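(* Assume that $d\ge2$ and that $\beta,D,b,K$ satisfy hypotheses (i)–(v) listed in the context. Let $T>0$, $Q_T=(0,T)\times\mathbb R^d$, let $u_0\in\mathcal P\cap L^\infty$, and let $u\in L^\infty(Q_T)\cap L^1(Q_T)$ be the solution (specified in the context) to $$\frac{\partial u}{\partial t}-\Delta\beta(u)+\mathrm{div}\big((D\,b(u)+K*u)\,u\big)=0,\qquad u(0,x)=u_0(x).$$ Let $v_1,v_2\in L^1(Q_T)\cap L^\infty(Q_T)$ be two distributional solutions to the linear equation $$\frac{\partial v}{\partial t}-\Delta\Big(\frac{\beta(u)}{u}\,v\Big)+\mathrm{div}\big((D\,b(u)+K*u)\,v\big)=0\ \text{ in }\mathcal D'((0,T)\times\mathbb R^d),\qquad v(0)=v_0,$$ (with the same $v_0$) such that $$\lim_{t\downarrow 0}\ \operatorname*{ess\,sup}_{s\in(0,t)}\int_{\mathbb R^d}(v_1(s,x)-v_2(s,x))\psi(x)\,dx=0,\qquad\forall\psi\in C_0^\infty(\mathbb R^d).$$ Then $v_1\equiv v_2$.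
   Context: Notation. $L^p=L^p(\mathbb R^d)$; $H^1=H^1(\mathbb R^d)$ and $H^{-1}$ is its dual; $*$ is convolution in the space variable; $B_1=\{x\in\mathbb R^d:|x|\le 1\}$, $B_1^c=\{x\in\mathbb R^d:|x|>1\}$; $f^-$ denotes the negative part of $f$; $C_0^\infty$ denotes smooth functions with compact support. $$\mathcal P=\Big\{u\in L^1(\mathbb R^d):\ u\ge 0\text{ a.e. in }\mathbb R^d,\ \int_{\mathbb R^d}u(x)\,dx=1\Big\}.$$ Hypotheses on $\beta:\mathbb R\to\mathbb R$, $D:\mathbb R^d\to\mathbb R^d$, $b:\mathbb R\to\mathbb R$, $K:\mathbb R^d\to\mathbb R^d$: (i) $\beta\in C^1(\mathbb R)$, $\beta(0)=0$, and there is $\alpha>0$ with $\beta'(r)\ge\alpha$ for all $r\in\mathbb R$. (ii) $D\in L^\infty(\mathbb R^d;\mathbb R^d)\cap L^2(\mathbb R^d;\mathbb R^d)$ and $(\mathrm{div}\,D)^-=0$ (that is, $\mathrm{div}\,D\ge 0$ in the sense of distributions). (iii) $b\in C^1(\mathbb R)$, $b(r)\ge 0$ for all $r\in\mathbb R$. (iv) $K\in C^1(\mathbb R^d\setminus\{0\};\mathbb R^d)\cap L^1(B_1;\mathbb R^d)\cap L^p(B_1^c;\mathbb R^d)$ for some $1\le p\le 2$, $(\mathrm{div}\,K)^-\in L^\infty(\mathbb R^d)$ (with $\mathrm{div}\,K$ the divergence on $\mathbb R^d\setminus\{0\}$), and the function $x\mapsto (K(x)\cdot x)^-|x|^{-1}$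 belongs to $L^\infty(B_1)$. (v) $K\in L^\infty(B_1^c;\mathbb R^d)$. The solution $u$. A function $u:[0,\infty)\to L^2$ is a weak solution of the nonlinear Cauchy problem with datum $u_0$ if: $u\in C([0,\infty);H^{-1})$ and $\frac{du}{dt}\in L^2(0,T;H^{-1})$ for all $T>0$; $\beta(u)\in L^2(0,T;H^1)$ and $D\,b(u)u+(K*u)u\in L^2(0,T;L^2)$ for all $T>0$; for all $\varphi\in H^1$ and a.e. $t>0$, $${}_{H^{-1}}\Big(\frac{du}{dt}(t),\varphi\Big)_{H^1}+\int_{\mathbb R^d}\Big(\nabla_x\beta(u(t,x))-\big(D(x)b(u(t,x))+(K*u(t,\cdot))(x)\big)u(t,x)\Big)\cdot\nabla\varphi(x)\,dx=0;$$ and $u(0,\cdot)=u_0$. The solution $u$ in the claim is the unique weak solution with $u(t)\in\mathcal P$ for all $t\ge 0$ and $u\in L^2(0,T;H^1)\cap L^\infty((0,T)\times\mathbb R^d)$ for all $T>0$ (it exists and is unique for every $u_0\in\mathcal P\cap L^\infty$ under (i)–(iv)). Linear equation. The quotient $\beta(u)/u$ is understood as $\beta'(0)$ where $u=0$. Let $v_0\in L^1_{\rm loc}(\mathbb R^d)$. A function $v\in L^1(Q_T)\cap L^\infty(Q_T)$ is a distributional solution of the linear equation with $v(0)=v_0$ if for all $\varphi\in C_0^\infty([0,T)\times\mathbb R^d)$, $$\int_{Q_T}v\Big(\frac{\partial\varphi}{\partial t}+\frac{\beta(u)}{u}\Delta\varphi+(D\,b(u)+K*u)\cdot\nabla\varphi\Big)\,dt\,dx+\int_{\mathbb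 R^d}v_0(x)\varphi(0,x)\,dx=0.$$ *)

theory Defs
  imports "HOL-Analysis.Analysis" "HOL-Probability.Essential_Supremum"
begin

text \<open>Continuous differentiability of order \<open>k\<close> on an open set \<open>S\<close>, through partial derivatives.\<close>

fun Ck_on :: "nat \<Rightarrow> 'a::euclidean_space set \<Rightarrow> ('a \<Rightarrow> 'b::real_normed_vector) \<Rightarrow> bool" where
  "Ck_on 0 S f \<longleftrightarrow> continuous_on S f"
| "Ck_on (Suc k) S f \<longleftrightarrow> (\<forall>x\<in>S. f differentiable (at x)) \<and>
     (\<forall>i\<in>Basis. Ck_on k S (\<lambda>x. frechet_derivative f (at x) i))"

definition test_functions :: "'a::euclidean_space set \<Rightarrow> ('a \<Rightarrow> real) set" where
  "test_functions S = {\<phi>. (\<forall>k. Ck_on k UNIV \<phi>) \<and>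
     compact (closure {x. \<phi> x \<noteq> 0}) \<and> closure {x. \<phi> x \<noteq> 0} \<subseteq> S}"

definition grad :: "('a::euclidean_space \<Rightarrow> real) \<Rightarrow> 'a \<Rightarrow> 'a" where
  "grad f x = (\<Sum>i\<in>Basis. frechet_derivative f (at x) i *\<^sub>R i)"

definition divergence :: "('a::euclidean_space \<Rightarrow> 'a) \<Rightarrow> 'a \<Rightarrow> real" where
  "divergence F x = (\<Sum>i\<in>Basis. frechet_derivative F (at x) i \<bullet> i)"

definition laplacian :: "('a::euclidean_space \<Rightarrow> real) \<Rightarrow> 'a \<Rightarrow> real" where
  "laplacian f x = divergence (grad f) x"

definition neg_part :: "real \<Rightarrow> real" where
  "neg_part r = max 0 (- r)"

text \<open>The elements of all spaces below are functions, not classes of functions modulo equality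
  almost everywhere.\<close>

definition Lp :: "real \<Rightarrow> 'a measure \<Rightarrow> ('a \<Rightarrow> 'b::euclidean_space) set" where
  "Lp p M = {f \<in> borel_measurable M. integrable M (\<lambda>x. norm (f x) powr p)}"

definition Linf :: "'a measure \<Rightarrow> ('a \<Rightarrow> 'b::euclidean_space) set" where
  "Linf M = {f \<in> borel_measurable M. \<exists>C. AE x in M. norm (f x) \<le> C}"

definition L1_loc :: "('a::euclidean_space \<Rightarrow> real) set" where
  "L1_loc = {f. \<forall>S. compact S \<longrightarrow> f \<in> Lp 1 (lebesgue_on S)}"

definition prob_densities :: "('a::euclidean_space \<Rightarrow> real) set" where
  "prob_densities = {f \<in> Lp 1 lebesgue. (AE x in lebesgue. f x \<ge> 0) \<and> (LINT x|lebesgue. f x) = 1}"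

definition L2_norm :: "('a::euclidean_space \<Rightarrow> 'b::euclidean_space) \<Rightarrow> real" where
  "L2_norm f = sqrt (LINT x|lebesgue. (norm (f x))\<^sup>2)"

definition is_weak_grad :: "('a::euclidean_space \<Rightarrow> real) \<Rightarrow> ('a \<Rightarrow> 'a) \<Rightarrow> bool" where
  "is_weak_grad f g \<longleftrightarrow> (\<forall>\<phi>\<in>test_functions UNIV.
     (LINT x|lebesgue. f x *\<^sub>R grad \<phi> x) = - (LINT x|lebesgue. \<phi> x *\<^sub>R g x))"

definition H1 :: "('a::euclidean_space \<Rightarrow> real) set" where
  "H1 = {f \<in> Lp 2 lebesgue. \<exists>g\<in>Lp 2 lebesgue. is_weak_grad f g}"

text \<open>Meaningful for \<open>f \<in> H1\<close>, where it is determined up to a null set.\<close>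

definition weak_grad :: "('a::euclidean_space \<Rightarrow> real) \<Rightarrow> 'a \<Rightarrow> 'a" where
  "weak_grad f = (SOME g. g \<in> Lp 2 lebesgue \<and> is_weak_grad f g)"

definition H1_norm :: "('a::euclidean_space \<Rightarrow> real) \<Rightarrow> real" where
  "H1_norm f = sqrt ((L2_norm f)\<^sup>2 + (L2_norm (weak_grad f))\<^sup>2)"

text \<open>The dual of \<open>H1\<close>. Only the values of a functional on \<open>H1\<close> matter.\<close>

definition H_minus1 :: "(('a::euclidean_space \<Rightarrow> real) \<Rightarrow> real) set" where
  "H_minus1 = {l.
     (\<forall>f\<in>H1. \<forall>g\<in>H1. \<forall>a b. l (\<lambda>x. a * f x + b * g x) = a * l f + b * l g) \<and>
     (\<exists>C. \<forall>f\<in>H1. \<bar>l f\<bar> \<le> C * H1_norm f)}"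

definition H_minus1_norm :: "(('a::euclidean_space \<Rightarrow> real) \<Rightarrow> real) \<Rightarrow> real" where
  "H_minus1_norm l = (SUP f\<in>{f \<in> H1. H1_norm f \<le> 1}. \<bar>l f\<bar>)"

definition L2_embed :: "('a::euclidean_space \<Rightarrow> real) \<Rightarrow> ('a \<Rightarrow> real) \<Rightarrow> real" where
  "L2_embed f = (\<lambda>\<phi>. LINT x|lebesgue. f x * \<phi> x)"

text \<open>The Bochner space of square integrable functions on \<open>(0,T)\<close> with values in the function
  space \<open>X\<close> with norm \<open>N\<close>: strongly measurable (an a.e. limit of simple functions) with square
  integrable norm. Differences are pointwise.\<close>

definition L2_Bochner ::
  "real \<Rightarrow> ('a \<Rightarrow> 'b::minus) set \<Rightarrow> (('a \<Rightarrow> 'b) \<Rightarrow> real) \<Rightarrow> (real \<Rightarrow> 'a \<Rightarrow> 'b) set" where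
  "L2_Bochner T X N = {w.
     (AE t in lebesgue_on {0<..<T}. w t \<in> X) \<and>
     (\<exists>s. (\<forall>n. simple_function (lebesgue_on {0<..<T}) (s n) \<and> (\<forall>t\<in>{0<..<T}. s n t \<in> X)) \<and>
          (AE t in lebesgue_on {0<..<T}. (\<lambda>n::nat. N (s n t - w t)) \<longlonglongrightarrow> 0)) \<and>
     integrable (lebesgue_on {0<..<T}) (\<lambda>t. (N (w t))\<^sup>2)}"

definition conv :: "('a::euclidean_space \<Rightarrow> 'a) \<Rightarrow> ('a \<Rightarrow> real) \<Rightarrow> 'a \<Rightarrow> 'a" where
  "conv K f x = (LINT y|lebesgue. f y *\<^sub>R K (x - y))"

text \<open>\<open>w\<close> is the derivative of \<open>u\<close> in the sense of distributions on \<open>(0,T)\<close> with values in the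
  dual of \<open>H1\<close>. The identity between two elements of the dual is evaluated at each \<open>\<phi> \<in> H1\<close>.\<close>

definition is_time_deriv :: "real \<Rightarrow> (real \<Rightarrow> 'a::euclidean_space \<Rightarrow> real) \<Rightarrow>
    (real \<Rightarrow> ('a \<Rightarrow> real) \<Rightarrow> real) \<Rightarrow> bool" where
  "is_time_deriv T u w \<longleftrightarrow> (\<forall>\<eta>\<in>test_functions {0<..<T}. \<forall>\<phi>\<in>H1.
     (LINT t|lebesgue_on {0<..<T}. deriv \<eta> t * L2_embed (u t) \<phi>) =
     - (LINT t|lebesgue_on {0<..<T}. \<eta> t * w t \<phi>))"

definition weak_solution ::
  "(real \<Rightarrow> real) \<Rightarrow> ('a::euclidean_space \<Rightarrow> 'a) \<Rightarrow> (real \<Rightarrow> real) \<Rightarrow> ('a \<Rightarrow> 'a) \<Rightarrow>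
   ('a \<Rightarrow> real) \<Rightarrow> (real \<Rightarrow> 'a \<Rightarrow> real) \<Rightarrow> bool" where
  "weak_solution \<beta> D b K u0 u \<longleftrightarrow>
     (\<forall>t\<ge>0. u t \<in> Lp 2 lebesgue) \<and>
     (\<forall>t\<ge>0. ((\<lambda>s. H_minus1_norm (L2_embed (u s) - L2_embed (u t))) \<longlongrightarrow> 0) (at t within {0..})) \<and>
     (\<forall>T>0. (\<lambda>t x. \<beta> (u t x)) \<in> L2_Bochner T H1 H1_norm) \<and>
     (\<forall>T>0. (\<lambda>t x. (b (u t x) * u t x) *\<^sub>R D x + u t x *\<^sub>R conv K (u t) x)
              \<in> L2_Bochner T (Lp 2 lebesgue) L2_norm) \<and>
     (\<exists>w. (\<forall>T>0. w \<in> L2_Bochner T H_minus1 H_minus1_norm \<and> is_time_deriv T u w) \<and>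
          (\<forall>\<phi>\<in>H1. AE t in lebesgue_on {0<..}.
             w t \<phi> + (LINT x|lebesgue.
               (weak_grad (\<lambda>y. \<beta> (u t y)) x - u t x *\<^sub>R (b (u t x) *\<^sub>R D x + conv K (u t) x))
                 \<bullet> weak_grad \<phi> x) = 0)) \<and>
     (AE x in lebesgue. u 0 x = u0 x)"

text \<open>The class in which the Cauchy problem has a unique solution. As an element of
  \<open>L\<^sup>\<infinity>((0,T) \<times> \<real>\<^sup>d)\<close>, \<open>u\<close> is jointly measurable.\<close>

definition density_solution ::
  "(real \<Rightarrow> real) \<Rightarrow> ('a::euclidean_space \<Rightarrow> 'a) \<Rightarrow> (real \<Rightarrow> real) \<Rightarrow> ('a \<Rightarrow> 'a) \<Rightarrow>
   ('a \<Rightarrow> real) \<Rightarrow> (real \<Rightarrow> 'a \<Rightarrow> real) \<Rightarrow> bool" where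
  "density_solution \<beta> D b K u0 u \<longleftrightarrow> weak_solution \<beta> D b K u0 u \<and>
     (\<forall>t\<ge>0. u t \<in> prob_densities) \<and>
     (\<forall>T>0. u \<in> L2_Bochner T H1 H1_norm \<and>
        (\<lambda>(t, x). u t x) \<in> Linf (lebesgue_on ({0<..<T} \<times> UNIV)))"

definition beta_quot :: "(real \<Rightarrow> real) \<Rightarrow> real \<Rightarrow> real" where
  "beta_quot \<beta> r = (if r = 0 then deriv \<beta> 0 else \<beta> r / r)"

text \<open>Test functions on \<open>[0,T) \<times> \<real>\<^sup>d\<close>, which need not vanish at time \<open>0\<close>, are the restrictions of
  test functions on \<open>(-\<infinity>,T) \<times> \<real>\<^sup>d\<close>.\<close>

definition linear_solution ::
  "real \<Rightarrow> (real \<Rightarrow> real) \<Rightarrow> ('a::euclidean_space \<Rightarrow> 'a) \<Rightarrow> (real \<Rightarrow> real) \<Rightarrow> ('a \<Rightarrow> 'a) \<Rightarrow>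
   (real \<Rightarrow> 'a \<Rightarrow> real) \<Rightarrow> ('a \<Rightarrow> real) \<Rightarrow> (real \<times> 'a \<Rightarrow> real) \<Rightarrow> bool" where
  "linear_solution T \<beta> D b K u v0 v \<longleftrightarrow>
     v \<in> Lp 1 (lebesgue_on ({0<..<T} \<times> UNIV)) \<and>
     v \<in> Linf (lebesgue_on ({0<..<T} \<times> UNIV)) \<and>
     (\<forall>\<phi>\<in>test_functions ({..<T} \<times> UNIV).
        (LINT (t, x)|lebesgue_on ({0<..<T} \<times> UNIV). v (t, x) *
           (deriv (\<lambda>s. \<phi> (s, x)) t
            + beta_quot \<beta> (u t x) * laplacian (\<lambda>y. \<phi> (t, y)) x
            + (b (u t x) *\<^sub>R D x + conv K (u t) x) \<bullet> grad (\<lambda>y. \<phi> (t, y)) x))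
        + (LINT x|lebesgue. v0 x * \<phi> (0, x)) = 0)"

end

theory Submission
  imports Defs "HOL-Probability.Characteristic_Functions"
begin

text \<open>
  The difference \<open>v\<close> of two solutions belongs to \<open>L\<^sup>1 \<inter> L\<^sup>\<infinity>\<close> and solves
  \<open>\<partial>\<^sub>t v = \<Delta>(a v) - div(B v)\<close> with zero initial datum, where \<open>a = \<beta>(u)/u\<close> and
  \<open>B = D b(u) + K * u\<close>. The proof rests on two properties of the coefficients: \<open>a\<close> lies between two
  positive constants, by the mean value theorem, and \<open>B\<close> is bounded, because \<open>K\<close> is integrable on the
  unit ball and bounded outside it, while \<open>u(t)\<close> is bounded and integrable.

  Formally, testing the equation with \<open>(1 - \<Delta>)\<^sup>-\<^sup>1 v\<close> gives
  \<open>1/2 d/dt \<parallel>v\<parallel>\<^sup>2 = - \<integral> a v\<^sup>2 + lower order terms\<close> for the norm of the dual of \<open>H\<^sup>1\<close>. The first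
  term controls the \<open>L\<^sup>2\<close> norm of \<open>v\<close>, the other terms are absorbed by Young's inequality, and
  Gronwall's lemma yields \<open>v = 0\<close>. The argument is carried out here frequency by frequency, so that \<open>v\<close>
  need not be regularised:

  \<^item> As \<open>v\<close> is integrable, the cutoff in the test functions \<open>\<eta>(t) \<chi>(\<epsilon>|x|\<^sup>2) cos(\<xi> \<bullet> x + \<theta>)\<close> can be removed
    by dominated convergence (\<open>tested_with_wave\<close>). Hence
    \<open>V(t) = \<integral> v(t,x) cos(\<xi> \<bullet> x + \<theta>) dx\<close> is, for almost every \<open>t\<close>, the primitive vanishing at \<open>0\<close> of an
    integrable function \<open>G\<close>, which consists of \<open>-|\<xi>|\<^sup>2\<close> times the transform \<open>A\<close> of \<open>a v\<close> and of a first
    order part (\<open>fourier_v_eq_primitive\<close>, \<open>flux_spectral\<close>).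

  \<^item> Every such primitive satisfies \<open>\<mu> \<integral> e\<^sup>-\<^sup>\<mu>\<^sup>t V\<^sup>2 \<le> 2 \<integral> e\<^sup>-\<^sup>\<mu>\<^sup>t V G\<close> on \<open>(0,T)\<close>
    (\<open>weighted_energy\<close>). The exponential weight takes the place of Gronwall's lemma.

  \<^item> This is divided by \<open>1 + |\<xi>|\<^sup>2\<close>. Since \<open>|\<xi>|\<^sup>2 / (1 + |\<xi>|\<^sup>2) = 1 - 1 / (1 + |\<xi>|\<^sup>2)\<close>, the product \<open>V G\<close>
    contributes \<open>- V A\<close> plus terms that Young's inequality bounds by a small multiple of the power
    spectra of \<open>a v\<close> and \<open>B v\<close> and a large multiple of \<open>V\<^sup>2 / (1 + |\<xi>|\<^sup>2)\<close>. For a suitable rate \<open>\<mu>\<close> the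
    latter cancels against the left-hand side (\<open>spectral_energy_bound\<close>).

  \<^item> Integration over all frequencies and the Plancherel identity (\<open>Plancherel\<close>) turn what is left into
    \<open>0 \<le> \<integral>\<integral> e\<^sup>-\<^sup>\<mu>\<^sup>t (- 2 a + \<kappa> a\<^sup>2 + \<kappa> |B|\<^sup>2) v\<^sup>2\<close>. For small \<open>\<kappa>\<close> the bracket is at most \<open>- \<alpha>\<close>, so
    \<open>v = 0\<close> (\<open>solution_is_zero\<close>).
\<close>

section \<open>Smooth functions with compact support\<close>

text \<open>
  The functions \<open>exp(-1/x) / x\<^sup>n\<close>, extended by \<open>0\<close>. The derivative of a member is a linear combination of
  two other members, so the whole family is handled at once.\<close>
definition flat :: "nat \<Rightarrow> real \<Rightarrow> real" where
  "flat n x = (if x \<le> 0 then 0 else exp (- inverse x) * inverse x ^ n)"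

lemma flat_nonneg: "0 \<le> flat n x"
  by (simp add: flat_def)

lemma flat_0_le_1: "flat 0 x \<le> 1"
  by (simp add: flat_def)

text \<open>
  The exponential series beats the power \<open>x\<^sup>-\<^sup>n\<close>. The spare factor \<open>\<bar>x\<bar>\<close> is what makes all difference
  quotients at the origin tend to \<open>0\<close>.\<close>
lemma flat_le: "flat n x \<le> fact (Suc n) * \<bar>x\<bar>"
proof (cases "x \<le> 0")
  case False
  define y where "y = inverse x"
  have y: "y > 0" using False by (simp add: y_def)
  have "(\<Sum>k\<in>{Suc n}. y ^ k /\<^sub>R fact k) \<le> exp y"
    unfolding exp_def using y by (intro sum_le_suminf summable_exp_generic) auto
  then have "y ^ Suc n / fact (Suc n) \<le> exp y"
    by (simp add: divide_inverse_commute del: fact_Suc power_Suc)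
  then have "y ^ Suc n \<le> fact (Suc n) * exp y"
    by (simp only: pos_divide_le_eq[OF fact_gt_zero] mult.commute)
  then have "exp (- y) * y ^ Suc n \<le> fact (Suc n)"
    by (simp add: exp_minus field_simps)
  then have "exp (- y) * y ^ n \<le> fact (Suc n) * x"
    using False y by (simp add: y_def field_simps)
  then show ?thesis using False by (simp add: flat_def y_def)
qed (auto simp: flat_def mult_le_0_iff simp del: fact_Suc)

lemma flat_has_derivative:
  "(flat n has_real_derivative flat (n + 2) x - n * flat (Suc n) x) (at x)"
proof -
  consider "x < 0" | "x = 0" | "x > 0" by linarith
  then show ?thesis
  proof cases
    case 1
    have "((\<lambda>x. 0) has_real_derivative 0) (at x)" by simp
    then have "(flat n has_real_derivative 0) (at x)"
      by (rule has_field_derivative_transform_within_open[of _ _ _ "{..<0}"])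
        (use 1 in \<open>auto simp: flat_def\<close>)
    then show ?thesis using 1 by (simp add: flat_def)
  next
    case 2
    have "((\<lambda>h. flat (Suc n) h) \<longlongrightarrow> 0) (at 0)"
    proof (rule Lim_null_comparison)
      show "\<forall>\<^sub>F h in at 0. norm (flat (Suc n) h) \<le> fact (Suc (Suc n)) * \<bar>h\<bar>"
        using flat_le[of "Suc n"] flat_nonneg[of "Suc n"] by (intro always_eventually) auto
      show "((\<lambda>h::real. fact (Suc (Suc n)) * \<bar>h\<bar>) \<longlongrightarrow> 0) (at 0)"
        by (rule tendsto_eq_intros | simp)+
    qed
    moreover have "(flat n (0 + h) - flat n 0) / h = flat (Suc n) h" if "h \<noteq> 0" for h
      using that by (auto simp: flat_def field_simps)
    ultimately have "(flat n has_real_derivative 0) (at 0)"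
      unfolding DERIV_def
      by (subst filterlim_cong[OF refl refl, of _ "\<lambda>h. flat (Suc n) h"])
        (auto simp: eventually_at_filter)
    then show ?thesis using 2 by (simp add: flat_def)
  next
    case 3
    have "((\<lambda>x. exp (- inverse x) * inverse x ^ n) has_real_derivative
        flat (n + 2) x - n * flat (Suc n) x) (at x)"
      using 3 by (auto intro!: derivative_eq_intros simp: flat_def field_simps power2_eq_square)
        (cases n; simp add: field_simps)
    then show ?thesis
      by (rule has_field_derivative_transform_within_open[of _ _ _ "{0<..}"])
        (use 3 in \<open>auto simp: flat_def\<close>)
  qed
qed

text \<open>
  A class of functions that is visibly closed under partial derivatives. Membership therefore gives
  differentiability of every order without a formula for any derivative. The rule \<open>primitive\<close> admits
  functions that are known through their derivative alone.\<close>
inductive smooth_expr :: "('a::euclidean_space \<Rightarrow> real) \<Rightarrow> bool" where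
  const: "smooth_expr (\<lambda>_. c)"
| linear: "bounded_linear l \<Longrightarrow> smooth_expr l"
| add: "smooth_expr f \<Longrightarrow> smooth_expr g \<Longrightarrow> smooth_expr (\<lambda>x. f x + g x)"
| mult: "smooth_expr f \<Longrightarrow> smooth_expr g \<Longrightarrow> smooth_expr (\<lambda>x. f x * g x)"
| flat: "smooth_expr f \<Longrightarrow> smooth_expr (\<lambda>x. flat n (f x))"
| cos: "smooth_expr f \<Longrightarrow> smooth_expr (\<lambda>x. cos (f x + c))"
| primitive: "smooth_expr f \<Longrightarrow> (\<And>s. (h has_real_derivative h' s) (at s)) \<Longrightarrow>
    smooth_expr (\<lambda>x. h' (f x)) \<Longrightarrow> smooth_expr (\<lambda>x. h (f x))"

lemma smooth_expr_cmult: "smooth_expr f \<Longrightarrow> smooth_expr (\<lambda>x. c * f x)"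
  by (intro smooth_expr.mult smooth_expr.const)

lemma smooth_expr_diff: "smooth_expr f \<Longrightarrow> smooth_expr g \<Longrightarrow> smooth_expr (\<lambda>x. f x - g x)"
  using smooth_expr.add[of f "\<lambda>x. -1 * g x"] smooth_expr_cmult[of g "-1"] by simp

lemma smooth_expr_sum: "finite I \<Longrightarrow> (\<And>i. i \<in> I \<Longrightarrow> smooth_expr (f i)) \<Longrightarrow> smooth_expr (\<lambda>x. \<Sum>i\<in>I. f i x)"
  by (induction I rule: finite_induct) (auto intro: smooth_expr.const smooth_expr.add)

lemma smooth_expr_has_derivative:
  assumes "smooth_expr f"
  shows "\<exists>f'. (\<forall>x. (f has_derivative f' x) (at x)) \<and> (\<forall>i. smooth_expr (\<lambda>x. f' x i))"
  using assms
proof induction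
  case (const c)
  show ?case
    by (rule exI[of _ "\<lambda>_ _. 0"]) (auto intro: smooth_expr.const)
next
  case (linear l)
  then show ?case
    by (intro exI[of _ "\<lambda>_. l"]) (auto intro: smooth_expr.const bounded_linear_imp_has_derivative)
next
  case (add f g)
  then obtain f' g' where "\<forall>x. (f has_derivative f' x) (at x)" "\<forall>i. smooth_expr (\<lambda>x. f' x i)"
    "\<forall>x. (g has_derivative g' x) (at x)" "\<forall>i. smooth_expr (\<lambda>x. g' x i)" by auto
  then show ?case
    by (intro exI[of _ "\<lambda>x h. f' x h + g' x h"]) (auto intro!: smooth_expr.add has_derivative_add)
next
  case (mult f g)
  then obtain f' g' where "\<forall>x. (f has_derivative f' x) (at x)" "\<forall>i. smooth_expr (\<lambda>x. f' x i)"
    "\<forall>x. (g has_derivative g' x) (at x)" "\<forall>i. smooth_expr (\<lambda>x. g' x i)" by auto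
  then show ?case using mult
    by (intro exI[of _ "\<lambda>x h. f x * g' x h + f' x h * g x"])
      (auto intro!: smooth_expr.add smooth_expr.mult has_derivative_mult)
next
  case (flat f n)
  then obtain f' where f': "\<forall>x. (f has_derivative f' x) (at x)" "\<forall>i. smooth_expr (\<lambda>x. f' x i)"
    by auto
  define h' where "h' = (\<lambda>s. flat (n + 2) s - n * flat (Suc n) s)"
  have "((\<lambda>x. flat n (f x)) has_derivative (\<lambda>h. h' (f x) * f' x h)) (at x)" for x
    using has_derivative_compose[OF f'(1)[rule_format] flat_has_derivative[of n, unfolded has_field_derivative_def]]
    by (simp add: h'_def)
  moreover have "smooth_expr (\<lambda>x. h' (f x))"
    unfolding h'_def using flat by (intro smooth_expr_diff smooth_expr_cmult smooth_expr.flat)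
  ultimately show ?case using f'
    by (intro exI[of _ "\<lambda>x h. h' (f x) * f' x h"]) (auto intro!: smooth_expr.mult)
next
  case (cos f c)
  then obtain f' where f': "\<forall>x. (f has_derivative f' x) (at x)" "\<forall>i. smooth_expr (\<lambda>x. f' x i)"
    by auto
  have "((\<lambda>x. cos (f x + c)) has_derivative (\<lambda>h. cos (f x + (c + pi / 2)) * f' x h)) (at x)" for x
    using f'(1) by (auto intro!: derivative_eq_intros simp: cos_add sin_add algebra_simps fun_eq_iff)
  moreover have "smooth_expr (\<lambda>x. cos (f x + (c + pi / 2)))"
    using cos by (intro smooth_expr.cos)
  ultimately show ?case using f'
    by (intro exI[of _ "\<lambda>x h. cos (f x + (c + pi / 2)) * f' x h"]) (auto intro!: smooth_expr.mult)
next
  case (primitive f h h')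
  then obtain f' where f': "\<forall>x. (f has_derivative f' x) (at x)" "\<forall>i. smooth_expr (\<lambda>x. f' x i)"
    by auto
  have "((\<lambda>x. h (f x)) has_derivative (\<lambda>v. h' (f x) * f' x v)) (at x)" for x
    using has_derivative_compose[OF f'(1)[rule_format] primitive.hyps(2)[unfolded has_field_derivative_def]]
    by simp
  then show ?case using f' primitive
    by (intro exI[of _ "\<lambda>x v. h' (f x) * f' x v"]) (auto intro!: smooth_expr.mult)
qed

lemma smooth_expr_Ck: "smooth_expr f \<Longrightarrow> Ck_on k UNIV f"
proof (induction k arbitrary: f)
  case 0
  then obtain f' where "\<forall>x. (f has_derivative f' x) (at x)"
    using smooth_expr_has_derivative by blast
  then show ?case
    by (auto intro!: continuous_at_imp_continuous_on has_derivative_continuous)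
next
  case (Suc k)
  then obtain f' where f': "\<forall>x. (f has_derivative f' x) (at x)" "\<forall>i. smooth_expr (\<lambda>x. f' x i)"
    using smooth_expr_has_derivative by blast
  have "frechet_derivative f (at x) = f' x" for x
    using f'(1) by (metis frechet_derivative_at)
  then show ?case using f' Suc.IH by (auto simp: differentiable_def)
qed

section \<open>Primitives and weak derivatives in time\<close>

text \<open>
  A smooth minorant of the indicator of \<open>(r, s)\<close>. The summand \<open>-1\<close> moves the right end of the support to
  \<open>s - 1/n\<close>, so that even for \<open>s = T\<close> the support stays away from the final time.\<close>
definition bump :: "real \<Rightarrow> real \<Rightarrow> real \<Rightarrow> real \<Rightarrow> real" where
  "bump r s n t = flat 0 (n * (t - r)) * flat 0 (n * (s - t) - 1)"

lemma flat_continuous: "continuous_on S (flat n)"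
  using flat_has_derivative by (meson DERIV_continuous continuous_at_imp_continuous_on)

lemma flat_measurable [measurable]: "flat n \<in> borel_measurable borel"
  by (intro borel_measurable_continuous_onI flat_continuous)

lemma bump_continuous: "continuous_on S (bump r s n)"
  unfolding bump_def by (intro continuous_intros continuous_on_compose2[OF flat_continuous[of UNIV]]) auto

lemma bump_measurable [measurable]: "bump r s n \<in> borel_measurable borel"
  by (intro borel_measurable_continuous_onI bump_continuous)

lemma bump_nonneg: "0 \<le> bump r s n t"
  by (simp add: bump_def flat_nonneg)

lemma bump_le_1: "bump r s n t \<le> 1"
  unfolding bump_def by (intro mult_le_one flat_0_le_1 flat_nonneg)

lemma bump_eq_0: "n > 0 \<Longrightarrow> t \<notin> {r..s - 1/n} \<Longrightarrow> bump r s n t = 0"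
  by (auto simp: bump_def flat_def field_simps mult_le_0_iff)

lemma smooth_expr_bump:
  "smooth_expr f \<Longrightarrow> smooth_expr (\<lambda>x. bump r s n (f x))"
  unfolding bump_def
  by (rule smooth_expr.mult[OF smooth_expr.flat[OF smooth_expr_cmult[OF smooth_expr_diff[OF _ smooth_expr.const]]]
        smooth_expr.flat[OF smooth_expr_diff[OF smooth_expr_cmult[OF smooth_expr_diff[OF smooth_expr.const]] smooth_expr.const]]])

lemma bump_tendsto: "(\<lambda>n. bump r s (real (Suc n)) t) \<longlonglongrightarrow> indicator {r<..<s} t"
proof (cases "t \<in> {r<..<s}")
  case True
  have 1: "(\<lambda>n. flat 0 (f n)) \<longlonglongrightarrow> 1" if "filterlim f at_top sequentially" for f :: "nat \<Rightarrow> real"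
  proof -
    have "(\<lambda>n. exp (- inverse (f n))) \<longlonglongrightarrow> exp (- 0)"
      using tendsto_inverse_0_at_top[OF that] by (intro tendsto_intros)
    moreover have "\<forall>\<^sub>F n in sequentially. exp (- inverse (f n)) = flat 0 (f n)"
      using that[unfolded filterlim_at_top_dense, rule_format, of 0]
      by eventually_elim (simp add: flat_def)
    ultimately show ?thesis using tendsto_cong by force
  qed
  have n: "filterlim (\<lambda>n. real (Suc n)) at_top sequentially"
    using filterlim_real_sequentially filterlim_sequentially_Suc by blast
  have 2: "filterlim (\<lambda>n. real (Suc n) * c) at_top sequentially" if "c > 0" for c
    using filterlim_tendsto_pos_mult_at_top[OF tendsto_const that n] by (simp add: mult.commute)
  have 3: "filterlim (\<lambda>n. real (Suc n) * c - 1) at_top sequentially" if "c > 0" for c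
    using filterlim_tendsto_add_at_top[OF tendsto_const[of "-1"] 2[OF that]] by simp
  have "(\<lambda>n. bump r s (real (Suc n)) t) \<longlonglongrightarrow> 1 * 1"
    unfolding bump_def by (intro tendsto_mult 1 2 3) (use True in auto)
  then show ?thesis using True by simp
next
  case False
  have "bump r s (real (Suc n)) t = 0" for n
  proof (cases "t \<le> r")
    case True
    then have "real (Suc n) * (t - r) \<le> 0" by (intro mult_nonneg_nonpos) auto
    then show ?thesis by (simp add: bump_def flat_def)
  next
    case False
    then have "real (Suc n) * (s - t) \<le> 0"
      using \<open>t \<notin> {r<..<s}\<close> by (intro mult_nonneg_nonpos) auto
    then show ?thesis by (simp add: bump_def flat_def)
  qed
  then show ?thesis using False by simp
qed

text \<open>
  A compactly supported function whose derivative is a given bump at all positive times. The primitive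
  of the bump alone would be constant at the far left or the far right. A multiple of a fixed bump at
  negative times is subtracted to make the total integral \<open>0\<close>. The function need not vanish at time \<open>0\<close>,
  which is how the initial condition enters later.\<close>
lemma time_test_function:
  assumes "0 \<le> r" "0 < n"
  obtains \<eta> \<eta>' where "\<And>t. (\<eta> has_real_derivative \<eta>' t) (at t)" "continuous_on UNIV \<eta>'"
    "smooth_expr (\<lambda>z::real \<times> 'a::euclidean_space. \<eta> (fst z))"
    "\<And>t. t \<notin> {-3..max 0 (s - 1/n)} \<Longrightarrow> \<eta> t = 0" "\<And>t. t > 0 \<Longrightarrow> \<eta>' t = bump r s n t"
proof -
  define e where "e = max 0 (s - 1/n)"
  \<comment> \<open>By the shift in \<open>bump\<close>, its support is \<open>[-2, -1]\<close>.\<close>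
  define q where "q = bump (-2) 0 1"
  have q0: "q t = 0" if "t \<notin> {-2..-1}" for t
    unfolding q_def using bump_eq_0[of 1 t "-2" 0] that by auto
  have p0: "bump r s n t = 0" if "t \<notin> {0..e}" for t
    using assms that by (intro bump_eq_0) (auto simp: e_def)
  define I where "I = (\<lambda>f. integral {-3..e} f :: real)"
  have e: "-3 < e" "0 \<le> e" by (auto simp: e_def)
  have "I q \<noteq> 0"
  proof
    assume "I q = 0"
    then have "\<forall>t\<in>{-3..e}. q t = 0"
      unfolding I_def q_def using e bump_continuous bump_nonneg
      by (subst (asm) integral_eq_0_iff) auto
    then have "q (-3/2) = 0" using e by auto
    then show False by (simp add: q_def bump_def flat_def)
  qed
  \<comment> \<open>The multiple of the bump at negative times for which the total integral vanishes.\<close>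
  define c where "c = I (bump r s n) / I q"
  define \<eta>' where "\<eta>' = (\<lambda>t. bump r s n t - c * q t)"
  define \<eta> where "\<eta> = (\<lambda>t. integral {-3..t} \<eta>')"
  have cont: "continuous_on S \<eta>'" for S
    unfolding \<eta>'_def q_def by (intro continuous_intros bump_continuous)
  have z: "\<eta>' t = 0" if "t \<notin> {-2..e}" for t
    unfolding \<eta>'_def using q0[of t] p0[of t] that e by auto
  have int: "f integrable_on {-3..t}" if "continuous_on UNIV f" for f :: "real \<Rightarrow> real" and t
    using that by (intro integrable_continuous_real) (auto intro: continuous_on_subset)
  have "I \<eta>' = I (bump r s n) - I (\<lambda>t. c * q t)"
    unfolding I_def \<eta>'_def q_def
    by (intro Henstock_Kurzweil_Integration.integral_diff int continuous_intros bump_continuous)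
  then have Ie: "I \<eta>' = 0"
    using \<open>I q \<noteq> 0\<close> by (simp add: I_def c_def)
  have low: "\<eta> t = 0" if "t < -2" for t
    unfolding \<eta>_def using that z by (subst Henstock_Kurzweil_Integration.integral_cong[of _ _ \<open>\<lambda>_. 0\<close>]) auto
  have "(\<eta> has_real_derivative \<eta>' t) (at t)" for t
  proof (cases "t < -2")
    case True
    have "((\<lambda>_. 0) has_real_derivative 0) (at t)" by simp
    then have "(\<eta> has_real_derivative 0) (at t)"
      by (rule has_field_derivative_transform_within_open[of _ _ _ "{..<-2}"]) (use True low in auto)
    then show ?thesis using z[of t] True by simp
  next
    case False
    have "(\<eta> has_real_derivative \<eta>' t) (at t within {-3..t+1})"
      unfolding \<eta>_def using False cont by (intro integral_has_real_derivative) auto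
    then show ?thesis using False
      by (subst (asm) at_within_interior) auto
  qed
  moreover have "smooth_expr (\<lambda>z::real \<times> 'a. \<eta> (fst z))"
  proof (rule smooth_expr.primitive[of fst])
    show f: "smooth_expr (fst :: real \<times> 'a \<Rightarrow> real)"
      by (rule smooth_expr.linear) (rule bounded_linear_fst)
    show "smooth_expr (\<lambda>z::real \<times> 'a. \<eta>' (fst z))"
      unfolding \<eta>'_def q_def by (rule smooth_expr_diff[OF smooth_expr_bump[OF f] smooth_expr_cmult[OF smooth_expr_bump[OF f]]])
  qed (fact calculation)
  moreover have "\<eta> t = 0" if "t \<notin> {-3..e}" for t
  proof (cases "t < -3")
    case False
    then have t: "e < t" using that by auto
    have "\<eta> t = I \<eta>' + integral {e..t} \<eta>'"
      unfolding \<eta>_def I_def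
      by (rule Henstock_Kurzweil_Integration.integral_combine[symmetric]) (use e t cont int in auto)
    also have "integral {e..t} \<eta>' = integral {e..t} (\<lambda>_. 0)"
      by (rule integral_spike[of "{e}"]) (use z in auto)
    finally show ?thesis using Ie by simp
  qed (use low in auto)
  moreover have "\<eta>' t = bump r s n t" if "t > 0" for t
    using q0[of t] that by (simp add: \<eta>'_def)
  ultimately show ?thesis
    using that[of \<eta> \<eta>'] cont unfolding e_def by blast
qed

text \<open>
  Bumps converge boundedly to indicators of open intervals, and these form an intersection-stable
  generator of the Borel sets.\<close>
lemma AE_zero_if_bump_integrals_zero:
  fixes Z :: "real \<Rightarrow> real"
  assumes Z: "integrable lborel Z" and Z0: "\<And>t. t \<notin> {0<..<T} \<Longrightarrow> Z t = 0"
    and bump: "\<And>r s n. 0 \<le> r \<Longrightarrow> s \<le> T \<Longrightarrow> 0 < n \<Longrightarrow> (LBINT t. Z t * bump r s n t) = 0"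
  shows "AE t in lborel. Z t = 0"
proof -
  have [measurable]: "Z \<in> borel_measurable borel" using Z by auto
  have base: "(LBINT t. indicator {r<..<s} t * Z t) = 0" for r s
  proof -
    define r' where "r' = max 0 r"
    define s' where "s' = min T s"
    have "(\<lambda>k. LBINT t. Z t * bump r' s' (real (Suc k)) t) \<longlonglongrightarrow> (LBINT t. Z t * indicator {r'<..<s'} t)"
    proof (rule integral_dominated_convergence[where w="\<lambda>t. \<bar>Z t\<bar>"])
      show "AE t in lborel. (\<lambda>k. Z t * bump r' s' (real (Suc k)) t) \<longlonglongrightarrow> Z t * indicator {r'<..<s'} t"
        by (intro AE_I2 tendsto_mult tendsto_const bump_tendsto)
      show "AE t in lborel. norm (Z t * bump r' s' (real (Suc k)) t) \<le> \<bar>Z t\<bar>" for k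
        using bump_nonneg bump_le_1 by (intro AE_I2) (auto simp: abs_mult intro!: mult_left_le)
    qed (use Z in auto)
    then have "(LBINT t. Z t * indicator {r'<..<s'} t) = 0"
      using bump[of r' s'] by (simp add: r'_def s'_def LIMSEQ_const_iff)
    moreover have "Z t * indicator {r'<..<s'} t = indicator {r<..<s} t * Z t" for t
      using Z0[of t] by (auto simp: indicator_def r'_def s'_def)
    ultimately show ?thesis by simp
  qed
  have int: "integrable lborel (\<lambda>t. indicator A t * Z t)" if "A \<in> sets borel" for A
    using integrable_real_mult_indicator[OF _ Z, of A] that by (simp add: mult.commute)
  have borel: "sets borel = sigma_sets UNIV (range (\<lambda>(a, b). {a<..<b :: real}))"
    by (subst borel_eq_box) (simp add: box_real[abs_def] case_prod_beta)
  have "(LBINT t. indicator A t * Z t) = 0" if "A \<in> sets borel" for A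
  proof -
    have st: "Int_stable (range (\<lambda>(a, b). {a<..<b :: real}))"
    proof (rule Int_stableI_image)
      show "\<exists>k\<in>UNIV. (case i of (a, b) \<Rightarrow> {a<..<b}) \<inter> (case j of (a, b) \<Rightarrow> {a<..<b :: real}) = (case k of (a, b) \<Rightarrow> {a<..<b})" for i j
        by (rule bexI[of _ "(max (fst i) (fst j), min (snd i) (snd j))"]) (auto simp: split: prod.splits)
    qed
    have A: "A \<in> sigma_sets UNIV (range (\<lambda>(a, b). {a<..<b :: real}))"
      using that borel by simp
    have G: "range (\<lambda>(a, b). {a<..<b :: real}) \<subseteq> Pow UNIV" by simp
    show ?thesis
      using A
    proof (induction rule: sigma_sets_induct_disjoint[OF st G, consumes 1, case_names basic empty compl union])
      case (basic A)
      then show ?case using base by auto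
    next
      case empty
      show ?case by simp
    next
      case (compl A)
      then have A: "A \<in> sets borel"
        by (simp add: borel)
      have "(LBINT t. Z t) = (LBINT t. indicator {0<..<T} t * Z t)"
        using Z0 by (intro Bochner_Integration.integral_cong) (auto simp: indicator_def)
      then have "(LBINT t. Z t) = 0" using base by simp
      moreover have "indicator (UNIV - A) t * Z t = Z t - indicator A t * Z t" for t
        by (auto simp: indicator_def)
      ultimately show ?case using compl int[OF A] Z by simp
    next
      case (union A)
      then have A: "A i \<in> sets borel" for i
        by (auto simp: borel)
      have "(\<integral>t\<in>(\<Union>i. A i). Z t \<partial>lborel) = (\<Sum>i. (\<integral>t\<in>A i. Z t \<partial>lborel))"
        using union(1) A int[of "\<Union>i. A i"]
        by (intro lebesgue_integral_countable_add) (auto simp: disjoint_family_on_def set_integrable_def)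
      then show ?case using union by (simp add: set_lebesgue_integral_def)
    qed
  qed
  then show ?thesis
    by (intro sigma_finite_measure.density_zero[OF sigma_finite_lborel Z]) (simp add: set_lebesgue_integral_def)
qed

abbreviation primitive :: "(real \<Rightarrow> real) \<Rightarrow> real \<Rightarrow> real" where
  "primitive H t \<equiv> (LBINT s. indicator {..t} s * H s)"

lemma integrable_indicator_mult:
  fixes f :: "'a \<Rightarrow> real"
  shows "integrable M f \<Longrightarrow> A \<in> sets M \<Longrightarrow> integrable M (\<lambda>x. indicator A x * f x)"
  using integrable_real_mult_indicator[of A M f] by (simp add: mult.commute)

lemma integrable_mult_bounded:
  fixes f g :: "'a \<Rightarrow> real"
  assumes f: "integrable M f" and g: "g \<in> borel_measurable M" and bd: "\<And>x. \<bar>g x\<bar> \<le> C"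
  shows "integrable M (\<lambda>x. f x * g x)"
proof (rule Bochner_Integration.integrable_bound[of _ "\<lambda>x. C * f x"])
  have "0 \<le> C" using bd[of undefined] by linarith
  then show "AE x in M. norm (f x * g x) \<le> norm (C * f x)"
    using bd by (intro AE_I2) (auto simp: abs_mult mult.commute[of "\<bar>f _\<bar>"] intro!: mult_right_mono)
qed (use f g in auto)

lemma integrable_indicator_Ioo: "integrable lborel (indicator {a<..<b} :: real \<Rightarrow> real)"
  using emeasure_bounded_finite[of "{a<..<b}"] by (simp add: integrable_indicator_iff)

lemma integrable_fst_times_snd:
  fixes f :: "'a::euclidean_space \<Rightarrow> real" and g :: "'b::euclidean_space \<Rightarrow> real"
  assumes f: "integrable lborel f" and g: "integrable lborel g"
  shows "integrable (lborel \<Otimes>\<^sub>M lborel) (\<lambda>z. f (fst z) * g (snd z))"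
proof (rule lborel_pair.Fubini_integrable)
  have [measurable]: "f \<in> borel_measurable borel" "g \<in> borel_measurable borel" using f g by auto
  show "(\<lambda>z. f (fst z) * g (snd z)) \<in> borel_measurable (lborel \<Otimes>\<^sub>M lborel)" by measurable
qed (use f g in \<open>auto simp: abs_mult\<close>)

lemma primitive_measurable [measurable]:
  assumes [measurable]: "H \<in> borel_measurable borel"
  shows "primitive H \<in> borel_measurable borel"
proof -
  have "(\<lambda>t. LBINT s. (if s \<le> t then H s else 0)) \<in> borel_measurable borel"
    by measurable
  also have "(\<lambda>t. LBINT s. (if s \<le> t then H s else 0)) = primitive H"
    by (intro ext Bochner_Integration.integral_cong) (auto simp: indicator_def)
  finally show ?thesis .
qed

lemma primitive_bound:
  assumes "integrable lborel H"
  shows "\<bar>primitive H t\<bar> \<le> (LBINT s. \<bar>H s\<bar>)"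
proof -
  have "\<bar>primitive H t\<bar> \<le> (LBINT s. \<bar>indicator {..t} s * H s\<bar>)"
    using integral_norm_bound[of lborel "\<lambda>s. indicator {..t} s * H s"] by simp
  also have "\<dots> \<le> (LBINT s. \<bar>H s\<bar>)"
    using assms by (intro integral_mono integrable_abs integrable_indicator_mult) (auto simp: indicator_def)
  finally show ?thesis .
qed

text \<open>
  A primitive of an integrable function is differentiable only almost everywhere. Exchanging the order
  of integration gives integration by parts without that fact.\<close>
lemma integral_by_parts_primitive:
  fixes H k k' :: "real \<Rightarrow> real"
  assumes H: "integrable lborel H" and H0: "\<And>s. s \<notin> {0<..<T} \<Longrightarrow> H s = 0"
    and k: "\<And>t. (k has_real_derivative k' t) (at t)" and k': "continuous_on UNIV k'"
  shows "(LBINT t. indicator {0<..<T} t * k' t * primitive H t) = (LBINT s. H s * (k T - k s))"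
proof -
  have [measurable]: "H \<in> borel_measurable borel" "k' \<in> borel_measurable borel"
    using H k' by (auto intro: borel_measurable_continuous_onI)
  define F where "F = (\<lambda>t s. indicator {0<..<T} t * k' t * (if s \<le> t then H s else 0))"
  have "bounded (k' ` {0..T})"
    using k' by (intro compact_imp_bounded compact_continuous_image) (auto intro: continuous_on_subset)
  then obtain C where "\<forall>y\<in>k' ` {0..T}. norm y \<le> C" unfolding bounded_iff by blast
  then have C: "\<And>t. t \<in> {0..T} \<Longrightarrow> \<bar>k' t\<bar> \<le> C" by auto
  have "integrable (lborel \<Otimes>\<^sub>M lborel) (\<lambda>(t, s). indicator {0<..<T} t * H s * (if t \<in> {0<..<T} \<and> s \<le> t then k' t else 0))"
  proof (unfold case_prod_beta, rule integrable_mult_bounded[of _ _ _ "max C 0"])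
    have "integrable (lborel \<Otimes>\<^sub>M lborel) (\<lambda>z. (indicator {0<..<T} (fst z) :: real) * H (snd z))"
      by (rule integrable_fst_times_snd[OF integrable_indicator_Ioo H])
    then show "integrable (lborel \<Otimes>\<^sub>M lborel) (\<lambda>z. (indicator {0<..<T} (fst z) :: real) * H (snd z))" .
    show "\<bar>if fst z \<in> {0<..<T} \<and> snd z \<le> fst z then k' (fst z) else 0\<bar> \<le> max C 0" for z
      using C[of "fst z"] by (cases "fst z \<in> {0<..<T} \<and> snd z \<le> fst z") auto
  qed auto
  moreover have "(\<lambda>(t, s). indicator {0<..<T} t * H s * (if t \<in> {0<..<T} \<and> s \<le> t then k' t else 0)) = case_prod F"
    by (auto simp: F_def fun_eq_iff indicator_def)
  ultimately have F: "integrable (lborel \<Otimes>\<^sub>M lborel) (case_prod F)" by simp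
  have "(LBINT t. indicator {0<..<T} t * k' t * primitive H t) = (LBINT t. (LBINT s. F t s))"
  proof (intro Bochner_Integration.integral_cong refl)
    fix t
    have "(LBINT s. F t s) = (LBINT s. indicator {0<..<T} t * k' t * (indicator {..t} s * H s))"
      by (intro Bochner_Integration.integral_cong) (auto simp: F_def)
    then show "indicator {0<..<T} t * k' t * primitive H t = (LBINT s. F t s)" by simp
  qed
  also have "\<dots> = (LBINT s. (LBINT t. F t s))"
    by (rule lborel_pair.Fubini_integral[OF F, symmetric])
  also have "\<dots> = (LBINT s. H s * (k T - k s))"
  proof (intro Bochner_Integration.integral_cong refl)
    fix s
    show "(LBINT t. F t s) = H s * (k T - k s)"
    proof (cases "s \<in> {0<..<T}")
      case False
      have "F t s = 0" for t using H0[OF False] by (simp add: F_def)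
      then show ?thesis using H0[OF False] by simp
    next
      case True
      have "(LBINT t. F t s) = (LBINT t. H s * (k' t * indicator {s..T} t))"
      proof (rule integral_cong_AE)
        show "AE t in lborel. F t s = H s * (k' t * indicator {s..T} t)"
          using AE_lborel_singleton[of T] by eventually_elim (use True in \<open>auto simp: F_def indicator_def\<close>)
      qed (auto simp: F_def)
      also have "\<dots> = H s * (LBINT t. k' t * indicator {s..T} t)" by simp
      also have "(LBINT t. k' t * indicator {s..T} t) = k T - k s"
        using True k k' by (intro integral_FTC_Icc_real) (auto simp: continuous_on_eq_continuous_at)
      finally show ?thesis .
    qed
  qed
  finally show ?thesis .
qed

text \<open>
  The product rule for the square of a primitive, in integrated form. The square \<open>(-\<infinity>, t]\<^sup>2\<close> is split
  along its diagonal, and both triangles contribute equally.\<close>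
lemma primitive_square:
  assumes G: "integrable lborel G"
  shows "(primitive G t)\<^sup>2 = 2 * primitive (\<lambda>s. primitive G s * G s) t"
proof -
  have [measurable]: "G \<in> borel_measurable borel" using G by auto
  define g where "g = (\<lambda>s. indicator {..t} s * G s)"
  have g: "integrable lborel g" unfolding g_def by (rule integrable_indicator_mult[OF G]) auto
  have [measurable]: "g \<in> borel_measurable borel" using g by auto
  define F where "F = (\<lambda>s r. g s * (if r \<le> s then g r else 0))"
  have gg: "integrable (lborel \<Otimes>\<^sub>M lborel) (\<lambda>z. g (fst z) * g (snd z))"
    by (rule integrable_fst_times_snd[OF g g])
  have "integrable (lborel \<Otimes>\<^sub>M lborel) (\<lambda>z. g (fst z) * g (snd z) * (if snd z \<le> fst z then 1 else 0))"
    by (rule integrable_mult_bounded[OF gg, of _ 1]) auto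
  then have F: "integrable (lborel \<Otimes>\<^sub>M lborel) (case_prod F)"
    by (rule Bochner_Integration.integrable_cong[THEN iffD1, rotated -1]) (auto simp: F_def)
  have e1: "primitive G t = (LBINT r. g r)" by (simp add: g_def)
  have "(primitive G t)\<^sup>2 = (LBINT s. g s * (LBINT r. g r))"
    by (simp add: e1 power2_eq_square)
  also have "\<dots> = (LBINT s. (LBINT r. F s r) + (LBINT r. F r s))"
  proof (intro Bochner_Integration.integral_cong refl)
    fix s
    have i: "integrable lborel (\<lambda>r. g s * (g r * (if P r then 1 else 0)))" if [measurable]: "Measurable.pred borel P" for P
      by (intro integrable_mult_right integrable_mult_bounded[OF g, of _ 1]) auto
    have "g s * (LBINT r. g r) = (LBINT r. g s * g r)" by simp
    also have "\<dots> = (LBINT r. g s * (g r * (if r \<le> s then 1 else 0)) + g s * (g r * (if s \<le> r then 1 else 0)))"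
    proof (rule integral_cong_AE)
      show "AE r in lborel. g s * g r = g s * (g r * (if r \<le> s then 1 else 0)) + g s * (g r * (if s \<le> r then 1 else 0))"
        using AE_lborel_singleton[of s] by eventually_elim auto
    qed auto
    also have "\<dots> = (LBINT r. g s * (g r * (if r \<le> s then 1 else 0))) + (LBINT r. g s * (g r * (if s \<le> r then 1 else 0)))"
      by (intro Bochner_Integration.integral_add i) auto
    also have "(LBINT r. g s * (g r * (if r \<le> s then 1 else 0))) = (LBINT r. F s r)"
      by (intro Bochner_Integration.integral_cong) (auto simp: F_def)
    also have "(LBINT r. g s * (g r * (if s \<le> r then 1 else 0))) = (LBINT r. F r s)"
      by (intro Bochner_Integration.integral_cong) (auto simp: F_def)
    finally show "g s * (LBINT r. g r) = (LBINT r. F s r) + (LBINT r. F r s)" .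
  qed
  also have "\<dots> = (LBINT s. (LBINT r. F s r)) + (LBINT s. (LBINT r. F r s))"
    by (intro Bochner_Integration.integral_add lborel_pair.integrable_fst[OF F] lborel_pair.integrable_snd[OF F])
  also have "(LBINT s. (LBINT r. F r s)) = (LBINT s. (LBINT r. F s r))"
    by (rule lborel_pair.Fubini_integral[OF F])
  also have "(LBINT s. (LBINT r. F s r)) = primitive (\<lambda>s. primitive G s * G s) t"
  proof (intro Bochner_Integration.integral_cong refl)
    fix s
    have "(LBINT r. F s r) = (LBINT r. (indicator {..t} s * G s) * (indicator {..s} r * G r))"
      by (intro Bochner_Integration.integral_cong) (auto simp: F_def g_def indicator_def)
    then show "(LBINT r. F s r) = indicator {..t} s * (primitive G s * G s)" by simp
  qed
  finally show ?thesis by simp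
qed

text \<open>
  Integration by parts of \<open>(P\<^sup>2)' = 2 P G\<close> against the weight \<open>exp (- \<mu> t)\<close>, with \<open>P\<close> the primitive of \<open>G\<close>.
  Nothing arises at time \<open>0\<close>, where \<open>P\<close> vanishes, and the boundary term at \<open>T\<close> has the favourable sign.\<close>
lemma weighted_energy:
  assumes G: "integrable lborel G" and G0: "\<And>s. s \<notin> {0<..<T} \<Longrightarrow> G s = 0"
  shows "(LBINT t. indicator {0<..<T} t * (\<mu> * exp (- \<mu> * t)) * (primitive G t)\<^sup>2)
     \<le> 2 * (LBINT t. exp (- \<mu> * t) * (primitive G t * G t))"
proof -
  have [measurable]: "G \<in> borel_measurable borel" using G by auto
  define H where "H = (\<lambda>s. primitive G s * G s)"
  have Hi: "integrable lborel H"
    unfolding H_def by (subst mult.commute) (rule integrable_mult_bounded[OF G _ primitive_bound[OF G]], measurable)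
  have H0: "H s = 0" if "s \<notin> {0<..<T}" for s using G0[OF that] by (simp add: H_def)
  define k where "k = (\<lambda>t. - exp (- \<mu> * t))"
  have eH: "integrable lborel (\<lambda>s. H s * exp (- \<mu> * s))"
  proof -
    have "integrable lborel (\<lambda>s. H s * (indicator {0..T} s * exp (- \<mu> * s)))"
    proof (rule integrable_mult_bounded[OF Hi, of _ "exp (\<bar>\<mu>\<bar> * \<bar>T\<bar>)"])
      fix s
      have "- \<mu> * s \<le> \<bar>\<mu>\<bar> * \<bar>T\<bar>" if "s \<in> {0..T}"
      proof -
        have "- \<mu> * s \<le> \<bar>\<mu>\<bar> * s" using that by (intro mult_right_mono) auto
        also have "\<dots> \<le> \<bar>\<mu>\<bar> * \<bar>T\<bar>" using that by (intro mult_left_mono) auto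
        finally show ?thesis .
      qed
      then show "\<bar>indicator {0..T} s * exp (- \<mu> * s)\<bar> \<le> exp (\<bar>\<mu>\<bar> * \<bar>T\<bar>)"
        by (auto simp: indicator_def)
    qed auto
    moreover have "(\<lambda>s. H s * (indicator {0..T} s * exp (- \<mu> * s))) = (\<lambda>s. H s * exp (- \<mu> * s))"
    proof
      show "H s * (indicator {0..T} s * exp (- \<mu> * s)) = H s * exp (- \<mu> * s)" for s
        using H0[of s] by (cases "s \<in> {0..T}") auto
    qed
    ultimately show ?thesis by simp
  qed
  have "(LBINT t. indicator {0<..<T} t * (\<mu> * exp (- \<mu> * t)) * primitive H t)
      = (LBINT s. H s * (k T - k s))"
    by (intro integral_by_parts_primitive Hi H0)
      (auto simp: k_def intro!: derivative_eq_intros continuous_intros)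
  also have "\<dots> = (LBINT s. H s * exp (- \<mu> * s) - exp (- \<mu> * T) * H s)"
    by (simp add: k_def algebra_simps)
  also have "\<dots> = (LBINT s. H s * exp (- \<mu> * s)) - exp (- \<mu> * T) * (LBINT s. H s)"
    using Hi eH by simp
  also have "(LBINT s. H s) = primitive H T"
    using H0 by (intro Bochner_Integration.integral_cong) (auto simp: indicator_def)
  finally have "(LBINT t. indicator {0<..<T} t * (\<mu> * exp (- \<mu> * t)) * (2 * primitive H t))
     = 2 * (LBINT s. H s * exp (- \<mu> * s)) - exp (- \<mu> * T) * (2 * primitive H T)"
    by (simp add: mult.left_commute[of _ 2])
  moreover have sq: "(primitive G t)\<^sup>2 = 2 * primitive H t" for t
    unfolding H_def by (rule primitive_square[OF G])
  moreover have "(LBINT t. exp (- \<mu> * t) * (primitive G t * G t)) = (LBINT s. H s * exp (- \<mu> * s))"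
    by (intro Bochner_Integration.integral_cong refl) (simp add: H_def mult.commute[of _ "exp _"])
  moreover have "0 \<le> exp (- \<mu> * T) * (2 * primitive H T)"
    unfolding sq[symmetric] by simp
  ultimately show ?thesis by simp
qed

text \<open>
  The du Bois-Reymond lemma. The test functions need not vanish at time \<open>0\<close>, which excludes an additive
  constant.\<close>
lemma weak_derivative_imp_primitive:
  fixes V G :: "real \<Rightarrow> real"
  assumes V: "integrable lborel V" "\<And>t. t \<notin> {0<..<T} \<Longrightarrow> V t = 0"
    and G: "integrable lborel G" "\<And>t. t \<notin> {0<..<T} \<Longrightarrow> G t = 0" and T: "T > 0"
    and weak: "\<And>\<eta> \<eta>' e. (\<And>t. (\<eta> has_real_derivative \<eta>' t) (at t)) \<Longrightarrow> continuous_on UNIV \<eta>' \<Longrightarrow>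
      smooth_expr (\<lambda>z::real \<times> 'a::euclidean_space. \<eta> (fst z)) \<Longrightarrow> e < T \<Longrightarrow>
      (\<And>t. t \<notin> {-3..e} \<Longrightarrow> \<eta> t = 0) \<Longrightarrow> (LBINT t. \<eta>' t * V t + \<eta> t * G t) = 0"
  shows "AE t in lborel. t \<in> {0<..<T} \<longrightarrow> V t = primitive G t"
proof -
  have [measurable]: "G \<in> borel_measurable borel" "V \<in> borel_measurable borel" using V G by auto
  define W where "W = (\<lambda>t. indicator {0<..<T} t * primitive G t)"
  have W: "integrable lborel W"
    unfolding W_def using primitive_bound[OF G(1)]
    by (intro integrable_mult_bounded[OF integrable_indicator_Ioo]) auto
  have Z: "AE t in lborel. V t - W t = 0"
  proof (rule AE_zero_if_bump_integrals_zero)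
    fix r s n :: real assume rsn: "0 \<le> r" "s \<le> T" "0 < n"
    obtain \<eta> \<eta>' where \<eta>: "\<And>t. (\<eta> has_real_derivative \<eta>' t) (at t)" "continuous_on UNIV \<eta>'"
      "smooth_expr (\<lambda>z::real \<times> 'a. \<eta> (fst z))"
      "\<And>t. t \<notin> {-3..max 0 (s - 1/n)} \<Longrightarrow> \<eta> t = 0" "\<And>t. t > 0 \<Longrightarrow> \<eta>' t = bump r s n t"
      by (rule time_test_function[OF rsn(1,3), of s]) blast
    have "0 < 1 / n" using rsn by simp
    then have eT: "max 0 (s - 1/n) < T" using rsn(2) T by linarith
    have "continuous_on UNIV \<eta>"
      using \<eta>(1) by (meson DERIV_continuous continuous_at_imp_continuous_on)
    then have m: "\<eta> \<in> borel_measurable borel" by (rule borel_measurable_continuous_onI)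
    note [measurable] = m
    have "bounded (\<eta> ` {-3..T})"
      using \<open>continuous_on UNIV \<eta>\<close> by (intro compact_imp_bounded compact_continuous_image) (auto intro: continuous_on_subset)
    then obtain C where "\<forall>y\<in>\<eta> ` {-3..T}. norm y \<le> C" unfolding bounded_iff by blast
    then have "\<And>t. t \<in> {-3..T} \<Longrightarrow> \<bar>\<eta> t\<bar> \<le> C" by auto
    then have "\<bar>\<eta> t\<bar> \<le> max C 0" for t
      using \<eta>(4)[of t] eT by (cases "t \<in> {-3..T}") (fastforce simp: max_def)+
    then have i1: "integrable lborel (\<lambda>t. \<eta> t * G t)"
      by (subst mult.commute) (intro integrable_mult_bounded[OF G(1)], auto)
    have i2: "integrable lborel (\<lambda>t. X t * bump r s n t)" if "integrable lborel X" for X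
      using that bump_nonneg[of r s n] bump_le_1[of r s n] by (intro integrable_mult_bounded[of _ _ _ 1]) auto
    have eq: "\<eta>' t * V t = V t * bump r s n t" for t
      using V(2)[of t] \<eta>(5)[of t] by (cases "t \<in> {0<..<T}") auto
    have "(LBINT t. V t * bump r s n t) + (LBINT t. \<eta> t * G t) = 0"
      using weak[OF \<eta>(1,2,3) eT \<eta>(4)] i1 i2[OF V(1)] by (simp add: eq)
    moreover have "(LBINT t. W t * bump r s n t) = (LBINT t. indicator {0<..<T} t * \<eta>' t * primitive G t)"
      using \<eta>(5) by (intro Bochner_Integration.integral_cong) (auto simp: W_def indicator_def)
    moreover have "\<dots> = (LBINT s. G s * (\<eta> T - \<eta> s))"
      by (rule integral_by_parts_primitive[OF G \<eta>(1,2)])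
    moreover have "\<eta> T = 0" using \<eta>(4)[of T] eT by simp
    ultimately show "(LBINT t. (V t - W t) * bump r s n t) = 0"
      using i2[OF V(1)] i2[OF W] by (simp add: left_diff_distrib mult.commute[of "G _"])
  qed (use V W in \<open>auto simp: W_def\<close>)
  then show ?thesis by (auto simp: W_def indicator_def elim!: eventually_mono)
qed

section \<open>Continuity of translations in the mean\<close>

lemma
  fixes g :: "'a::euclidean_space \<Rightarrow> real"
  assumes g: "integrable lborel g"
  shows integrable_translate: "integrable lborel (\<lambda>x. g (x + h))"
    and integral_translate: "(LBINT x. g (x + h)) = (LBINT x. g x)"
proof -
  have [measurable]: "g \<in> borel_measurable borel" using g by auto
  have 1: "integrable (distr lborel borel ((+) h)) g" using g by (simp add: lborel_distr_plus)
  then show "integrable lborel (\<lambda>x. g (x + h))"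
    by (subst (asm) integrable_distr_eq) (auto simp: add.commute)
  have "(LBINT x. g x) = (\<integral>x. g x \<partial>distr lborel borel ((+) h))" by (simp add: lborel_distr_plus)
  also have "\<dots> = (LBINT x. g (h + x))" by (rule integral_distr) auto
  finally show "(LBINT x. g (x + h)) = (LBINT x. g x)" by (simp add: add.commute)
qed

text \<open>
  Continuity at \<open>0\<close> of the translates in the \<open>L\<^sup>1\<close> norm, along sequences, as dominated convergence
  requires it.\<close>
definition translation_continuous :: "('a::euclidean_space \<Rightarrow> real) \<Rightarrow> bool" where
  "translation_continuous g \<longleftrightarrow>
     (\<forall>X. X \<longlonglongrightarrow> 0 \<longrightarrow> (\<lambda>n. LBINT x. \<bar>g (x + X n) - g x\<bar>) \<longlonglongrightarrow> 0)"

text \<open>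
  Translations are isometries of \<open>L\<^sup>1\<close>, so the property passes to limits in \<open>L\<^sup>1\<close>.\<close>
lemma translation_continuous_approx:
  fixes g :: "'a::euclidean_space \<Rightarrow> real"
  assumes g: "integrable lborel g"
    and approx: "\<And>e. e > 0 \<Longrightarrow> \<exists>g'. integrable lborel g' \<and> translation_continuous g' \<and> (LBINT x. \<bar>g x - g' x\<bar>) < e"
  shows "translation_continuous g"
  unfolding translation_continuous_def
proof (intro allI impI LIMSEQ_I)
  fix X :: "nat \<Rightarrow> 'a" and r :: real assume X: "X \<longlonglongrightarrow> 0" and r: "0 < r"
  obtain g' where g': "integrable lborel g'" "translation_continuous g'" "(LBINT x. \<bar>g x - g' x\<bar>) < r / 3"
    using approx[of "r / 3"] r by auto
  have "(\<lambda>n. LBINT x. \<bar>g' (x + X n) - g' x\<bar>) \<longlonglongrightarrow> 0"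
    using g'(2) X by (simp add: translation_continuous_def)
  from LIMSEQ_D[OF this, of "r/3"] r
  obtain N where N: "\<And>n. n \<ge> N \<Longrightarrow> (LBINT x. \<bar>g' (x + X n) - g' x\<bar>) < r / 3" by auto
  show "\<exists>N. \<forall>n\<ge>N. norm ((LBINT x. \<bar>g (x + X n) - g x\<bar>) - 0) < r"
  proof (intro exI allI impI)
    fix n assume "n \<ge> N"
    have d: "integrable lborel (\<lambda>x. \<bar>g x - g' x\<bar>)" using g g' by auto
    have "(LBINT x. \<bar>g (x + X n) - g x\<bar>) \<le>
        (LBINT x. \<bar>g (x + X n) - g' (x + X n)\<bar> + \<bar>g' (x + X n) - g' x\<bar> + \<bar>g x - g' x\<bar>)"
      by (intro integral_mono integrable_abs Bochner_Integration.integrable_add Bochner_Integration.integrable_diff integrable_translate g g') auto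
    also have "\<dots> = (LBINT x. \<bar>g (x + X n) - g' (x + X n)\<bar>) + (LBINT x. \<bar>g' (x + X n) - g' x\<bar>) + (LBINT x. \<bar>g x - g' x\<bar>)"
      using g g' by (simp add: integrable_translate)
    also have "(LBINT x. \<bar>g (x + X n) - g' (x + X n)\<bar>) = (LBINT x. \<bar>g x - g' x\<bar>)"
      by (rule integral_translate[OF d])
    finally show "norm ((LBINT x. \<bar>g (x + X n) - g x\<bar>) - 0) < r"
      using N[OF \<open>n \<ge> N\<close>] g'(3) by simp
  qed
qed

text \<open>
  The indicator of an open set is lower semicontinuous, hence the positive part of
  \<open>1\<^sub>U(x) - 1\<^sub>U(x + h)\<close> tends to \<open>0\<close>. The difference has integral \<open>0\<close>, so its negative part has the
  same integral as its positive part.\<close>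
lemma translation_continuous_open:
  fixes U :: "'a::euclidean_space set"
  assumes U: "open U" and fin: "emeasure lborel U < \<infinity>"
  shows "translation_continuous (indicat_real U)"
  unfolding translation_continuous_def
proof (intro allI impI)
  fix X :: "nat \<Rightarrow> 'a" assume X: "X \<longlonglongrightarrow> 0"
  have [measurable]: "U \<in> sets borel" using U by auto
  have i: "integrable lborel (indicat_real U)" using fin by (simp add: integrable_indicator_iff)
  \<comment> \<open>The positive part, which dominated convergence controls.\<close>
  define p where "p = (\<lambda>n x. max 0 (indicat_real U x - indicat_real U (x + X n)) :: real)"
  have ip: "integrable lborel (p n)" for n
    unfolding p_def by (intro integrable_max Bochner_Integration.integrable_diff i integrable_translate[OF i]) auto
  have "(\<lambda>n. LBINT x. p n x) \<longlonglongrightarrow> (\<integral>x. 0 \<partial>(lborel::'a measure))"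
  proof (rule integral_dominated_convergence[where w="indicat_real U"])
    show "AE x in lborel. (\<lambda>n. p n x) \<longlonglongrightarrow> 0"
    proof (intro AE_I2 tendsto_eventually)
      fix x
      show "\<forall>\<^sub>F n in sequentially. p n x = 0"
      proof (cases "x \<in> U")
        case True
        have "(\<lambda>n. x + X n) \<longlonglongrightarrow> x" using tendsto_add[OF tendsto_const X, of x] by simp
        then have "\<forall>\<^sub>F n in sequentially. x + X n \<in> U" using U True topological_tendstoD by blast
        then show ?thesis by eventually_elim (simp add: p_def)
      qed (simp add: p_def)
    qed
    show "AE x in lborel. norm (p n x) \<le> indicat_real U x" for n
      by (intro AE_I2) (auto simp: p_def indicator_def)
  qed (use i ip in auto)
  moreover have "(LBINT x. \<bar>indicat_real U (x + X n) - indicat_real U x\<bar>) = 2 * (LBINT x. p n x)" for n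
  proof -
    have "(LBINT x. \<bar>indicat_real U (x + X n) - indicat_real U x\<bar>)
        = (LBINT x. 2 * p n x + (indicat_real U (x + X n) - indicat_real U x))"
      by (intro Bochner_Integration.integral_cong) (auto simp: p_def indicator_def)
    also have "\<dots> = 2 * (LBINT x. p n x) + ((LBINT x. indicat_real U (x + X n)) - (LBINT x. indicat_real U x))"
      using ip[of n] i integrable_translate[OF i, of "X n"] by simp
    also have "(LBINT x. indicat_real U (x + X n)) = (LBINT x. indicat_real U x)"
      by (rule integral_translate[OF i])
    finally show ?thesis by simp
  qed
  ultimately show "(\<lambda>n. LBINT x. \<bar>indicat_real U (x + X n) - indicat_real U x\<bar>) \<longlonglongrightarrow> 0"
    by (simp add: tendsto_mult_right_zero)
qed

text \<open>
  Outer regularity reduces indicators of sets of finite measure to those of open sets.\<close>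
lemma translation_continuous_L1:
  fixes g :: "'a::euclidean_space \<Rightarrow> real"
  assumes "integrable lborel g"
  shows "translation_continuous g"
  using assms
proof (induction rule: integrable_induct)
  case (base A c)
  then have A: "A \<in> sets borel" "emeasure lborel A < \<infinity>" by auto
  have [measurable]: "A \<in> sets borel" by fact
  have iA: "integrable lborel (indicat_real A)" using A by (simp add: integrable_indicator_iff)
  have "translation_continuous (indicat_real A)"
  proof (rule translation_continuous_approx[OF iA])
    fix e :: real assume e: "e > 0"
    obtain U where U: "open U" "A \<subseteq> U" "emeasure lborel (U - A) < e"
      using outer_regular_lborel[OF A(1) e] .
    have "emeasure lborel U \<le> emeasure lborel (U - A) + emeasure lborel A"
      using emeasure_subadditive[of "U - A" lborel A] U(1,2) by (simp add: Un_absorb2)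
    also have "\<dots> < \<infinity>" using U(3) A(2) by (auto simp: ennreal_add_less_top intro: order_less_trans)
    finally have fin: "emeasure lborel U < \<infinity>" .
    have "(LBINT x. \<bar>indicat_real A x - indicat_real U x\<bar>) = (LBINT x. indicat_real (U - A) x)"
      using U(2) by (intro Bochner_Integration.integral_cong) (auto simp: indicator_def)
    also have "\<dots> = measure lborel (U - A)" using U(1) A(1) by simp
    also have "\<dots> < e"
      using U(3) e by (cases "emeasure lborel (U - A)") (auto simp: measure_def ennreal_less_iff)
    finally have "(LBINT x. \<bar>indicat_real A x - indicat_real U x\<bar>) < e" .
    then show "\<exists>g'. integrable lborel g' \<and> translation_continuous g' \<and> (LBINT x. \<bar>indicat_real A x - g' x\<bar>) < e"
      using translation_continuous_open[OF U(1) fin] U(1) fin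
      by (intro exI[of _ "indicat_real U"]) (auto simp: integrable_indicator_iff)
  qed
  then have "translation_continuous (\<lambda>x. c * indicat_real A x :: real)"
    by (auto simp: translation_continuous_def right_diff_distrib[symmetric] abs_mult tendsto_mult_right_zero)
  then show ?case by (simp add: mult.commute)
next
  case (add f g)
  show ?case
    unfolding translation_continuous_def
  proof (intro allI impI)
    fix X :: "nat \<Rightarrow> 'a" assume X: "X \<longlonglongrightarrow> 0"
    show "(\<lambda>n. LBINT x. \<bar>f (x + X n) + g (x + X n) - (f x + g x)\<bar>) \<longlonglongrightarrow> 0"
    proof (rule tendsto_sandwich[OF _ _ tendsto_const])
      show "(\<lambda>n. (LBINT x. \<bar>f (x + X n) - f x\<bar>) + (LBINT x. \<bar>g (x + X n) - g x\<bar>)) \<longlonglongrightarrow> 0"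
        using add X tendsto_add[of _ 0 sequentially _ 0] unfolding translation_continuous_def by fastforce
      have d: "integrable lborel (\<lambda>x. \<bar>k (x + X n) - k x\<bar>)" if "integrable lborel k" for k :: "'a \<Rightarrow> real" and n
        by (intro integrable_abs Bochner_Integration.integrable_diff integrable_translate that)
      have "(LBINT x. \<bar>f (x + X n) + g (x + X n) - (f x + g x)\<bar>)
          \<le> (LBINT x. \<bar>f (x + X n) - f x\<bar> + \<bar>g (x + X n) - g x\<bar>)" for n
        using d[OF Bochner_Integration.integrable_add[OF add(1,2)], of n] d[OF add(1), of n] d[OF add(2), of n]
        by (intro integral_mono) auto
      then show "\<forall>\<^sub>F n in sequentially. (LBINT x. \<bar>f (x + X n) + g (x + X n) - (f x + g x)\<bar>)
          \<le> (LBINT x. \<bar>f (x + X n) - f x\<bar>) + (LBINT x. \<bar>g (x + X n) - g x\<bar>)"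
        using d[OF add(1)] d[OF add(2)] by simp
    qed auto
  qed
next
  case (lim f s)
  show ?case
  proof (rule translation_continuous_approx[OF lim.hyps(4)])
    fix e :: real assume e: "e > 0"
    have "(\<lambda>i. LBINT x. \<bar>f x - s i x\<bar>) \<longlonglongrightarrow> (\<integral>x. 0 \<partial>(lborel::'a measure))"
    proof (rule integral_dominated_convergence[where w="\<lambda>x. 3 * norm (f x)"])
      show "AE x in lborel. (\<lambda>i. \<bar>f x - s i x\<bar>) \<longlonglongrightarrow> 0"
      proof (rule AE_I2)
        fix x :: 'a
        have "(\<lambda>i. f x - s i x) \<longlonglongrightarrow> f x - f x"
          using lim.hyps(2)[of x] by (intro tendsto_intros) simp
        then show "(\<lambda>i. \<bar>f x - s i x\<bar>) \<longlonglongrightarrow> 0" using tendsto_rabs_zero by fastforce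
      qed
      show "AE x in lborel. norm \<bar>f x - s i x\<bar> \<le> 3 * norm (f x)" for i
      proof (rule AE_I2)
        fix x :: 'a
        show "norm \<bar>f x - s i x\<bar> \<le> 3 * norm (f x)" using lim.hyps(3)[of x i] by simp
      qed
    qed (use lim in auto)
    from LIMSEQ_D[OF this e] obtain i where "(LBINT x. \<bar>f x - s i x\<bar>) < e" by auto
    then show "\<exists>g'. integrable lborel g' \<and> translation_continuous g' \<and> (LBINT x. \<bar>f x - g' x\<bar>) < e"
      using lim.hyps(1) lim.IH by blast
  qed
qed

section \<open>The Plancherel identity\<close>

definition gauss :: "'a::euclidean_space \<Rightarrow> real" where
  "gauss x = exp (- (x \<bullet> x) / 2)"

text \<open>
  The integral of \<open>gauss\<close>, which is also the factor by which the Fourier transform multiplies \<open>gauss\<close>.\<close>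
definition gauss_mass :: "'a::euclidean_space itself \<Rightarrow> real" where
  "gauss_mass _ = sqrt (2 * pi) ^ DIM('a)"

lemma gauss_measurable [measurable]: "gauss \<in> borel_measurable borel"
  unfolding gauss_def[abs_def] by measurable

lemma gauss_pos: "0 < gauss x"
  by (simp add: gauss_def)

text \<open>
  This is the characteristic function of the standard normal distribution.\<close>
lemma gauss_cis_1D:
  "has_bochner_integral lborel (\<lambda>x. complex_of_real (exp (- x\<^sup>2 / 2)) * cis (t * x))
     (complex_of_real (sqrt (2 * pi) * exp (- t\<^sup>2 / 2)))"
proof -
  have i: "integrable lborel (\<lambda>x. exp (- x\<^sup>2 / 2) :: real)"
  proof -
    have "integrable lborel (\<lambda>x. sqrt (2 * pi) * std_normal_density x)"
      using integrable_std_normal_moment[of 0] by auto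
    then show ?thesis by (simp add: std_normal_density_def)
  qed
  have int: "integrable lborel (\<lambda>x. complex_of_real (exp (- x\<^sup>2 / 2)) * cis (t * x))"
    by (rule Bochner_Integration.integrable_bound[OF i])
      (auto simp: norm_mult intro!: borel_measurable_continuous_onI continuous_intros)
  have "complex_of_real (exp (- t\<^sup>2 / 2)) = char std_normal_distribution t"
    by (simp add: char_std_normal_distribution)
  also have "\<dots> = (LBINT x. std_normal_density x *\<^sub>R iexp (t * x))"
    unfolding char_def by (subst integral_density) auto
  also have "\<dots> = (LBINT x. complex_of_real (1 / sqrt (2 * pi)) * (complex_of_real (exp (- x\<^sup>2 / 2)) * cis (t * x)))"
    by (intro Bochner_Integration.integral_cong) (auto simp: std_normal_density_def cis_conv_exp scaleR_conv_of_real)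
  also have "\<dots> = complex_of_real (1 / sqrt (2 * pi)) * (LBINT x. complex_of_real (exp (- x\<^sup>2 / 2)) * cis (t * x))"
    by simp
  finally have "(LBINT x. complex_of_real (exp (- x\<^sup>2 / 2)) * cis (t * x)) = complex_of_real (sqrt (2 * pi) * exp (- t\<^sup>2 / 2))"
    by (simp add: field_simps)
  with int show ?thesis by (simp add: has_bochner_integral_iff)
qed

text \<open>
  Both factors of the integrand are products over the coordinates, so the integral is a product of
  one-dimensional ones.\<close>
lemma gauss_cis:
  fixes z :: "'a::euclidean_space"
  shows "has_bochner_integral lborel (\<lambda>\<xi>::'a. complex_of_real (gauss \<xi>) * cis (\<xi> \<bullet> z))
    (complex_of_real (gauss_mass TYPE('a) * gauss z))"
proof -
  interpret product_sigma_finite "\<lambda>_::'a. lborel :: real measure" ..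
  define f where "f = (\<lambda>b x. complex_of_real (exp (- x\<^sup>2 / 2)) * cis ((z \<bullet> b) * x))"
  have f: "integrable lborel (f b)" "integral\<^sup>L lborel (f b) = complex_of_real (sqrt (2 * pi) * exp (- (z \<bullet> b)\<^sup>2 / 2))" for b :: 'a
    using gauss_cis_1D[of "z \<bullet> b"] by (auto simp: f_def has_bochner_integral_iff)
  have prod: "complex_of_real (gauss \<xi>) * cis (\<xi> \<bullet> z) = (\<Prod>b\<in>Basis. f b (\<xi> \<bullet> b))" for \<xi> :: 'a
  proof -
    have "gauss \<xi> = (\<Prod>b\<in>Basis. exp (- (\<xi> \<bullet> b)\<^sup>2 / 2))"
      unfolding gauss_def by (subst euclidean_inner) (simp add: exp_sum[symmetric] sum_negf sum_divide_distrib power2_eq_square)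
    moreover have "cis (\<xi> \<bullet> z) = (\<Prod>b\<in>Basis. cis ((z \<bullet> b) * (\<xi> \<bullet> b)))"
      by (subst euclidean_inner) (simp add: cis_conv_exp exp_sum[symmetric] sum_distrib_left mult.commute)
    ultimately show ?thesis by (simp add: f_def prod.distrib)
  qed
  have m: "(\<lambda>x. \<Sum>b\<in>Basis. x b *\<^sub>R b) \<in> (\<Pi>\<^sub>M b\<in>Basis. lborel) \<rightarrow>\<^sub>M (borel :: 'a measure)"
    by measurable
  have m2: "(\<lambda>\<xi>::'a. complex_of_real (gauss \<xi>) * cis (\<xi> \<bullet> z)) \<in> borel_measurable borel"
    unfolding gauss_def by (intro borel_measurable_continuous_onI continuous_intros ballI) simp
  have e: "complex_of_real (gauss (\<Sum>b\<in>Basis. x b *\<^sub>R b)) * cis ((\<Sum>b\<in>Basis. x b *\<^sub>R b) \<bullet> z)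
      = (\<Prod>b\<in>Basis. f b (x b))" for x :: "'a \<Rightarrow> real"
    unfolding prod by (intro prod.cong refl) (simp add: inner_sum_left inner_Basis if_distrib sum.delta cong: if_cong)
  have "integrable lborel (\<lambda>\<xi>::'a. complex_of_real (gauss \<xi>) * cis (\<xi> \<bullet> z))"
    by (subst lborel_eq, subst integrable_distr_eq[OF m m2]) (auto simp: e intro!: product_integrable_prod f)
  moreover have "(\<integral>\<xi>. complex_of_real (gauss \<xi>) * cis (\<xi> \<bullet> z) \<partial>(lborel::'a measure)) = complex_of_real (gauss_mass TYPE('a) * gauss z)"
  proof -
    have "(\<integral>\<xi>. complex_of_real (gauss \<xi>) * cis (\<xi> \<bullet> z) \<partial>(lborel::'a measure)) = (\<Prod>b\<in>Basis. integral\<^sup>L lborel (f (b::'a)))"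
      by (subst lborel_eq, subst integral_distr[OF m m2]) (simp add: e product_integral_prod f)
    also have "\<dots> = complex_of_real (\<Prod>b\<in>Basis. sqrt (2 * pi) * exp (- (z \<bullet> b)\<^sup>2 / 2))"
      by (simp add: f)
    also have "(\<Prod>b\<in>Basis. sqrt (2 * pi) * exp (- (z \<bullet> b)\<^sup>2 / 2)) = gauss_mass TYPE('a) * gauss z"
      unfolding gauss_def gauss_mass_def prod.distrib
      by (subst euclidean_inner) (simp add: exp_sum[symmetric] sum_negf sum_divide_distrib power2_eq_square)
    finally show ?thesis .
  qed
  ultimately show ?thesis by (simp add: has_bochner_integral_iff)
qed

lemma gauss_cos:
  fixes z :: "'a::euclidean_space"
  shows "(\<integral>\<xi>. gauss \<xi> * cos (\<xi> \<bullet> z) \<partial>(lborel::'a measure)) = gauss_mass TYPE('a) * gauss z"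
proof -
  have "(\<integral>\<xi>. Re (complex_of_real (gauss \<xi>) * cis (\<xi> \<bullet> z)) \<partial>(lborel::'a measure)) = Re (complex_of_real (gauss_mass TYPE('a) * gauss z))"
    using gauss_cis[of z] by (subst integral_Re) (auto simp: has_bochner_integral_iff)
  then show ?thesis by simp
qed

lemma gauss_integrable: "integrable lborel (gauss :: 'a::euclidean_space \<Rightarrow> real)"
proof -
  have "integrable lborel (\<lambda>\<xi>::'a. Re (complex_of_real (gauss \<xi>) * cis (\<xi> \<bullet> 0)))"
    using gauss_cis[of "0::'a"] by (intro integrable_Re) (auto simp: has_bochner_integral_iff)
  then show ?thesis by simp
qed

lemma
  fixes f :: "'a::euclidean_space \<Rightarrow> real" and g :: "'b::euclidean_space \<Rightarrow> real"
  assumes f: "integrable lborel f" and g: "integrable lborel g"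
    and h: "(\<lambda>z. h (fst z) (snd z)) \<in> borel_measurable (borel \<Otimes>\<^sub>M borel)" and bd: "\<And>a b. \<bar>h a b\<bar> \<le> C"
  shows integrable_product_kernel: "integrable (lborel \<Otimes>\<^sub>M lborel) (\<lambda>z. f (fst z) * g (snd z) * h (fst z) (snd z))"
    and Fubini_product_kernel:
      "(LBINT a. f a * (LBINT b. g b * h a b)) = (LBINT b. g b * (LBINT a. f a * h a b))"
    and integrable_product_kernel_fst: "integrable lborel (\<lambda>a. f a * (LBINT b. g b * h a b))"
proof -
  show i: "integrable (lborel \<Otimes>\<^sub>M lborel) (\<lambda>z. f (fst z) * g (snd z) * h (fst z) (snd z))"
    using h bd by (intro integrable_mult_bounded[OF integrable_fst_times_snd[OF f g]]) auto
  have i': "integrable (lborel \<Otimes>\<^sub>M lborel) (\<lambda>(a, b). f a * g b * h a b)"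
    using i by (simp add: case_prod_unfold)
  have 1: "(\<lambda>a. f a * (LBINT b. g b * h a b)) = (\<lambda>a. LBINT b. f a * g b * h a b)"
    by (simp add: mult.assoc)
  have 2: "(\<lambda>b. g b * (LBINT a. f a * h a b)) = (\<lambda>b. LBINT a. f a * g b * h a b)"
    by (subst integral_mult_right_zero[symmetric]) (simp add: ac_simps)
  show "(LBINT a. f a * (LBINT b. g b * h a b)) = (LBINT b. g b * (LBINT a. f a * h a b))"
    unfolding 1 2 by (rule lborel_pair.Fubini_integral[OF i', symmetric])
  show "integrable lborel (\<lambda>a. f a * (LBINT b. g b * h a b))"
    unfolding 1 by (rule lborel_pair.integrable_fst[OF i'])
qed

text \<open>
  The phases \<open>0\<close> and \<open>\<pi>/2\<close> give the real part and, up to the sign, the imaginary part of the Fourier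
  transform. Real test functions produce these two separately, and a derivative in space amounts to a
  shift of the phase by \<open>\<pi>/2\<close>.\<close>
definition fourier :: "real \<Rightarrow> ('a::euclidean_space \<Rightarrow> real) \<Rightarrow> 'a \<Rightarrow> real" where
  "fourier \<theta> f \<xi> = (LBINT x. f x * cos (\<xi> \<bullet> x + \<theta>))"

definition power_spectrum :: "('a::euclidean_space \<Rightarrow> real) \<Rightarrow> 'a \<Rightarrow> real" where
  "power_spectrum f \<xi> = (fourier 0 f \<xi>)\<^sup>2 + (fourier (pi / 2) f \<xi>)\<^sup>2"

lemma integrable_times_cos:
  fixes f :: "'a::euclidean_space \<Rightarrow> real"
  shows "integrable lborel f \<Longrightarrow> integrable lborel (\<lambda>x. f x * cos (\<xi> \<bullet> x + \<theta>))"
  by (rule integrable_mult_bounded[of _ _ _ 1]) auto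

text \<open>
  The addition theorem \<open>cos p cos q + sin p sin q = cos (p - q)\<close> writes the power spectrum as a double
  integral, to which Fubini's theorem applies.\<close>
lemma power_spectrum_eq:
  fixes f :: "'a::euclidean_space \<Rightarrow> real"
  assumes f: "integrable lborel f"
  shows "power_spectrum f \<xi> = (LBINT x. f x * (LBINT y. f y * cos (\<xi> \<bullet> (y - x))))"
proof -
  have 1: "(LBINT y. f y * cos (\<xi> \<bullet> (y - x))) = cos (\<xi> \<bullet> x) * fourier 0 f \<xi> + cos (\<xi> \<bullet> x + pi / 2) * fourier (pi / 2) f \<xi>" for x
  proof -
    have "(LBINT y. f y * cos (\<xi> \<bullet> (y - x)))
      = (LBINT y. cos (\<xi> \<bullet> x) * (f y * cos (\<xi> \<bullet> y + 0)) + cos (\<xi> \<bullet> x + pi / 2) * (f y * cos (\<xi> \<bullet> y + pi / 2)))"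
      by (intro Bochner_Integration.integral_cong) (auto simp: inner_diff_right cos_diff cos_add algebra_simps)
    also have "\<dots> = cos (\<xi> \<bullet> x) * fourier 0 f \<xi> + cos (\<xi> \<bullet> x + pi / 2) * fourier (pi / 2) f \<xi>"
      unfolding fourier_def
      by (subst Bochner_Integration.integral_add)
        (use integrable_times_cos[OF f] integrable_times_cos[OF f, of _ 0, simplified] in auto)
    finally show ?thesis .
  qed
  have "(LBINT x. f x * (LBINT y. f y * cos (\<xi> \<bullet> (y - x))))
    = (LBINT x. (f x * cos (\<xi> \<bullet> x + 0)) * fourier 0 f \<xi> + (f x * cos (\<xi> \<bullet> x + pi / 2)) * fourier (pi / 2) f \<xi>)"
    unfolding 1 by (intro Bochner_Integration.integral_cong) (auto simp: algebra_simps)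
  also have "\<dots> = power_spectrum f \<xi>"
    unfolding power_spectrum_def fourier_def power2_eq_square
    by (subst Bochner_Integration.integral_add)
        (use integrable_times_cos[OF f] integrable_times_cos[OF f, of _ 0, simplified] in auto)
  finally show ?thesis by simp
qed

lemma fourier_measurable:
  assumes [measurable]: "f \<in> borel_measurable borel"
  shows "fourier \<theta> f \<in> borel_measurable borel"
proof -
  have "(\<lambda>\<xi>. LBINT x. f x * cos (\<xi> \<bullet> x + \<theta>)) \<in> borel_measurable borel" by measurable
  then show ?thesis by (simp add: fourier_def[abs_def])
qed

lemma
  fixes f :: "'a::euclidean_space \<Rightarrow> real"
  assumes "\<sigma> > 0"
  shows integral_rescale: "f \<in> borel_measurable borel \<Longrightarrow>
      (LBINT x. f x) = \<sigma> ^ DIM('a) * (LBINT x. f (t + \<sigma> *\<^sub>R x))"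
    and integrable_rescale: "integrable lborel f \<Longrightarrow> integrable lborel (\<lambda>x. f (t + \<sigma> *\<^sub>R x))"
proof -
  have d: "lborel = density (distr lborel borel (\<lambda>x::'a. t + \<sigma> *\<^sub>R x)) (\<lambda>_. ennreal (\<sigma> ^ DIM('a)))"
    using lborel_affine[of \<sigma> t] \<open>\<sigma> > 0\<close> by simp
  {
    assume [measurable]: "f \<in> borel_measurable borel"
    have "(LBINT x. f x) = (\<integral>x. f x \<partial>density (distr lborel borel (\<lambda>x. t + \<sigma> *\<^sub>R x)) (\<lambda>_. ennreal (\<sigma> ^ DIM('a))))"
      using d by simp
    also have "\<dots> = (\<integral>x. \<sigma> ^ DIM('a) * f x \<partial>distr lborel borel (\<lambda>x. t + \<sigma> *\<^sub>R x))"
      using \<open>\<sigma> > 0\<close> by (subst integral_density) auto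
    also have "\<dots> = \<sigma> ^ DIM('a) * (LBINT x. f (t + \<sigma> *\<^sub>R x))"
      by (subst integral_distr) auto
    finally show "(LBINT x. f x) = \<sigma> ^ DIM('a) * (LBINT x. f (t + \<sigma> *\<^sub>R x))" .
  }
  assume f: "integrable lborel f"
  then have [measurable]: "f \<in> borel_measurable borel" by auto
  have "integrable (density (distr lborel borel (\<lambda>x. t + \<sigma> *\<^sub>R x)) (\<lambda>_. ennreal (\<sigma> ^ DIM('a)))) f"
    using f d by simp
  then have "integrable (distr lborel borel (\<lambda>x. t + \<sigma> *\<^sub>R x)) (\<lambda>x. \<sigma> ^ DIM('a) * f x)"
    using \<open>\<sigma> > 0\<close> by (subst (asm) integrable_density) auto
  then show "integrable lborel (\<lambda>x. f (t + \<sigma> *\<^sub>R x))"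
    using \<open>\<sigma> > 0\<close> by (subst (asm) integrable_distr_eq) auto
qed

text \<open>
  The Gaussian weight makes all integrals converge absolutely. Integrating in the frequency first leaves
  a narrow Gaussian in \<open>y - x\<close>, and the substitution \<open>y = x + \<sigma> z\<close> turns it into a fixed Gaussian that
  averages the autocorrelations of \<open>f\<close> at the shifts \<open>\<sigma> z\<close>.\<close>
lemma gauss_weighted_power_spectrum:
  fixes f :: "'a::euclidean_space \<Rightarrow> real"
  assumes f: "integrable lborel f" and bd: "\<And>x. \<bar>f x\<bar> \<le> C" and \<sigma>: "\<sigma> > 0"
  shows "integrable lborel (\<lambda>\<xi>. gauss (\<sigma> *\<^sub>R \<xi>) * power_spectrum f \<xi>)"
    and "(LBINT \<xi>. gauss (\<sigma> *\<^sub>R \<xi>) * power_spectrum f \<xi>)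
      = gauss_mass TYPE('a) * (LBINT z. gauss z * (LBINT x. f x * f (x + \<sigma> *\<^sub>R z)))"
proof -
  have [measurable]: "f \<in> borel_measurable borel" using f by auto
  define \<gamma> where "\<gamma> = (\<lambda>\<xi>::'a. gauss (\<sigma> *\<^sub>R \<xi>))"
  have \<gamma>: "integrable lborel \<gamma>"
    unfolding \<gamma>_def using integrable_rescale[OF \<sigma> gauss_integrable, of 0] by simp
  have [measurable]: "\<gamma> \<in> borel_measurable borel" using \<gamma> by auto
  define h where "h = (\<lambda>\<xi> x. LBINT y. f y * cos (\<xi> \<bullet> (y - x)))"
  have h_bd: "\<bar>h \<xi> x\<bar> \<le> (LBINT y. \<bar>f y\<bar>)" for \<xi> x
  proof -
    have "integrable lborel (\<lambda>y. f y * cos (\<xi> \<bullet> (y - x)))"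
      by (rule integrable_mult_bounded[OF f, of _ 1]) auto
    then have "\<bar>h \<xi> x\<bar> \<le> (LBINT y. \<bar>f y * cos (\<xi> \<bullet> (y - x))\<bar>)"
      unfolding h_def using integral_abs_bound by blast
    also have "\<dots> \<le> (LBINT y. \<bar>f y\<bar>)"
      using \<open>integrable lborel (\<lambda>y. f y * cos (\<xi> \<bullet> (y - x)))\<close> f
      by (intro integral_mono integrable_abs) (auto simp: abs_mult intro!: mult_left_le)
    finally show ?thesis .
  qed
  have h_m: "(\<lambda>z. h (fst z) (snd z)) \<in> borel_measurable (borel \<Otimes>\<^sub>M borel)"
    unfolding h_def by measurable
  have ps: "power_spectrum f \<xi> = (LBINT x. f x * h \<xi> x)" for \<xi>
    using power_spectrum_eq[OF f] by (simp add: h_def)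
  define q where "q = (\<lambda>w. LBINT \<xi>. \<gamma> \<xi> * cos (\<xi> \<bullet> w))"
  have [measurable]: "q \<in> borel_measurable borel"
    unfolding q_def by measurable
  have q: "\<sigma> ^ DIM('a) * q (\<sigma> *\<^sub>R z) = gauss_mass TYPE('a) * gauss z" for z :: 'a
  proof -
    have "gauss_mass TYPE('a) * gauss z = (LBINT \<xi>. gauss \<xi> * cos (\<xi> \<bullet> z))"
      by (rule gauss_cos[symmetric])
    also have "\<dots> = \<sigma> ^ DIM('a) * (LBINT \<xi>. gauss (0 + \<sigma> *\<^sub>R \<xi>) * cos ((0 + \<sigma> *\<^sub>R \<xi>) \<bullet> z))"
      by (rule integral_rescale[OF \<sigma>]) measurable
    finally show ?thesis by (simp add: q_def \<gamma>_def)
  qed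
  have "integrable lborel (\<lambda>\<xi>. \<gamma> \<xi> * (LBINT x. f x * h \<xi> x))"
    by (rule integrable_product_kernel_fst[OF \<gamma> f h_m h_bd])
  then show "integrable lborel (\<lambda>\<xi>. gauss (\<sigma> *\<^sub>R \<xi>) * power_spectrum f \<xi>)"
    by (simp add: \<gamma>_def ps)
  have "(LBINT \<xi>. gauss (\<sigma> *\<^sub>R \<xi>) * power_spectrum f \<xi>) = (LBINT \<xi>. \<gamma> \<xi> * (LBINT x. f x * h \<xi> x))"
    by (simp add: \<gamma>_def ps)
  also have "\<dots> = (LBINT x. f x * (LBINT \<xi>. \<gamma> \<xi> * h \<xi> x))"
    by (rule Fubini_product_kernel[OF \<gamma> f h_m h_bd])
  also have "\<dots> = (LBINT x. f x * (gauss_mass TYPE('a) * (LBINT z. gauss z * f (x + \<sigma> *\<^sub>R z))))"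
  proof (intro Bochner_Integration.integral_cong refl arg_cong2[where f="(*)"])
    fix x :: 'a
    have "(LBINT \<xi>. \<gamma> \<xi> * h \<xi> x) = (LBINT y. f y * (LBINT \<xi>. \<gamma> \<xi> * cos (\<xi> \<bullet> (y - x))))"
      unfolding h_def by (rule Fubini_product_kernel[OF \<gamma> f, of _ 1]) auto
    also have "\<dots> = (LBINT y. f y * q (y - x))" by (simp add: q_def)
    also have "\<dots> = \<sigma> ^ DIM('a) * (LBINT z. f (x + \<sigma> *\<^sub>R z) * q ((x + \<sigma> *\<^sub>R z) - x))"
      by (rule integral_rescale[OF \<sigma>]) measurable
    also have "\<dots> = (LBINT z. f (x + \<sigma> *\<^sub>R z) * (\<sigma> ^ DIM('a) * q (\<sigma> *\<^sub>R z)))"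
      by (subst integral_mult_right_zero[symmetric]) (simp add: ac_simps)
    also have "\<dots> = (LBINT z. gauss_mass TYPE('a) * (gauss z * f (x + \<sigma> *\<^sub>R z)))"
      by (simp add: q ac_simps)
    finally show "(LBINT \<xi>. \<gamma> \<xi> * h \<xi> x) = gauss_mass TYPE('a) * (LBINT z. gauss z * f (x + \<sigma> *\<^sub>R z))"
      by simp
  qed
  also have "\<dots> = gauss_mass TYPE('a) * (LBINT x. f x * (LBINT z. gauss z * f (x + \<sigma> *\<^sub>R z)))"
    by (simp add: mult.left_commute[of "f _"])
  also have "(LBINT x. f x * (LBINT z. gauss z * f (x + \<sigma> *\<^sub>R z)))
      = (LBINT z. gauss z * (LBINT x. f x * f (x + \<sigma> *\<^sub>R z)))"
    by (rule Fubini_product_kernel[OF f gauss_integrable _ bd]) measurable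
  finally show "(LBINT \<xi>. gauss (\<sigma> *\<^sub>R \<xi>) * power_spectrum f \<xi>)
      = gauss_mass TYPE('a) * (LBINT z. gauss z * (LBINT x. f x * f (x + \<sigma> *\<^sub>R z)))" .
qed

text \<open>
  One factor is bounded, so continuity of translations in \<open>L\<^sup>1\<close> suffices.\<close>
lemma autocorrelation_tendsto:
  fixes f :: "'a::euclidean_space \<Rightarrow> real"
  assumes f: "integrable lborel f" and bd: "\<And>x. \<bar>f x\<bar> \<le> C" and X: "X \<longlonglongrightarrow> 0"
  shows "(\<lambda>n. LBINT x. f x * f (x + X n)) \<longlonglongrightarrow> (LBINT x. (f x)\<^sup>2)"
proof (rule LIM_zero_cancel, rule Lim_null_comparison)
  have [measurable]: "f \<in> borel_measurable borel" using f by auto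
  have i: "integrable lborel (\<lambda>x. f x * f (x + h))" for h
    using bd by (intro integrable_mult_bounded[OF f, of _ C]) auto
  have "norm ((LBINT x. f x * f (x + h)) - (LBINT x. (f x)\<^sup>2)) \<le> C * (LBINT x. \<bar>f (x + h) - f x\<bar>)" for h
  proof -
    have d: "integrable lborel (\<lambda>x. f (x + h) - f x)"
      by (intro Bochner_Integration.integrable_diff integrable_translate f)
    have "(LBINT x. f x * f (x + h)) - (LBINT x. (f x)\<^sup>2) = (LBINT x. (f (x + h) - f x) * f x)"
      using i[of h] i[of 0] by (subst Bochner_Integration.integral_diff[symmetric]) (auto simp: power2_eq_square algebra_simps)
    also have "norm \<dots> \<le> (LBINT x. \<bar>(f (x + h) - f x) * f x\<bar>)"
      unfolding real_norm_def by (rule integral_abs_bound)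
    also have "\<dots> \<le> (LBINT x. C * \<bar>f (x + h) - f x\<bar>)"
      using bd d integrable_mult_bounded[OF d _ bd]
      by (intro integral_mono integrable_abs integrable_mult_right) (auto simp: abs_mult mult.commute[of C] intro!: mult_left_mono)
    finally show ?thesis by simp
  qed
  then show "\<forall>\<^sub>F n in sequentially. norm ((LBINT x. f x * f (x + X n)) - (LBINT x. (f x)\<^sup>2)) \<le> C * (LBINT x. \<bar>f (x + X n) - f x\<bar>)"
    by simp
  show "(\<lambda>n. C * (LBINT x. \<bar>f (x + X n) - f x\<bar>)) \<longlonglongrightarrow> 0"
    using translation_continuous_L1[OF f] X unfolding translation_continuous_def
    by (intro tendsto_mult_right_zero) auto
qed

text \<open>
  As \<open>\<sigma>\<close> decreases to \<open>0\<close>, the weights increase to \<open>1\<close> and the autocorrelations tend to the one at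
  shift \<open>0\<close>. Monotone convergence also yields integrability of the power spectrum.\<close>
lemma power_spectrum_integral:
  fixes f :: "'a::euclidean_space \<Rightarrow> real"
  assumes f: "integrable lborel f" and bd: "\<And>x. \<bar>f x\<bar> \<le> C"
  shows "has_bochner_integral lborel (power_spectrum f) ((gauss_mass TYPE('a))\<^sup>2 * (LBINT x. (f x)\<^sup>2))"
proof -
  have [measurable]: "f \<in> borel_measurable borel" using f by auto
  have [measurable]: "fourier \<theta> f \<in> borel_measurable borel" for \<theta> by (rule fourier_measurable) simp
  define \<sigma> where "\<sigma> = (\<lambda>n. inverse (real (Suc n)))"
  have \<sigma>: "\<sigma> n > 0" "\<sigma> \<longlonglongrightarrow> 0" for n
    using LIMSEQ_inverse_real_of_nat by (auto simp: \<sigma>_def)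
  define c where "c = gauss_mass TYPE('a)"
  have corr: "\<bar>LBINT x. f x * f (x + h)\<bar> \<le> C * (LBINT x. \<bar>f x\<bar>)" for h
  proof -
    have "integrable lborel (\<lambda>x. f x * f (x + h))"
      using bd by (intro integrable_mult_bounded[OF f, of _ C]) auto
    then have "(LBINT x. \<bar>f x * f (x + h)\<bar>) \<le> (LBINT x. C * \<bar>f x\<bar>)"
      using f bd by (intro integral_mono integrable_abs integrable_mult_right) (auto simp: abs_mult mult.commute[of C] intro!: mult_left_mono)
    then show ?thesis using order_trans[OF integral_abs_bound[of lborel "\<lambda>x. f x * f (x + h)"]] by simp
  qed
  have "(\<lambda>n. \<integral>z. gauss z * (LBINT x. f x * f (x + \<sigma> n *\<^sub>R z)) \<partial>(lborel::'a measure))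
      \<longlonglongrightarrow> (\<integral>z. gauss z * (LBINT x. (f x)\<^sup>2) \<partial>(lborel::'a measure))"
  proof (rule integral_dominated_convergence[where w="\<lambda>z. gauss z * (C * (LBINT x. \<bar>f x\<bar>))"])
    show "AE z in lborel. (\<lambda>n. gauss z * (LBINT x. f x * f (x + \<sigma> n *\<^sub>R z))) \<longlonglongrightarrow> gauss z * (LBINT x. (f x)\<^sup>2)"
      using \<sigma>(2) by (intro AE_I2 tendsto_mult tendsto_const autocorrelation_tendsto[OF f bd] tendsto_eq_intros | simp)+
    show "AE z in lborel. norm (gauss z * (LBINT x. f x * f (x + \<sigma> n *\<^sub>R z))) \<le> gauss z * (C * (LBINT x. \<bar>f x\<bar>))" for n
      using corr by (intro AE_I2) (auto simp: abs_mult abs_of_pos[OF gauss_pos] intro!: mult_left_mono less_imp_le[OF gauss_pos])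
    show "(\<lambda>z. gauss z * (LBINT x. f x * f (x + \<sigma> n *\<^sub>R z))) \<in> borel_measurable lborel" for n
      by measurable
  qed (use gauss_integrable in auto)
  also have "(\<integral>z. gauss z * (LBINT x. (f x)\<^sup>2) \<partial>(lborel::'a measure)) = c * (LBINT x. (f x)\<^sup>2)"
    using gauss_cos[of "0::'a"] by (simp add: c_def gauss_def)
  finally have "(\<lambda>n. c * (\<integral>z. gauss z * (LBINT x. f x * f (x + \<sigma> n *\<^sub>R z)) \<partial>(lborel::'a measure)))
      \<longlonglongrightarrow> c * (c * (LBINT x. (f x)\<^sup>2))"
    by (intro tendsto_mult tendsto_const)
  then have lim: "(\<lambda>n. LBINT \<xi>. gauss (\<sigma> n *\<^sub>R \<xi>) * power_spectrum f \<xi>) \<longlonglongrightarrow> c\<^sup>2 * (LBINT x. (f x)\<^sup>2)"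
    using gauss_weighted_power_spectrum(2)[OF f bd \<sigma>(1)] by (simp add: c_def power2_eq_square mult.assoc)
  show ?thesis
  proof (rule has_bochner_integral_monotone_convergence[OF _ _ _ lim[unfolded c_def]])
    show "integrable lborel (\<lambda>\<xi>. gauss (\<sigma> n *\<^sub>R \<xi>) * power_spectrum f \<xi>)" for n
      by (rule gauss_weighted_power_spectrum(1)[OF f bd \<sigma>(1)])
    show "AE \<xi> in lborel. mono (\<lambda>n. gauss (\<sigma> n *\<^sub>R \<xi>) * power_spectrum f \<xi>)"
    proof (intro AE_I2 monoI mult_right_mono)
      fix \<xi> :: 'a and m n :: nat assume "m \<le> n"
      then have "\<sigma> n \<le> \<sigma> m" by (simp add: \<sigma>_def)
      then have "\<sigma> n * \<sigma> n * (\<xi> \<bullet> \<xi>) \<le> \<sigma> m * \<sigma> m * (\<xi> \<bullet> \<xi>)"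
        using \<sigma>(1)[THEN less_imp_le] by (intro mult_right_mono mult_mono) auto
      then show "gauss (\<sigma> m *\<^sub>R \<xi>) \<le> gauss (\<sigma> n *\<^sub>R \<xi>)"
        by (simp add: gauss_def mult.assoc)
    qed (simp add: power_spectrum_def)
    show "AE \<xi> in lborel. (\<lambda>n. gauss (\<sigma> n *\<^sub>R \<xi>) * power_spectrum f \<xi>) \<longlonglongrightarrow> power_spectrum f \<xi>"
    proof (rule AE_I2)
      fix \<xi> :: 'a
      have "(\<lambda>n. exp (- (\<sigma> n * (\<sigma> n * (\<xi> \<bullet> \<xi>))) / 2)) \<longlonglongrightarrow> exp (- (0 * (0 * (\<xi> \<bullet> \<xi>))) / 2)"
        by (intro tendsto_intros \<sigma>(2)) auto
      then have "(\<lambda>n. gauss (\<sigma> n *\<^sub>R \<xi>)) \<longlonglongrightarrow> 1" by (simp add: gauss_def)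
      from tendsto_mult[OF this tendsto_const[of "power_spectrum f \<xi>"]]
      show "(\<lambda>n. gauss (\<sigma> n *\<^sub>R \<xi>) * power_spectrum f \<xi>) \<longlonglongrightarrow> power_spectrum f \<xi>" by simp
    qed
    show "power_spectrum f \<in> borel_measurable lborel"
      unfolding power_spectrum_def[abs_def] by measurable
  qed
qed

lemma fourier_add:
  "integrable lborel f \<Longrightarrow> integrable lborel g \<Longrightarrow> fourier \<theta> (\<lambda>x. f x + g x) \<xi> = fourier \<theta> f \<xi> + fourier \<theta> g \<xi>"
  unfolding fourier_def using integrable_times_cos[of f \<xi> \<theta>] integrable_times_cos[of g \<xi> \<theta>] by (simp add: distrib_right)

text \<open>The bilinear version follows by polarisation.\<close>
lemma Plancherel:
  fixes f g :: "'a::euclidean_space \<Rightarrow> real"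
  assumes f: "integrable lborel f" "\<And>x. \<bar>f x\<bar> \<le> C" and g: "integrable lborel g" "\<And>x. \<bar>g x\<bar> \<le> C"
  shows "has_bochner_integral lborel (\<lambda>\<xi>. fourier 0 f \<xi> * fourier 0 g \<xi> + fourier (pi / 2) f \<xi> * fourier (pi / 2) g \<xi>)
    ((gauss_mass TYPE('a))\<^sup>2 * (LBINT x. f x * g x))"
proof -
  define c where "c = (gauss_mass TYPE('a))\<^sup>2"
  have fg: "integrable lborel (\<lambda>x. f x + g x)" "\<bar>f x + g x\<bar> \<le> C + C" for x
    using f(1) g(1) f(2)[of x] g(2)[of x] by auto
  note F = power_spectrum_integral[OF f, folded c_def]
  note G = power_spectrum_integral[OF g, folded c_def]
  note FG = power_spectrum_integral[OF fg, folded c_def]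
  have [measurable]: "f \<in> borel_measurable borel" "g \<in> borel_measurable borel" using f g by auto
  have i: "integrable lborel (\<lambda>x. (f x)\<^sup>2)" "integrable lborel (\<lambda>x. (g x)\<^sup>2)" "integrable lborel (\<lambda>x. f x * g x)"
    unfolding power2_eq_square using integrable_mult_bounded[OF f(1) _ f(2)] integrable_mult_bounded[OF g(1) _ g(2)]
      integrable_mult_bounded[OF f(1) _ g(2)] by auto
  have hb: "has_bochner_integral lborel (\<lambda>\<xi>. (power_spectrum (\<lambda>x. f x + g x) \<xi> - power_spectrum f \<xi> - power_spectrum g \<xi>) / 2)
      ((c * (LBINT x. (f x + g x)\<^sup>2) - c * (LBINT x. (f x)\<^sup>2) - c * (LBINT x. (g x)\<^sup>2)) / 2)"
    by (intro has_bochner_integral_divide_zero has_bochner_integral_diff F G FG)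
  have "(LBINT x. (f x + g x)\<^sup>2) = (LBINT x. (f x)\<^sup>2 + (g x)\<^sup>2 + 2 * (f x * g x))"
    by (intro Bochner_Integration.integral_cong) (auto simp: power2_sum)
  also have "\<dots> = (LBINT x. (f x)\<^sup>2) + (LBINT x. (g x)\<^sup>2) + 2 * (LBINT x. f x * g x)"
    using i by simp
  finally have val: "(c * (LBINT x. (f x + g x)\<^sup>2) - c * (LBINT x. (f x)\<^sup>2) - c * (LBINT x. (g x)\<^sup>2)) / 2
      = c * (LBINT x. f x * g x)" by (simp add: algebra_simps)
  have integrand: "(power_spectrum (\<lambda>x. f x + g x) \<xi> - power_spectrum f \<xi> - power_spectrum g \<xi>) / 2
      = fourier 0 f \<xi> * fourier 0 g \<xi> + fourier (pi / 2) f \<xi> * fourier (pi / 2) g \<xi>" for \<xi>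
    by (simp add: power_spectrum_def fourier_add[OF f(1) g(1)] power2_eq_square field_simps)
  show ?thesis by (rule hb[unfolded integrand val, unfolded c_def])
qed

section \<open>Plane waves with a cutoff\<close>

lemma grad_eqI: "(f has_derivative (\<lambda>h. g \<bullet> h)) (at x) \<Longrightarrow> grad f x = g"
  unfolding grad_def by (metis (no_types, lifting) frechet_derivative_at euclidean_representation sum.cong)

text \<open>
  As \<open>\<epsilon>\<close> tends to \<open>0\<close>, the cutoff tends to the constant \<open>flat 0 1\<close>, which is \<open>exp (- 1)\<close> rather than \<open>1\<close>.\<close>
definition wave :: "real \<Rightarrow> real \<Rightarrow> 'a::euclidean_space \<Rightarrow> 'a \<Rightarrow> real" where
  "wave \<epsilon> \<theta> \<xi> x = flat 0 (1 - \<epsilon> * (x \<bullet> x)) * cos (\<xi> \<bullet> x + \<theta>)"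

lemma grad_wave:
  "grad (wave \<epsilon> \<theta> \<xi>) x =
    (- 2 * \<epsilon> * flat 2 (1 - \<epsilon> * (x \<bullet> x)) * cos (\<xi> \<bullet> x + \<theta>)) *\<^sub>R x
    - (flat 0 (1 - \<epsilon> * (x \<bullet> x)) * sin (\<xi> \<bullet> x + \<theta>)) *\<^sub>R \<xi>"
proof (rule grad_eqI)
  have fl: "((\<lambda>x. flat 0 (1 - \<epsilon> * (x \<bullet> x))) has_derivative
      (\<lambda>h. flat 2 (1 - \<epsilon> * (x \<bullet> x)) * (- 2 * \<epsilon> * (x \<bullet> h)))) (at x)"
  proof -
    have "((\<lambda>x. 1 - \<epsilon> * (x \<bullet> x)) has_derivative (\<lambda>h. - 2 * \<epsilon> * (x \<bullet> h))) (at x)"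
      by (auto intro!: derivative_eq_intros simp: fun_eq_iff inner_commute)
    from has_derivative_compose[OF this flat_has_derivative[of 0, unfolded has_field_derivative_def]]
    show ?thesis by (simp add: eval_nat_numeral)
  qed
  show "(wave \<epsilon> \<theta> \<xi> has_derivative (\<bullet>)
     ((- 2 * \<epsilon> * flat 2 (1 - \<epsilon> * (x \<bullet> x)) * cos (\<xi> \<bullet> x + \<theta>)) *\<^sub>R x
    - (flat 0 (1 - \<epsilon> * (x \<bullet> x)) * sin (\<xi> \<bullet> x + \<theta>)) *\<^sub>R \<xi>)) (at x)"
    unfolding wave_def[abs_def]
    by (rule derivative_eq_intros fl refl | simp)+
      (auto simp: fun_eq_iff inner_diff_left algebra_simps)
qed

lemma laplacian_wave:
  fixes x :: "'a::euclidean_space"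
  shows "laplacian (wave \<epsilon> \<theta> \<xi>) x =
    (4 * \<epsilon>^2 * (x \<bullet> x) * (flat 4 (1 - \<epsilon> * (x \<bullet> x)) - 2 * flat 3 (1 - \<epsilon> * (x \<bullet> x)))
     - 2 * \<epsilon> * DIM('a) * flat 2 (1 - \<epsilon> * (x \<bullet> x))) * cos (\<xi> \<bullet> x + \<theta>)
    + 4 * \<epsilon> * flat 2 (1 - \<epsilon> * (x \<bullet> x)) * (x \<bullet> \<xi>) * sin (\<xi> \<bullet> x + \<theta>)
    - flat 0 (1 - \<epsilon> * (x \<bullet> x)) * (\<xi> \<bullet> \<xi>) * cos (\<xi> \<bullet> x + \<theta>)"
proof -
  define r where "r = 1 - \<epsilon> * (x \<bullet> x)"
  define c where "c = cos (\<xi> \<bullet> x + \<theta>)"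
  define s where "s = sin (\<xi> \<bullet> x + \<theta>)"
  have fl: "((\<lambda>x. flat n (1 - \<epsilon> * (x \<bullet> x))) has_derivative
      (\<lambda>h. (flat (n + 2) r - n * flat (Suc n) r) * (- 2 * \<epsilon> * (x \<bullet> h)))) (at x)" for n
  proof -
    have "((\<lambda>x. 1 - \<epsilon> * (x \<bullet> x)) has_derivative (\<lambda>h. - 2 * \<epsilon> * (x \<bullet> h))) (at x)"
      by (auto intro!: derivative_eq_intros simp: fun_eq_iff inner_commute)
    from has_derivative_compose[OF this flat_has_derivative[of n, unfolded has_field_derivative_def]]
    show ?thesis by (simp add: r_def)
  qed
  define L where "L = (\<lambda>h. (- 2 * \<epsilon> * (flat 4 r - 2 * flat 3 r) * (- 2 * \<epsilon> * (x \<bullet> h)) * c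
      + 2 * \<epsilon> * flat 2 r * s * (\<xi> \<bullet> h)) *\<^sub>R x + (- 2 * \<epsilon> * flat 2 r * c) *\<^sub>R h
     - (flat 2 r * (- 2 * \<epsilon> * (x \<bullet> h)) * s + flat 0 r * c * (\<xi> \<bullet> h)) *\<^sub>R \<xi>)"
  have "(grad (wave \<epsilon> \<theta> \<xi>) has_derivative L) (at x)"
    unfolding grad_wave[abs_def]
    by (rule derivative_eq_intros fl[of 0] fl[of 2] refl | simp)+
      (auto simp: fun_eq_iff L_def r_def[symmetric] c_def s_def algebra_simps eval_nat_numeral)
  then have "laplacian (wave \<epsilon> \<theta> \<xi>) x = (\<Sum>i\<in>Basis. L i \<bullet> i)"
    unfolding laplacian_def divergence_def using frechet_derivative_at by metis
  also have "\<dots> = (\<Sum>i\<in>Basis. 4 * \<epsilon>^2 * (flat 4 r - 2 * flat 3 r) * c * ((x \<bullet> i) * (x \<bullet> i))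
      + 4 * \<epsilon> * flat 2 r * s * ((x \<bullet> i) * (\<xi> \<bullet> i)) - 2 * \<epsilon> * flat 2 r * c
      - flat 0 r * c * ((\<xi> \<bullet> i) * (\<xi> \<bullet> i)))"
    by (intro sum.cong refl) (simp add: L_def inner_add_left inner_diff_left algebra_simps power2_eq_square)
  also have "\<dots> = 4 * \<epsilon>^2 * (flat 4 r - 2 * flat 3 r) * c * (x \<bullet> x)
      + 4 * \<epsilon> * flat 2 r * s * (x \<bullet> \<xi>) - DIM('a) * (2 * \<epsilon> * flat 2 r * c)
      - flat 0 r * c * (\<xi> \<bullet> \<xi>)"
    by (simp add: sum.distrib sum_subtractf sum_distrib_left[symmetric] euclidean_inner[of x x, symmetric]
        euclidean_inner[of x \<xi>, symmetric] euclidean_inner[of \<xi> \<xi>, symmetric])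
  finally show ?thesis
    by (simp only: r_def c_def s_def) (simp add: algebra_simps)
qed

lemma smooth_expr_wave:
  assumes l: "bounded_linear l"
  shows "smooth_expr (\<lambda>z. wave \<epsilon> \<theta> \<xi> (l z))"
proof -
  have lin: "smooth_expr (\<lambda>z. y \<bullet> l z)" for y
    by (rule smooth_expr.linear, rule bounded_linear_compose[OF bounded_linear_inner_right l])
  have "smooth_expr (\<lambda>z. (l z \<bullet> i) * (l z \<bullet> i))" for i
    using smooth_expr.mult[OF lin[of i] lin[of i]] by (simp add: inner_commute)
  then have sq: "smooth_expr (\<lambda>z. l z \<bullet> l z)"
    by (subst euclidean_inner) (rule smooth_expr_sum[OF finite_Basis])
  show ?thesis
    unfolding wave_def
    by (rule smooth_expr.mult[OF
          smooth_expr.flat[OF smooth_expr_diff[OF smooth_expr.const smooth_expr_cmult[OF sq]]]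
          smooth_expr.cos[OF lin]])
qed

lemma wave_test_function:
  fixes \<xi> :: "'a::euclidean_space"
  assumes \<epsilon>: "\<epsilon> > 0" and \<eta>: "smooth_expr (\<lambda>z::real \<times> 'a. \<eta> (fst z))"
    and supp: "\<And>t. t \<notin> {r..s} \<Longrightarrow> \<eta> t = 0" and "s < T"
  shows "(\<lambda>z. \<eta> (fst z) * wave \<epsilon> \<theta> \<xi> (snd z)) \<in> test_functions ({..<T} \<times> UNIV)"
proof -
  have sm: "smooth_expr (\<lambda>z. \<eta> (fst z) * wave \<epsilon> \<theta> \<xi> (snd z))"
    by (rule smooth_expr.mult[OF \<eta> smooth_expr_wave[OF bounded_linear_snd]])
  have sub: "closure {z. \<eta> (fst z) * wave \<epsilon> \<theta> \<xi> (snd z) \<noteq> 0} \<subseteq> {r..s} \<times> cball 0 (sqrt (1/\<epsilon>))"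
  proof (rule closure_minimal)
    show "{z. \<eta> (fst z) * wave \<epsilon> \<theta> \<xi> (snd z) \<noteq> 0} \<subseteq> {r..s} \<times> cball 0 (sqrt (1/\<epsilon>))"
    proof
      fix z assume "z \<in> {z. \<eta> (fst z) * wave \<epsilon> \<theta> \<xi> (snd z) \<noteq> 0}"
      then have 1: "\<eta> (fst z) \<noteq> 0" and "flat 0 (1 - \<epsilon> * (snd z \<bullet> snd z)) \<noteq> 0"
        by (auto simp: wave_def)
      then have "\<epsilon> * (snd z \<bullet> snd z) < 1" by (auto simp: flat_def split: if_splits)
      then have "(norm (snd z))^2 \<le> 1/\<epsilon>"
        using \<epsilon> by (simp add: power2_norm_eq_inner field_simps)
      then have "norm (snd z) \<le> sqrt (1/\<epsilon>)" by (rule real_le_rsqrt)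
      then show "z \<in> {r..s} \<times> cball 0 (sqrt (1/\<epsilon>))"
        using 1 supp by (auto simp: mem_Times_iff)
    qed
  qed (auto intro: closed_Times)
  have "compact ({r..s} \<times> cball (0::'a) (sqrt (1/\<epsilon>)))"
    by (intro compact_Times) auto
  then have "compact (closure {z. \<eta> (fst z) * wave \<epsilon> \<theta> \<xi> (snd z) \<noteq> 0})"
    unfolding compact_eq_bounded_closed using bounded_subset[OF _ sub] by simp
  moreover have "closure {z. \<eta> (fst z) * wave \<epsilon> \<theta> \<xi> (snd z) \<noteq> 0} \<subseteq> {..<T} \<times> UNIV"
    using sub \<open>s < T\<close> by fastforce
  ultimately show ?thesis
    unfolding test_functions_def by (intro CollectI conjI allI smooth_expr_Ck[OF sm])
qed

lemma smooth_expr_differentiable: "smooth_expr f \<Longrightarrow> f differentiable (at x)"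
  using smooth_expr_has_derivative differentiable_def by blast

lemma smooth_expr_grad_differentiable:
  assumes "smooth_expr f"
  shows "grad f differentiable (at x)"
proof -
  obtain f' where f': "\<forall>x. (f has_derivative f' x) (at x)" "\<forall>i. smooth_expr (\<lambda>x. f' x i)"
    using smooth_expr_has_derivative[OF assms] by auto
  have "frechet_derivative f (at x) = f' x" for x
    using f'(1) by (metis frechet_derivative_at)
  then have "grad f = (\<lambda>x. \<Sum>i\<in>Basis. f' x i *\<^sub>R i)" by (simp add: grad_def fun_eq_iff)
  then show ?thesis
    using f'(2) by (auto intro!: differentiable_sum differentiable_scaleR smooth_expr_differentiable)
qed

lemma grad_cmult: "f differentiable (at x) \<Longrightarrow> grad (\<lambda>y. c * f y) x = c *\<^sub>R grad f x"
proof -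
  assume "f differentiable (at x)"
  then obtain L where L: "(f has_derivative L) (at x)" using differentiable_def by blast
  then have "((\<lambda>y. c * f y) has_derivative (\<lambda>h. c * L h)) (at x)"
    by (rule has_derivative_mult_right)
  then have "frechet_derivative (\<lambda>y. c * f y) (at x) = (\<lambda>h. c * L h)"
    by (metis frechet_derivative_at)
  moreover have "frechet_derivative f (at x) = L" using L by (metis frechet_derivative_at)
  ultimately show ?thesis by (simp add: grad_def scaleR_sum_right)
qed

lemma laplacian_cmult:
  fixes f :: "'a::euclidean_space \<Rightarrow> real"
  assumes f: "smooth_expr f"
  shows "laplacian (\<lambda>y. c * f y) x = c * laplacian f x"
proof -
  have 1: "grad (\<lambda>y. c * f y) = (\<lambda>y. c *\<^sub>R grad f y)"
    using grad_cmult[OF smooth_expr_differentiable[OF f]] by (simp add: fun_eq_iff)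
  obtain L where L: "(grad f has_derivative L) (at x)"
    using smooth_expr_grad_differentiable[OF f] differentiable_def by blast
  have "((\<lambda>y. c *\<^sub>R grad f y) has_derivative (\<lambda>h. c *\<^sub>R L h)) (at x)"
    using L by (rule has_derivative_scaleR_right)
  then have "frechet_derivative (\<lambda>y. c *\<^sub>R grad f y) (at x) = (\<lambda>h. c *\<^sub>R L h)"
    by (metis frechet_derivative_at)
  moreover have "frechet_derivative (grad f) (at x) = L" using L by (metis frechet_derivative_at)
  ultimately show ?thesis
    by (simp add: laplacian_def divergence_def 1 sum_distrib_left)
qed

lemma flat_bound: "r \<le> 1 \<Longrightarrow> flat n r \<le> fact (Suc n)"
proof (cases "r \<le> 0")
  case False
  assume "r \<le> 1"
  then have "fact (Suc n) * \<bar>r\<bar> \<le> fact (Suc n) * 1"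
    using False by (intro mult_left_mono) auto
  then show ?thesis using flat_le[of n r] by linarith
qed (simp add: flat_def del: fact_Suc)

text \<open>
  Every derivative that falls on the cutoff brings a factor \<open>\<epsilon>\<close> times \<open>x\<close> or a factor \<open>\<epsilon>\<close>. Where the
  cutoff does not vanish, \<open>\<epsilon> |x|\<^sup>2 \<le> 1\<close>, and therefore \<open>\<epsilon> |x| \<le> 1\<close> as \<open>\<epsilon> \<le> 1\<close>, so these derivatives are bounded
  uniformly in \<open>\<epsilon>\<close> and \<open>x\<close>.\<close>
lemma wave_bounds:
  fixes \<xi> :: "'a::euclidean_space"
  shows "\<exists>K. \<forall>\<epsilon> x. 0 < \<epsilon> \<longrightarrow> \<epsilon> \<le> 1 \<longrightarrow>
    \<bar>wave \<epsilon> \<theta> \<xi> x\<bar> \<le> K \<and> norm (grad (wave \<epsilon> \<theta> \<xi>) x) \<le> K \<and> \<bar>laplacian (wave \<epsilon> \<theta> \<xi>) x\<bar> \<le> K"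
proof -
  define K where "K = 1 + 12 + norm \<xi> + (4 * 168 + 2 * real DIM('a) * 6 + 4 * 6 * norm \<xi> + (norm \<xi>)\<^sup>2)"
  show ?thesis
  proof (intro exI[of _ K] allI impI)
    fix \<epsilon> :: real and x :: 'a assume \<epsilon>: "0 < \<epsilon>" "\<epsilon> \<le> 1"
    define r where "r = 1 - \<epsilon> * (x \<bullet> x)"
    have r: "r \<le> 1" using \<epsilon> by (simp add: r_def)
    define c where "c = cos (\<xi> \<bullet> x + \<theta>)"
    define s where "s = sin (\<xi> \<bullet> x + \<theta>)"
    have cs: "\<bar>c\<bar> \<le> 1" "\<bar>s\<bar> \<le> 1" by (auto simp: c_def s_def)
    have f0: "0 \<le> flat 0 r" "flat 0 r \<le> 1" using flat_nonneg flat_0_le_1 by auto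
    have fl: "0 \<le> flat n r" "flat n r \<le> fact (Suc n)" for n using flat_nonneg flat_bound[OF r] by auto
    have fz: "flat n r * y \<le> fact (Suc n) * z" if "r > 0 \<Longrightarrow> y \<le> z" "0 \<le> z" for n y z
    proof (cases "r > 0")
      case True
      have "flat n r * y \<le> flat n r * z" using that(1)[OF True] fl by (intro mult_left_mono)
      also have "\<dots> \<le> fact (Suc n) * z" using fl that(2) by (intro mult_right_mono)
      finally show ?thesis .
    next
      case False
      then have "flat n r = 0" by (simp add: flat_def)
      then show ?thesis using that(2) by simp
    qed
    have e1: "\<epsilon> * (x \<bullet> x) \<le> 1" if "r > 0" using that by (simp add: r_def)
    have e2: "\<epsilon> * norm x \<le> 1" if "r > 0"
    proof -
      have "(\<epsilon> * norm x)\<^sup>2 = \<epsilon> * (\<epsilon> * (x \<bullet> x))" by (simp add: dot_square_norm power2_eq_square)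
      also have "\<dots> \<le> 1 * 1" using \<epsilon> e1[OF that] by (intro mult_mono) auto
      finally show ?thesis using abs_le_square_iff[of "\<epsilon> * norm x" 1] \<epsilon> by simp
    qed
    have w: "\<bar>wave \<epsilon> \<theta> \<xi> x\<bar> \<le> 1"
      unfolding wave_def r_def[symmetric] c_def[symmetric] abs_mult using f0 cs by (intro mult_le_one) auto
    have g1: "\<bar>2 * \<epsilon> * flat 2 r * c\<bar> * norm x \<le> 12"
    proof -
      have "\<bar>2 * \<epsilon> * flat 2 r * c\<bar> * norm x = 2 * (flat 2 r * (\<epsilon> * norm x)) * \<bar>c\<bar>"
        using \<epsilon> fl by (simp add: abs_mult)
      also have "\<dots> \<le> 2 * (fact (Suc 2) * 1) * 1"
      proof (rule mult_mono)
        show "2 * (flat 2 r * (\<epsilon> * norm x)) \<le> 2 * (fact (Suc 2) * 1)"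
          using fz[of "\<epsilon> * norm x" 1 2] e2 by (intro mult_left_mono) auto
      qed (use cs in auto)
      finally show ?thesis by (simp add: fact_numeral eval_nat_numeral)
    qed
    have g: "norm (grad (wave \<epsilon> \<theta> \<xi>) x) \<le> 12 + norm \<xi>"
    proof -
      have "norm (grad (wave \<epsilon> \<theta> \<xi>) x) \<le> norm ((- 2 * \<epsilon> * flat 2 r * c) *\<^sub>R x) + norm ((flat 0 r * s) *\<^sub>R \<xi>)"
        unfolding grad_wave r_def[symmetric] c_def[symmetric] s_def[symmetric] by (rule norm_triangle_ineq4)
      also have "norm ((flat 0 r * s) *\<^sub>R \<xi>) \<le> 1 * norm \<xi>"
        unfolding norm_scaleR using f0 cs by (intro mult_right_mono) (auto simp: abs_mult intro!: mult_le_one)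
      also have "norm ((- 2 * \<epsilon> * flat 2 r * c) *\<^sub>R x) \<le> 12" using g1 by simp
      finally show ?thesis by simp
    qed
    have l1: "\<bar>4 * \<epsilon>\<^sup>2 * (x \<bullet> x) * (flat 4 r - 2 * flat 3 r)\<bar> \<le> 4 * 168"
    proof -
      have "\<bar>4 * \<epsilon>\<^sup>2 * (x \<bullet> x) * (flat 4 r - 2 * flat 3 r)\<bar> = 4 * \<epsilon> * \<bar>flat 4 r * (\<epsilon> * (x \<bullet> x)) - 2 * (flat 3 r * (\<epsilon> * (x \<bullet> x)))\<bar>"
        using \<epsilon> by (simp add: abs_mult power2_eq_square right_diff_distrib[symmetric] mult.commute[of "flat _ _"] mult.left_commute[of 2] left_diff_distrib[symmetric])
      also have "\<dots> \<le> 4 * 1 * (\<bar>flat 4 r * (\<epsilon> * (x \<bullet> x))\<bar> + \<bar>2 * (flat 3 r * (\<epsilon> * (x \<bullet> x)))\<bar>)"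
        using \<epsilon> by (intro mult_mono abs_triangle_ineq4) auto
      also have "\<bar>flat 4 r * (\<epsilon> * (x \<bullet> x))\<bar> \<le> fact (Suc 4) * 1"
        using fz[of "\<epsilon> * (x \<bullet> x)" 1 4] e1 fl \<epsilon> by simp
      also have "\<bar>2 * (flat 3 r * (\<epsilon> * (x \<bullet> x)))\<bar> \<le> 2 * (fact (Suc 3) * 1)"
        using fz[of "\<epsilon> * (x \<bullet> x)" 1 3] e1 fl \<epsilon> by simp
      finally show ?thesis by (simp add: fact_numeral eval_nat_numeral)
    qed
    have l2: "\<bar>2 * \<epsilon> * real DIM('a) * flat 2 r\<bar> \<le> 2 * real DIM('a) * 6"
    proof -
      have "\<epsilon> * flat 2 r \<le> 1 * fact (Suc 2)" using fl by (intro mult_mono[OF \<epsilon>(2) fl(2)]) auto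
      then have "2 * real DIM('a) * (\<epsilon> * flat 2 r) \<le> 2 * real DIM('a) * 6"
        by (intro mult_left_mono) (auto simp: fact_numeral eval_nat_numeral)
      then show ?thesis using \<epsilon> fl by (simp add: abs_mult ac_simps)
    qed
    have l3: "\<bar>4 * \<epsilon> * flat 2 r * (x \<bullet> \<xi>)\<bar> \<le> 4 * 6 * norm \<xi>"
    proof -
      have "\<bar>4 * \<epsilon> * flat 2 r * (x \<bullet> \<xi>)\<bar> \<le> 4 * \<epsilon> * flat 2 r * (norm x * norm \<xi>)"
        using Cauchy_Schwarz_ineq2[of x \<xi>] \<epsilon> fl by (simp add: abs_mult mult_left_mono)
      also have "\<dots> = 4 * (flat 2 r * (\<epsilon> * norm x)) * norm \<xi>" by simp
      also have "\<dots> \<le> 4 * (fact (Suc 2) * 1) * norm \<xi>"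
        using fz[of "\<epsilon> * norm x" 1 2] e2 by (intro mult_right_mono mult_left_mono) auto
      finally show ?thesis by (simp add: fact_numeral eval_nat_numeral)
    qed
    have l4: "\<bar>flat 0 r * (\<xi> \<bullet> \<xi>) * c\<bar> \<le> (norm \<xi>)\<^sup>2"
      using f0 cs mult_le_one[of "flat 0 r" "\<bar>c\<bar>"] by (simp add: abs_mult power2_norm_eq_inner[symmetric] mult.assoc mult.left_commute[of "flat 0 r"] mult_left_le)
    have prod: "\<bar>p * q\<bar> \<le> Q" if "\<bar>p\<bar> \<le> Q" "\<bar>q\<bar> \<le> 1" for p q Q :: real
      using mult_mono[OF that] that by (simp add: abs_mult)
    have "laplacian (wave \<epsilon> \<theta> \<xi>) x = (4 * \<epsilon>\<^sup>2 * (x \<bullet> x) * (flat 4 r - 2 * flat 3 r) - 2 * \<epsilon> * real DIM('a) * flat 2 r) * c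
        + 4 * \<epsilon> * flat 2 r * (x \<bullet> \<xi>) * s - flat 0 r * (\<xi> \<bullet> \<xi>) * c"
      unfolding laplacian_wave r_def c_def s_def by simp
    moreover have "\<bar>(4 * \<epsilon>\<^sup>2 * (x \<bullet> x) * (flat 4 r - 2 * flat 3 r) - 2 * \<epsilon> * real DIM('a) * flat 2 r) * c\<bar> \<le> 4 * 168 + 2 * real DIM('a) * 6"
      using l1 l2 by (intro prod cs(1)) linarith
    moreover have "\<bar>4 * \<epsilon> * flat 2 r * (x \<bullet> \<xi>) * s\<bar> \<le> 4 * 6 * norm \<xi>"
      by (rule prod[OF l3 cs(2)])
    ultimately have l: "\<bar>laplacian (wave \<epsilon> \<theta> \<xi>) x\<bar> \<le> 4 * 168 + 2 * real DIM('a) * 6 + 4 * 6 * norm \<xi> + (norm \<xi>)\<^sup>2"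
      using l4 by linarith
    have "0 \<le> 2 * real DIM('a) * 6" "0 \<le> (norm \<xi>)\<^sup>2" "0 \<le> norm \<xi>" by auto
    then show "\<bar>wave \<epsilon> \<theta> \<xi> x\<bar> \<le> K \<and> norm (grad (wave \<epsilon> \<theta> \<xi>) x) \<le> K \<and> \<bar>laplacian (wave \<epsilon> \<theta> \<xi>) x\<bar> \<le> K"
      using w g l unfolding K_def by (intro conjI) linarith+
  qed
qed

lemma flat_tendsto: "(f \<longlongrightarrow> l) F \<Longrightarrow> ((\<lambda>x. flat n (f x)) \<longlongrightarrow> flat n l) F"
  using flat_continuous[of UNIV n] continuous_on_tendsto_compose by fastforce

lemma wave_tendsto:
  fixes x :: "'a::euclidean_space"
  assumes \<epsilon>: "(\<epsilon> \<longlongrightarrow> 0) F"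
  shows "((\<lambda>k. wave (\<epsilon> k) \<theta> \<xi> x) \<longlongrightarrow> flat 0 1 * cos (\<xi> \<bullet> x + \<theta>)) F"
    and "((\<lambda>k. grad (wave (\<epsilon> k) \<theta> \<xi>) x) \<longlongrightarrow> - (flat 0 1 * sin (\<xi> \<bullet> x + \<theta>)) *\<^sub>R \<xi>) F"
    and "((\<lambda>k. laplacian (wave (\<epsilon> k) \<theta> \<xi>) x) \<longlongrightarrow> - flat 0 1 * (\<xi> \<bullet> \<xi>) * cos (\<xi> \<bullet> x + \<theta>)) F"
proof -
  have "((\<lambda>k. 1 - \<epsilon> k * (x \<bullet> x)) \<longlongrightarrow> 1 - 0 * (x \<bullet> x)) F" by (intro tendsto_intros \<epsilon>)
  then have f: "((\<lambda>k. flat n (1 - \<epsilon> k * (x \<bullet> x))) \<longlongrightarrow> flat n 1) F" for n by (intro flat_tendsto) simp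
  show "((\<lambda>k. wave (\<epsilon> k) \<theta> \<xi> x) \<longlongrightarrow> flat 0 1 * cos (\<xi> \<bullet> x + \<theta>)) F"
    unfolding wave_def by (intro tendsto_intros f)
  have "((\<lambda>k. grad (wave (\<epsilon> k) \<theta> \<xi>) x) \<longlongrightarrow> (- 2 * 0 * flat 2 1 * cos (\<xi> \<bullet> x + \<theta>)) *\<^sub>R x - (flat 0 1 * sin (\<xi> \<bullet> x + \<theta>)) *\<^sub>R \<xi>) F"
    unfolding grad_wave by (intro tendsto_intros f \<epsilon>)
  then show "((\<lambda>k. grad (wave (\<epsilon> k) \<theta> \<xi>) x) \<longlongrightarrow> - (flat 0 1 * sin (\<xi> \<bullet> x + \<theta>)) *\<^sub>R \<xi>) F" by simp
  have "((\<lambda>k. laplacian (wave (\<epsilon> k) \<theta> \<xi>) x) \<longlongrightarrow>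
     (4 * 0^2 * (x \<bullet> x) * (flat 4 1 - 2 * flat 3 1) - 2 * 0 * real DIM('a) * flat 2 1) * cos (\<xi> \<bullet> x + \<theta>)
    + 4 * 0 * flat 2 1 * (x \<bullet> \<xi>) * sin (\<xi> \<bullet> x + \<theta>) - flat 0 1 * (\<xi> \<bullet> \<xi>) * cos (\<xi> \<bullet> x + \<theta>)) F"
    unfolding laplacian_wave by (intro tendsto_intros f \<epsilon>)
  then show "((\<lambda>k. laplacian (wave (\<epsilon> k) \<theta> \<xi>) x) \<longlongrightarrow> - flat 0 1 * (\<xi> \<bullet> \<xi>) * cos (\<xi> \<bullet> x + \<theta>)) F" by simp
qed

lemma continuous_bounded_on_Ioo:
  fixes f :: "real \<Rightarrow> real"
  assumes "continuous_on UNIV f"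
  obtains L where "0 \<le> L" "\<And>t. t \<in> {0<..<T} \<Longrightarrow> \<bar>f t\<bar> \<le> L"
proof -
  have "bounded (f ` {0..T})"
    using assms by (intro compact_imp_bounded compact_continuous_image) (auto intro: continuous_on_subset)
  then obtain L where "\<forall>y\<in>f ` {0..T}. norm y \<le> L" unfolding bounded_iff by blast
  then show ?thesis by (intro that[of "max L 0"]) (auto simp: le_max_iff_disj)
qed

text \<open>
  The dominating constant for the limit in which the cutoff is removed.\<close>
lemma wave_test_bound:
  fixes \<xi> :: "'a::euclidean_space" and \<eta> \<eta>' :: "real \<Rightarrow> real"
  assumes \<eta>: "continuous_on UNIV \<eta>" "continuous_on UNIV \<eta>'" and M: "0 \<le> M"
  obtains L where "\<And>\<epsilon> t x p q. 0 < \<epsilon> \<Longrightarrow> \<epsilon> \<le> 1 \<Longrightarrow> t \<in> {0<..<T} \<Longrightarrow> \<bar>p\<bar> \<le> M \<Longrightarrow> norm q \<le> M \<Longrightarrow>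
    \<bar>\<eta>' t * wave \<epsilon> \<theta> \<xi> x + p * (\<eta> t * laplacian (wave \<epsilon> \<theta> \<xi>) x) + q \<bullet> (\<eta> t *\<^sub>R grad (wave \<epsilon> \<theta> \<xi>) x)\<bar> \<le> L"
proof -
  obtain L1 where L1: "0 \<le> L1" "\<And>t. t \<in> {0<..<T} \<Longrightarrow> \<bar>\<eta> t\<bar> \<le> L1" using continuous_bounded_on_Ioo[OF \<eta>(1)] by blast
  obtain L2 where L2: "0 \<le> L2" "\<And>t. t \<in> {0<..<T} \<Longrightarrow> \<bar>\<eta>' t\<bar> \<le> L2" using continuous_bounded_on_Ioo[OF \<eta>(2)] by blast
  obtain K where K: "\<And>\<epsilon> x. 0 < \<epsilon> \<Longrightarrow> \<epsilon> \<le> 1 \<Longrightarrow> \<bar>wave \<epsilon> \<theta> \<xi> x\<bar> \<le> K"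
    "\<And>\<epsilon> x. 0 < \<epsilon> \<Longrightarrow> \<epsilon> \<le> 1 \<Longrightarrow> norm (grad (wave \<epsilon> \<theta> \<xi>) x) \<le> K"
    "\<And>\<epsilon> x. 0 < \<epsilon> \<Longrightarrow> \<epsilon> \<le> 1 \<Longrightarrow> \<bar>laplacian (wave \<epsilon> \<theta> \<xi>) x\<bar> \<le> K"
    using wave_bounds[of \<theta> \<xi>] by blast
  have K0: "0 \<le> K" using K(1)[of 1 0] by simp
  show ?thesis
  proof (rule that[of "L2 * K + M * (L1 * K) + M * (L1 * K)"])
    fix \<epsilon> t p :: real and x q :: 'a
    assume \<epsilon>: "0 < \<epsilon>" "\<epsilon> \<le> 1" and t: "t \<in> {0<..<T}" and p: "\<bar>p\<bar> \<le> M" and q: "norm q \<le> M"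
    have "\<bar>\<eta>' t * wave \<epsilon> \<theta> \<xi> x\<bar> \<le> L2 * K"
      unfolding abs_mult using L2(1) L2(2)[OF t] K(1)[OF \<epsilon>] by (intro mult_mono) auto
    moreover have "\<bar>p * (\<eta> t * laplacian (wave \<epsilon> \<theta> \<xi>) x)\<bar> \<le> M * (L1 * K)"
      unfolding abs_mult using L1(1) L1(2)[OF t] K(3)[OF \<epsilon>] p M K0
      by (intro mult_mono mult_nonneg_nonneg) auto
    moreover have "\<bar>q \<bullet> (\<eta> t *\<^sub>R grad (wave \<epsilon> \<theta> \<xi>) x)\<bar> \<le> M * (L1 * K)"
    proof -
      have "\<bar>q \<bullet> (\<eta> t *\<^sub>R grad (wave \<epsilon> \<theta> \<xi>) x)\<bar> \<le> norm q * (\<bar>\<eta> t\<bar> * norm (grad (wave \<epsilon> \<theta> \<xi>) x))"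
        using Cauchy_Schwarz_ineq2[of q "\<eta> t *\<^sub>R grad (wave \<epsilon> \<theta> \<xi>) x"] by simp
      also have "\<dots> \<le> M * (L1 * K)"
        using L1(1) L1(2)[OF t] K(2)[OF \<epsilon>] q M by (intro mult_mono mult_nonneg_nonneg) auto
      finally show ?thesis .
    qed
    ultimately show "\<bar>\<eta>' t * wave \<epsilon> \<theta> \<xi> x + p * (\<eta> t * laplacian (wave \<epsilon> \<theta> \<xi>) x) + q \<bullet> (\<eta> t *\<^sub>R grad (wave \<epsilon> \<theta> \<xi>) x)\<bar>
      \<le> L2 * K + M * (L1 * K) + M * (L1 * K)" by linarith
  qed
qed

lemma wave_measurable [measurable]:
  "wave \<epsilon> \<theta> \<xi> \<in> borel_measurable borel"
  "grad (wave \<epsilon> \<theta> \<xi>) \<in> borel_measurable borel"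
  "laplacian (wave \<epsilon> \<theta> \<xi>) \<in> borel_measurable borel"
proof -
  show "laplacian (wave \<epsilon> \<theta> \<xi>) \<in> borel_measurable borel"
    unfolding laplacian_wave[abs_def] by measurable
  show "grad (wave \<epsilon> \<theta> \<xi>) \<in> borel_measurable borel"
    unfolding grad_wave[abs_def] by measurable
  show "wave \<epsilon> \<theta> \<xi> \<in> borel_measurable borel"
    unfolding wave_def[abs_def] by measurable
qed

section \<open>Uniqueness for bounded Borel coefficients\<close>

lemma borel_measurable_fst [measurable]: "fst \<in> borel_measurable (borel :: ('b::second_countable_topology \<times> 'c::second_countable_topology) measure)"
  by (simp add: borel_prod[symmetric])

lemma borel_measurable_snd [measurable]: "snd \<in> borel_measurable (borel :: ('b::second_countable_topology \<times> 'c::second_countable_topology) measure)"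
  by (simp add: borel_prod[symmetric])

lemma fourier_pi: "fourier (\<theta> + pi) f \<xi> = - fourier \<theta> f \<xi>"
  unfolding fourier_def by (simp add: add.assoc[symmetric])

text \<open>
  The absorption argument at a single frequency. In applications, \<open>V\<close>, \<open>A\<close> and \<open>h\<close> are transforms of \<open>v\<close>,
  \<open>a v\<close> and \<open>B v\<close>, and \<open>X = |\<xi>|\<^sup>2\<close>. The factor \<open>X / (1 + X) = 1 - 1 / (1 + X)\<close> isolates the good term
  \<open>- 2 V A\<close>. Young's inequality with parameter \<open>\<kappa>\<close> is applied to two remainders, each of which costs
  \<open>V\<^sup>2 / \<kappa> / (1 + X)\<close>. This explains the rate \<open>2 / \<kappa>\<close>, for which the two costs cancel.\<close>
lemma spectral_energy_bound:
  fixes V A X \<kappa> :: real and h \<xi> :: "'b \<Rightarrow> real"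
  assumes \<kappa>: "\<kappa> > 0" and "finite I" and X: "X = (\<Sum>i\<in>I. (\<xi> i)\<^sup>2)"
  shows "(2 * (V * (- X * A + (\<Sum>i\<in>I. \<xi> i * h i))) - (2 / \<kappa>) * V\<^sup>2) / (1 + X)
    \<le> - 2 * (V * A) + \<kappa> * A\<^sup>2 + \<kappa> * (\<Sum>i\<in>I. (h i)\<^sup>2)"
proof -
  define \<omega> where "\<omega> = 1 / (1 + X)"
  define H where "H = (\<Sum>i\<in>I. \<xi> i * h i)"
  define S where "S = (\<Sum>i\<in>I. (h i)\<^sup>2)"
  have X0: "0 \<le> X" unfolding X by (intro sum_nonneg) auto
  have \<omega>: "0 \<le> \<omega>" "\<omega> \<le> 1" "\<omega> * X = 1 - \<omega>" using X0 by (auto simp: \<omega>_def field_simps)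
  have S0: "0 \<le> S" unfolding S_def by (intro sum_nonneg) auto
  have "H\<^sup>2 \<le> X * S"
    unfolding H_def S_def X by (rule Cauchy_Schwarz_ineq_sum)
  then have "\<omega> * H\<^sup>2 \<le> \<omega> * (X * S)" using \<omega>(1) by (rule mult_left_mono)
  also have "\<dots> = (\<omega> * X) * S" by simp
  also have "\<dots> \<le> 1 * S" using \<omega> S0 by (intro mult_right_mono) auto
  finally have H: "\<omega> * H\<^sup>2 \<le> S" by simp
  have young: "2 * (V * Y) \<le> V\<^sup>2 / \<kappa> + \<kappa> * Y\<^sup>2" for Y
  proof -
    have "0 \<le> (V - \<kappa> * Y)\<^sup>2 / \<kappa>" using \<kappa> by simp
    also have "\<dots> = V\<^sup>2 / \<kappa> + \<kappa> * Y\<^sup>2 - 2 * (V * Y)"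
      using \<kappa> by (simp add: power2_eq_square field_simps)
    finally show ?thesis by simp
  qed
  have y\<omega>: "\<omega> * (2 * (V * Y)) \<le> \<omega> * (V\<^sup>2 / \<kappa>) + \<kappa> * (\<omega> * Y\<^sup>2)" for Y
    using mult_left_mono[OF young \<omega>(1), of Y] by (simp only: distrib_left mult.left_commute)
  have "\<kappa> * (\<omega> * A\<^sup>2) \<le> \<kappa> * A\<^sup>2" using \<omega> \<kappa> by (intro mult_left_mono) (auto simp: mult_left_le_one_le)
  moreover have "\<kappa> * (\<omega> * H\<^sup>2) \<le> \<kappa> * S" using H \<kappa> by (intro mult_left_mono) auto
  moreover have "(2 * (V * (- X * A + H)) - (2 / \<kappa>) * V\<^sup>2) / (1 + X)
     = - 2 * (V * A) + \<omega> * (2 * (V * A)) + \<omega> * (2 * (V * H)) - 2 * (\<omega> * (V\<^sup>2 / \<kappa>))"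
  proof -
    have "(2 * (V * (- X * A + H)) - (2 / \<kappa>) * V\<^sup>2) / (1 + X) = \<omega> * (2 * (V * (- X * A + H)) - (2 / \<kappa>) * V\<^sup>2)"
      by (simp add: \<omega>_def)
    also have "\<dots> = - 2 * (V * A) * (\<omega> * X) + \<omega> * (2 * (V * H)) - 2 * (\<omega> * (V\<^sup>2 / \<kappa>))"
      by (simp add: algebra_simps)
    also have "\<dots> = - 2 * (V * A) + \<omega> * (2 * (V * A)) + \<omega> * (2 * (V * H)) - 2 * (\<omega> * (V\<^sup>2 / \<kappa>))"
      unfolding \<omega>(3) by (simp add: algebra_simps)
    finally show ?thesis .
  qed
  ultimately have "(2 * (V * (- X * A + H)) - (2 / \<kappa>) * V\<^sup>2) / (1 + X) \<le> - 2 * (V * A) + \<kappa> * A\<^sup>2 + \<kappa> * S"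
    using y\<omega>[of A] y\<omega>[of H] by linarith
  then show ?thesis by (simp only: H_def S_def)
qed

lemma has_bochner_integral_combination:
  fixes f g :: "'b \<Rightarrow> real"
  assumes "has_bochner_integral N f x" "has_bochner_integral N g y" "\<And>i. i \<in> I \<Longrightarrow> has_bochner_integral N (k i) (z i)"
  shows "has_bochner_integral N (\<lambda>w. p * f w + q * g w + r * (\<Sum>i\<in>I. k i w)) (p * x + q * y + r * (\<Sum>i\<in>I. z i))"
  by (intro has_bochner_integral_add has_bochner_integral_mult_right has_bochner_integral_sum assms)

text \<open>
  The equation with Borel coefficients that satisfy their bounds at every point, and with a solution that
  is extended by \<open>0\<close> outside the time interval. The weak formulation is assumed for cutoff plane waves,
  with the derivatives of the test function written out.\<close>
locale uniformly_parabolic_equation =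
  fixes T :: real and v a :: "real \<times> 'a::euclidean_space \<Rightarrow> real" and B :: "real \<times> 'a \<Rightarrow> 'a"
    and \<alpha> M C :: real
  assumes T: "T > 0" and \<alpha>: "\<alpha> > 0" and M: "M \<ge> 1"
    and v_int: "integrable lborel v" and v_bd: "\<And>z. \<bar>v z\<bar> \<le> C"
    and v_zero: "\<And>z. fst z \<notin> {0<..<T} \<Longrightarrow> v z = 0"
    and a_meas [measurable]: "a \<in> borel_measurable borel" and a_ge: "\<And>z. \<alpha> \<le> a z" and a_le: "\<And>z. a z \<le> M"
    and B_meas [measurable]: "B \<in> borel_measurable borel" and B_bd: "\<And>z. norm (B z) \<le> M"
    and weak: "\<And>\<eta> \<eta>' e \<epsilon> \<theta> \<xi>. (\<And>t. (\<eta> has_real_derivative \<eta>' t) (at t)) \<Longrightarrow> continuous_on UNIV \<eta>' \<Longrightarrow>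
      smooth_expr (\<lambda>z::real \<times> 'a. \<eta> (fst z)) \<Longrightarrow> e < T \<Longrightarrow> (\<And>t. t \<notin> {-3..e} \<Longrightarrow> \<eta> t = 0) \<Longrightarrow>
      0 < \<epsilon> \<Longrightarrow> \<epsilon> \<le> 1 \<Longrightarrow>
      (LBINT z. v z * (\<eta>' (fst z) * wave \<epsilon> \<theta> \<xi> (snd z)
        + a z * (\<eta> (fst z) * laplacian (wave \<epsilon> \<theta> \<xi>) (snd z))
        + B z \<bullet> (\<eta> (fst z) *\<^sub>R grad (wave \<epsilon> \<theta> \<xi>) (snd z)))) = 0"
begin

lemma v_meas [measurable]: "v \<in> borel_measurable borel"
  using v_int by auto

text \<open>
  The limit \<open>\<epsilon> \<rightarrow> 0\<close> in the weak formulation. The integrands are dominated by a multiple of the integrable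
  function \<open>\<bar>v\<bar>\<close>, and the constant \<open>flat 0 1\<close> is divided out at the end.\<close>
lemma tested_with_wave:
  assumes \<eta>: "\<And>t. (\<eta> has_real_derivative \<eta>' t) (at t)" "continuous_on UNIV \<eta>'"
    "smooth_expr (\<lambda>z::real \<times> 'a. \<eta> (fst z))" "e < T" "\<And>t. t \<notin> {-3..e} \<Longrightarrow> \<eta> t = 0"
  shows "(LBINT z. v z * (\<eta>' (fst z) * cos (\<xi> \<bullet> snd z + \<theta>)
     - \<eta> (fst z) * (a z * (\<xi> \<bullet> \<xi>) * cos (\<xi> \<bullet> snd z + \<theta>) + (B z \<bullet> \<xi>) * sin (\<xi> \<bullet> snd z + \<theta>)))) = 0"
proof -
  have c\<eta>: "continuous_on UNIV \<eta>"
    using \<eta>(1) by (meson DERIV_continuous continuous_at_imp_continuous_on)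
  have [measurable]: "\<eta> \<in> borel_measurable borel" "\<eta>' \<in> borel_measurable borel"
    using c\<eta> \<eta>(2) by (auto intro: borel_measurable_continuous_onI)
  obtain L where L: "\<And>\<epsilon> t x p q. 0 < \<epsilon> \<Longrightarrow> \<epsilon> \<le> 1 \<Longrightarrow> t \<in> {0<..<T} \<Longrightarrow> \<bar>p\<bar> \<le> M \<Longrightarrow> norm q \<le> M \<Longrightarrow>
    \<bar>\<eta>' t * wave \<epsilon> \<theta> \<xi> x + p * (\<eta> t * laplacian (wave \<epsilon> \<theta> \<xi>) x) + q \<bullet> (\<eta> t *\<^sub>R grad (wave \<epsilon> \<theta> \<xi>) x)\<bar> \<le> L"
    using wave_test_bound[OF c\<eta> \<eta>(2), of M T \<theta> \<xi>] M by auto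
  define \<epsilon> where "\<epsilon> = (\<lambda>k. inverse (real (Suc k)))"
  have \<epsilon>: "0 < \<epsilon> k" "\<epsilon> k \<le> 1" "\<epsilon> \<longlonglongrightarrow> 0" for k
    using LIMSEQ_inverse_real_of_nat by (auto simp: \<epsilon>_def field_simps)
  define F where "F = (\<lambda>k z. v z * (\<eta>' (fst z) * wave (\<epsilon> k) \<theta> \<xi> (snd z)
      + a z * (\<eta> (fst z) * laplacian (wave (\<epsilon> k) \<theta> \<xi>) (snd z))
      + B z \<bullet> (\<eta> (fst z) *\<^sub>R grad (wave (\<epsilon> k) \<theta> \<xi>) (snd z))))"
  define G where "G = (\<lambda>z. v z * (\<eta>' (fst z) * (flat 0 1 * cos (\<xi> \<bullet> snd z + \<theta>))
      + a z * (\<eta> (fst z) * (- flat 0 1 * (\<xi> \<bullet> \<xi>) * cos (\<xi> \<bullet> snd z + \<theta>)))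
      + B z \<bullet> (\<eta> (fst z) *\<^sub>R (- (flat 0 1 * sin (\<xi> \<bullet> snd z + \<theta>)) *\<^sub>R \<xi>))))"
  have F0: "(LBINT z. F k z) = 0" for k
    unfolding F_def by (rule weak[OF \<eta> \<epsilon>(1,2)])
  have "(\<lambda>k. LBINT z. F k z) \<longlonglongrightarrow> (LBINT z. G z)"
  proof (rule integral_dominated_convergence[where w="\<lambda>z. L * \<bar>v z\<bar>"])
    show "AE z in lborel. (\<lambda>k. F k z) \<longlonglongrightarrow> G z"
      unfolding F_def G_def by (intro AE_I2 tendsto_intros wave_tendsto \<epsilon>(3))
    show "AE z in lborel. norm (F k z) \<le> L * \<bar>v z\<bar>" for k
    proof (rule AE_I2)
      fix z :: "real \<times> 'a"
      show "norm (F k z) \<le> L * \<bar>v z\<bar>"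
      proof (cases "fst z \<in> {0<..<T}")
        case False
        then show ?thesis using v_zero by (simp add: F_def)
      next
        case True
        have "\<bar>a z\<bar> \<le> M" using a_ge[of z] a_le[of z] \<alpha> by linarith
        from L[OF \<epsilon>(1,2) True this B_bd]
        show ?thesis
          unfolding F_def real_norm_def abs_mult by (subst mult.commute) (rule mult_right_mono, auto)
      qed
    qed
    show "F k \<in> borel_measurable lborel" for k unfolding F_def by measurable
    show "G \<in> borel_measurable lborel" unfolding G_def by measurable
  qed (use v_int in auto)
  then have "(LBINT z. G z) = 0" by (simp add: F0 LIMSEQ_const_iff)
  moreover have "G z = flat 0 1 * (v z * (\<eta>' (fst z) * cos (\<xi> \<bullet> snd z + \<theta>)
     - \<eta> (fst z) * (a z * (\<xi> \<bullet> \<xi>) * cos (\<xi> \<bullet> snd z + \<theta>) + (B z \<bullet> \<xi>) * sin (\<xi> \<bullet> snd z + \<theta>))))" for z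
    unfolding G_def by (simp add: algebra_simps)
  moreover have "flat 0 1 \<noteq> 0" by (simp add: flat_def)
  ultimately show ?thesis by simp
qed

lemma integrable_v_mult:
  assumes k: "k \<in> borel_measurable borel" and L: "\<And>z. fst z \<in> {0<..<T} \<Longrightarrow> \<bar>k z\<bar> \<le> L"
  shows "integrable lborel (\<lambda>z. v z * k z)"
proof (rule Bochner_Integration.integrable_bound)
  show "integrable lborel (\<lambda>z. L * v z)" using v_int by simp
  show "AE z in lborel. norm (v z * k z) \<le> norm (L * v z)"
  proof (rule AE_I2)
    fix z show "norm (v z * k z) \<le> norm (L * v z)"
    proof (cases "fst z \<in> {0<..<T}")
      case True
      then have "\<bar>v z\<bar> * \<bar>k z\<bar> \<le> \<bar>v z\<bar> * \<bar>L\<bar>" using L[OF True] by (intro mult_left_mono) auto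
      then show ?thesis by (simp add: abs_mult mult.commute)
    qed (simp add: v_zero)
  qed
qed (use k in auto)

lemma AE_slice_integrable: "AE t in lborel. integrable lborel (\<lambda>x. v (t, x))"
  by (rule lborel_pair.AE_integrable_fst') (use v_int in \<open>simp add: lborel_prod\<close>)

lemma slice_mult_integrable:
  assumes "integrable lborel (\<lambda>x. v (t, x))" "k \<in> borel_measurable borel" "\<And>z. \<bar>k z\<bar> \<le> L"
  shows "integrable lborel (\<lambda>x. v (t, x) * k (t, x))"
  using assms by (intro integrable_mult_bounded) auto

text \<open>
  The time derivative that the equation prescribes for the transform of \<open>v\<close> with phase \<open>\<theta>\<close> at
  frequency \<open>\<xi>\<close>.\<close>
definition flux :: "real \<Rightarrow> 'a \<Rightarrow> real \<Rightarrow> real" where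
  "flux \<theta> \<xi> t = - (LBINT x. v (t, x) * (a (t, x) * (\<xi> \<bullet> \<xi>) * cos (\<xi> \<bullet> x + \<theta>)
      + (B (t, x) \<bullet> \<xi>) * sin (\<xi> \<bullet> x + \<theta>)))"

lemma flux_kernel_bound:
  "\<bar>a z * (\<xi> \<bullet> \<xi>) * cos p + (B z \<bullet> \<xi>) * sin q\<bar> \<le> M * (\<xi> \<bullet> \<xi>) + M * norm \<xi>"
proof -
  have "\<bar>a z * (\<xi> \<bullet> \<xi>) * cos p\<bar> \<le> (M * (\<xi> \<bullet> \<xi>)) * 1"
    unfolding abs_mult using a_ge[of z] a_le[of z] \<alpha> M by (intro mult_mono) auto
  moreover have "\<bar>B z \<bullet> \<xi>\<bar> \<le> M * norm \<xi>"
    using Cauchy_Schwarz_ineq2[of "B z" \<xi>] B_bd[of z] mult_right_mono[OF B_bd[of z] norm_ge_zero[of \<xi>]] by linarith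
  then have "\<bar>(B z \<bullet> \<xi>) * sin q\<bar> \<le> (M * norm \<xi>) * 1"
    unfolding abs_mult using M by (intro mult_mono) auto
  ultimately show ?thesis by linarith
qed

lemma slice_integral:
  assumes k: "k \<in> borel_measurable borel" and L: "\<And>z. fst z \<in> {0<..<T} \<Longrightarrow> \<bar>k z\<bar> \<le> L"
  shows "integrable lborel (\<lambda>t. LBINT x. v (t, x) * k (t, x))"
    and "(LBINT t. (LBINT x. v (t, x) * k (t, x))) = (LBINT z. v z * k z)"
  using lborel_pair.integrable_fst'[of "\<lambda>z. v z * k z"] lborel_pair.integral_fst'[of "\<lambda>z. v z * k z"] integrable_v_mult[OF k L]
  by (auto simp: lborel_prod)

lemma slice_zero: "t \<notin> {0<..<T} \<Longrightarrow> v (t, x) = 0"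
  using v_zero[of "(t, x)"] by simp

lemma fourier_v_integrable: "integrable lborel (\<lambda>t. fourier \<theta> (\<lambda>x. v (t, x)) \<xi>)"
proof -
  have "integrable lborel (\<lambda>t. LBINT x. v (t, x) * (\<lambda>z. cos (\<xi> \<bullet> snd z + \<theta>)) (t, x))"
    by (rule slice_integral(1)[of _ 1]) auto
  then show ?thesis by (simp add: fourier_def)
qed

lemma flux_integrable: "integrable lborel (flux \<theta> \<xi>)"
proof -
  have "integrable lborel (\<lambda>t. LBINT x. v (t, x) * (\<lambda>z. a z * (\<xi> \<bullet> \<xi>) * cos (\<xi> \<bullet> snd z + \<theta>)
      + (B z \<bullet> \<xi>) * sin (\<xi> \<bullet> snd z + \<theta>)) (t, x))"
    by (rule slice_integral(1)[OF _ flux_kernel_bound]) measurable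
  then show ?thesis unfolding flux_def[abs_def] by simp
qed

lemma fourier_v_eq_primitive:
  "AE t in lborel. t \<in> {0<..<T} \<longrightarrow> fourier \<theta> (\<lambda>x. v (t, x)) \<xi> = primitive (flux \<theta> \<xi>) t"
proof (rule weak_derivative_imp_primitive[where 'a='a])
  fix \<eta> \<eta>' :: "real \<Rightarrow> real" and e
  assume \<eta>: "\<And>t. (\<eta> has_real_derivative \<eta>' t) (at t)" "continuous_on UNIV \<eta>'"
    "smooth_expr (\<lambda>z::real \<times> 'a. \<eta> (fst z))" "e < T" "\<And>t. t \<notin> {-3..e} \<Longrightarrow> \<eta> t = 0"
  have c\<eta>: "continuous_on UNIV \<eta>"
    using \<eta>(1) by (meson DERIV_continuous continuous_at_imp_continuous_on)
  have [measurable]: "\<eta> \<in> borel_measurable borel" "\<eta>' \<in> borel_measurable borel"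
    using c\<eta> \<eta>(2) by (auto intro: borel_measurable_continuous_onI)
  define k where "k = (\<lambda>z. \<eta>' (fst z) * cos (\<xi> \<bullet> snd z + \<theta>)
     - \<eta> (fst z) * (a z * (\<xi> \<bullet> \<xi>) * cos (\<xi> \<bullet> snd z + \<theta>) + (B z \<bullet> \<xi>) * sin (\<xi> \<bullet> snd z + \<theta>)))"
  have [measurable]: "k \<in> borel_measurable borel" unfolding k_def by measurable
  obtain L1 where L1: "0 \<le> L1" "\<And>t. t \<in> {0<..<T} \<Longrightarrow> \<bar>\<eta> t\<bar> \<le> L1" using continuous_bounded_on_Ioo[OF c\<eta>] by blast
  obtain L2 where L2: "0 \<le> L2" "\<And>t. t \<in> {0<..<T} \<Longrightarrow> \<bar>\<eta>' t\<bar> \<le> L2" using continuous_bounded_on_Ioo[OF \<eta>(2)] by blast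
  have kb: "\<bar>k z\<bar> \<le> L2 * 1 + L1 * (M * (\<xi> \<bullet> \<xi>) + M * norm \<xi>)" if "fst z \<in> {0<..<T}" for z
  proof -
    have "\<bar>k z\<bar> \<le> \<bar>\<eta>' (fst z)\<bar> * \<bar>cos (\<xi> \<bullet> snd z + \<theta>)\<bar>
       + \<bar>\<eta> (fst z)\<bar> * \<bar>a z * (\<xi> \<bullet> \<xi>) * cos (\<xi> \<bullet> snd z + \<theta>) + (B z \<bullet> \<xi>) * sin (\<xi> \<bullet> snd z + \<theta>)\<bar>"
      unfolding k_def abs_mult[symmetric] by (rule abs_triangle_ineq4)
    also have "\<dots> \<le> L2 * 1 + L1 * (M * (\<xi> \<bullet> \<xi>) + M * norm \<xi>)"
      using L1 L2 that flux_kernel_bound by (intro add_mono mult_mono) auto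
    finally show ?thesis .
  qed
  have "0 = (LBINT z. v z * k z)"
    unfolding k_def by (rule tested_with_wave[OF \<eta>, symmetric])
  also have "\<dots> = (LBINT t. (LBINT x. v (t, x) * k (t, x)))"
    by (rule slice_integral(2)[OF _ kb, symmetric]) measurable
  also have "\<dots> = (LBINT t. \<eta>' t * fourier \<theta> (\<lambda>x. v (t, x)) \<xi> + \<eta> t * flux \<theta> \<xi> t)"
  proof (rule integral_cong_AE)
    show "AE t in lborel. (LBINT x. v (t, x) * k (t, x)) = \<eta>' t * fourier \<theta> (\<lambda>x. v (t, x)) \<xi> + \<eta> t * flux \<theta> \<xi> t"
      using AE_slice_integrable
    proof eventually_elim
      case (elim t)
      have i1: "integrable lborel (\<lambda>x. v (t, x) * cos (\<xi> \<bullet> x + \<theta>))" by (rule integrable_times_cos[OF elim])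
      have i2: "integrable lborel (\<lambda>x. v (t, x) * (a (t, x) * (\<xi> \<bullet> \<xi>) * cos (\<xi> \<bullet> x + \<theta>)
          + (B (t, x) \<bullet> \<xi>) * sin (\<xi> \<bullet> x + \<theta>)))"
        by (rule integrable_mult_bounded[OF elim _ flux_kernel_bound]) measurable
      have "(LBINT x. v (t, x) * k (t, x)) = (LBINT x. \<eta>' t * (v (t, x) * cos (\<xi> \<bullet> x + \<theta>))
         - \<eta> t * (v (t, x) * (a (t, x) * (\<xi> \<bullet> \<xi>) * cos (\<xi> \<bullet> x + \<theta>) + (B (t, x) \<bullet> \<xi>) * sin (\<xi> \<bullet> x + \<theta>))))"
        by (intro Bochner_Integration.integral_cong) (auto simp: k_def algebra_simps)
      also have "\<dots> = \<eta>' t * fourier \<theta> (\<lambda>x. v (t, x)) \<xi> + \<eta> t * flux \<theta> \<xi> t"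
        unfolding fourier_def flux_def by (subst Bochner_Integration.integral_diff) (use i1 i2 in auto)
      finally show ?case .
    qed
    have "integrable lborel (\<lambda>t. LBINT x. v (t, x) * k (t, x))"
      by (rule slice_integral(1)[OF _ kb]) measurable
    then show "(\<lambda>t. LBINT x. v (t, x) * k (t, x)) \<in> borel_measurable lborel" by auto
    show "(\<lambda>t. \<eta>' t * fourier \<theta> (\<lambda>x. v (t, x)) \<xi> + \<eta> t * flux \<theta> \<xi> t) \<in> borel_measurable lborel"
      using borel_measurable_integrable[OF fourier_v_integrable[of \<theta> \<xi>]] borel_measurable_integrable[OF flux_integrable[of \<theta> \<xi>]] by auto
  qed
  finally show "(LBINT t. \<eta>' t * fourier \<theta> (\<lambda>x. v (t, x)) \<xi> + \<eta> t * flux \<theta> \<xi> t) = 0" by simp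
next
  show "integrable lborel (\<lambda>t. fourier \<theta> (\<lambda>x. v (t, x)) \<xi>)" by (rule fourier_v_integrable)
  show "integrable lborel (flux \<theta> \<xi>)" by (rule flux_integrable)
  show "0 < T" by (rule T)
qed (simp_all add: slice_zero fourier_def flux_def)

definition decay :: "real \<Rightarrow> real \<Rightarrow> real" where
  "decay \<mu> t = indicator {0<..<T} t * exp (- \<mu> * t)"

lemma decay_measurable [measurable]: "decay \<mu> \<in> borel_measurable borel"
  unfolding decay_def[abs_def] by measurable

lemma decay_bounds: "0 \<le> \<mu> \<Longrightarrow> 0 \<le> decay \<mu> t \<and> decay \<mu> t \<le> 1"
  by (auto simp: decay_def indicator_def)

text \<open>
  The weighted energy inequality for the primitive of the flux carries over to the transform of \<open>v\<close>,
  because the two agree at almost every time.\<close>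
lemma frequency_energy:
  assumes \<mu>: "\<mu> \<ge> 0"
  shows "integrable lborel (\<lambda>t. decay \<mu> t * (2 * (fourier \<theta> (\<lambda>x. v (t, x)) \<xi> * flux \<theta> \<xi> t) - \<mu> * (fourier \<theta> (\<lambda>x. v (t, x)) \<xi>)\<^sup>2))"
    and "0 \<le> (LBINT t. decay \<mu> t * (2 * (fourier \<theta> (\<lambda>x. v (t, x)) \<xi> * flux \<theta> \<xi> t) - \<mu> * (fourier \<theta> (\<lambda>x. v (t, x)) \<xi>)\<^sup>2))"
proof -
  define V where "V = (\<lambda>t. fourier \<theta> (\<lambda>x. v (t, x)) \<xi>)"
  define G where "G = flux \<theta> \<xi>"
  define W where "W = primitive G"
  have G: "integrable lborel G" "\<And>t. t \<notin> {0<..<T} \<Longrightarrow> G t = 0"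
    using flux_integrable slice_zero by (auto simp: G_def flux_def)
  have [measurable]: "G \<in> borel_measurable borel" using G by auto
  have [measurable]: "W \<in> borel_measurable borel" unfolding W_def by measurable
  have [measurable]: "V \<in> borel_measurable borel"
    using borel_measurable_integrable[OF fourier_v_integrable[of \<theta> \<xi>]] by (simp add: V_def)
  define N where "N = (LBINT s. \<bar>G s\<bar>)"
  have N: "\<bar>W t\<bar> \<le> N" for t unfolding W_def N_def by (rule primitive_bound[OF G(1)])
  have d: "\<bar>decay \<mu> t\<bar> \<le> 1" for t using decay_bounds[OF \<mu>, of t] by auto
  have i1: "integrable lborel (\<lambda>t. decay \<mu> t * (W t * G t))"
  proof -
    have "integrable lborel (\<lambda>t. G t * W t * decay \<mu> t)"
      by (rule integrable_mult_bounded[OF integrable_mult_bounded[OF G(1) _ N] _ d]) measurable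
    then show ?thesis by (simp add: ac_simps)
  qed
  have i2: "integrable lborel (\<lambda>t. decay \<mu> t * (W t)\<^sup>2)"
  proof -
    have "(W t)\<^sup>2 \<le> N\<^sup>2" for t by (metis N power2_abs power_mono abs_ge_zero)
    then have "\<bar>exp (- \<mu> * t) * indicator {0<..<T} t * (W t)\<^sup>2\<bar> \<le> 1 * N\<^sup>2" for t
      unfolding abs_mult using d[of t] by (intro mult_mono) (auto simp: decay_def abs_mult mult.commute)
    then have "integrable lborel (\<lambda>t. indicator {0<..<T} t * (exp (- \<mu> * t) * indicator {0<..<T} t * (W t)\<^sup>2))"
      by (intro integrable_mult_bounded[OF integrable_indicator_Ioo]) auto
    moreover have "(\<lambda>t. indicator {0<..<T} t * (exp (- \<mu> * t) * indicator {0<..<T} t * (W t)\<^sup>2)) = (\<lambda>t. decay \<mu> t * (W t)\<^sup>2)"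
      by (auto simp: decay_def indicator_def fun_eq_iff)
    ultimately show ?thesis by simp
  qed
  have eq: "AE t in lborel. decay \<mu> t * (2 * (V t * G t) - \<mu> * (V t)\<^sup>2) = 2 * (decay \<mu> t * (W t * G t)) - \<mu> * (decay \<mu> t * (W t)\<^sup>2)"
    using fourier_v_eq_primitive[of \<theta> \<xi>]
  proof eventually_elim
    case (elim t)
    show ?case
    proof (cases "t \<in> {0<..<T}")
      case True
      then have "V t = W t" using elim by (simp add: V_def W_def G_def)
      then show ?thesis by (simp add: algebra_simps)
    qed (simp add: decay_def)
  qed
  have "integrable lborel (\<lambda>t. 2 * (decay \<mu> t * (W t * G t)) - \<mu> * (decay \<mu> t * (W t)\<^sup>2))"
    using i1 i2 by auto
  then have "integrable lborel (\<lambda>t. decay \<mu> t * (2 * (V t * G t) - \<mu> * (V t)\<^sup>2))"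
    by (subst integrable_cong_AE[OF _ _ eq]) auto
  then show "integrable lborel (\<lambda>t. decay \<mu> t * (2 * (fourier \<theta> (\<lambda>x. v (t, x)) \<xi> * flux \<theta> \<xi> t) - \<mu> * (fourier \<theta> (\<lambda>x. v (t, x)) \<xi>)\<^sup>2))"
    by (simp add: V_def G_def)
  have "(LBINT t. decay \<mu> t * (2 * (V t * G t) - \<mu> * (V t)\<^sup>2))
      = 2 * (LBINT t. decay \<mu> t * (W t * G t)) - (LBINT t. \<mu> * (decay \<mu> t * (W t)\<^sup>2))"
    using i1 i2 by (subst integral_cong_AE[OF _ _ eq]) auto
  also have "(LBINT t. decay \<mu> t * (W t * G t)) = (LBINT t. exp (- \<mu> * t) * (W t * G t))"
    using G(2) by (intro Bochner_Integration.integral_cong) (auto simp: decay_def indicator_def)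
  also have "(LBINT t. \<mu> * (decay \<mu> t * (W t)\<^sup>2)) = (LBINT t. indicator {0<..<T} t * (\<mu> * exp (- \<mu> * t)) * (W t)\<^sup>2)"
    by (intro Bochner_Integration.integral_cong) (auto simp: decay_def indicator_def)
  finally have "0 \<le> (LBINT t. decay \<mu> t * (2 * (V t * G t) - \<mu> * (V t)\<^sup>2))"
    using weighted_energy[OF G(1), of T \<mu>, OF G(2)] by (simp add: W_def)
  then show "0 \<le> (LBINT t. decay \<mu> t * (2 * (fourier \<theta> (\<lambda>x. v (t, x)) \<xi> * flux \<theta> \<xi> t) - \<mu> * (fourier \<theta> (\<lambda>x. v (t, x)) \<xi>)\<^sup>2))"
    by (simp add: V_def G_def)
qed

text \<open>
  Derivatives in space become multiplications by \<open>\<xi>\<close>. The first order term changes the phase by \<open>\<pi>/2\<close>.\<close>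
lemma flux_spectral:
  assumes t: "integrable lborel (\<lambda>x. v (t, x))"
  shows "flux \<theta> \<xi> t = - (\<xi> \<bullet> \<xi>) * fourier \<theta> (\<lambda>x. v (t, x) * a (t, x)) \<xi>
     + (\<Sum>i\<in>Basis. (\<xi> \<bullet> i) * fourier (\<theta> + pi / 2) (\<lambda>x. v (t, x) * (B (t, x) \<bullet> i)) \<xi>)"
proof -
  have A: "integrable lborel (\<lambda>x. v (t, x) * a (t, x))"
    by (rule slice_mult_integrable[OF t, of a M]) (use a_ge a_le \<alpha> in \<open>auto simp: abs_le_iff intro: order_trans[of _ 0] order_trans[OF _ a_ge]\<close>, smt (verit) M a_ge)
  have Bi: "integrable lborel (\<lambda>x. v (t, x) * (B (t, x) \<bullet> i))" if "i \<in> Basis" for i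
    using slice_mult_integrable[OF t, of "\<lambda>z. B z \<bullet> i" M] Basis_le_norm[OF that] B_bd order_trans by fastforce
  have i1: "integrable lborel (\<lambda>x. v (t, x) * a (t, x) * cos (\<xi> \<bullet> x + \<theta>))"
    by (rule integrable_times_cos[OF A])
  have i2: "integrable lborel (\<lambda>x. v (t, x) * (B (t, x) \<bullet> i) * cos (\<xi> \<bullet> x + (\<theta> + pi / 2)))" if "i \<in> Basis" for i
    by (rule integrable_times_cos[OF Bi[OF that]])
  have "flux \<theta> \<xi> t = (LBINT x. - (\<xi> \<bullet> \<xi>) * (v (t, x) * a (t, x) * cos (\<xi> \<bullet> x + \<theta>))
      + (\<Sum>i\<in>Basis. (\<xi> \<bullet> i) * (v (t, x) * (B (t, x) \<bullet> i) * cos (\<xi> \<bullet> x + (\<theta> + pi / 2)))))"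
  proof (unfold flux_def, subst Bochner_Integration.integral_minus[symmetric], intro Bochner_Integration.integral_cong refl)
    fix x
    have c: "cos (\<xi> \<bullet> x + (\<theta> + pi / 2)) = - sin (\<xi> \<bullet> x + \<theta>)"
      by (simp add: add.assoc[symmetric] cos_add)
    have "(\<Sum>i\<in>Basis. (\<xi> \<bullet> i) * (v (t, x) * (B (t, x) \<bullet> i) * cos (\<xi> \<bullet> x + (\<theta> + pi / 2))))
       = (- v (t, x) * sin (\<xi> \<bullet> x + \<theta>)) * (\<Sum>i\<in>Basis. (B (t, x) \<bullet> i) * (\<xi> \<bullet> i))"
      unfolding c sum_distrib_left by (intro sum.cong) auto
    also have "\<dots> = (- v (t, x) * sin (\<xi> \<bullet> x + \<theta>)) * (B (t, x) \<bullet> \<xi>)"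
      by (subst (3) euclidean_inner) simp
    finally show "- (v (t, x) * (a (t, x) * (\<xi> \<bullet> \<xi>) * cos (\<xi> \<bullet> x + \<theta>) + B (t, x) \<bullet> \<xi> * sin (\<xi> \<bullet> x + \<theta>)))
      = - (\<xi> \<bullet> \<xi>) * (v (t, x) * a (t, x) * cos (\<xi> \<bullet> x + \<theta>))
      + (\<Sum>i\<in>Basis. (\<xi> \<bullet> i) * (v (t, x) * (B (t, x) \<bullet> i) * cos (\<xi> \<bullet> x + (\<theta> + pi / 2))))"
      by (simp add: algebra_simps)
  qed
  also have "\<dots> = - (\<xi> \<bullet> \<xi>) * (LBINT x. v (t, x) * a (t, x) * cos (\<xi> \<bullet> x + \<theta>))
     + (\<Sum>i\<in>Basis. (\<xi> \<bullet> i) * (LBINT x. v (t, x) * (B (t, x) \<bullet> i) * cos (\<xi> \<bullet> x + (\<theta> + pi / 2))))"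
    using i1 i2 by (subst Bochner_Integration.integral_add) (auto intro!: Bochner_Integration.integrable_sum simp: Bochner_Integration.integral_sum)
  finally show ?thesis by (simp add: fourier_def)
qed

abbreviation slice :: "(real \<times> 'a \<Rightarrow> real) \<Rightarrow> real \<Rightarrow> 'a \<Rightarrow> real" where
  "slice k t \<equiv> (\<lambda>x. v (t, x) * k (t, x))"

lemma fourier_slice_measurable [measurable]:
  assumes [measurable]: "k \<in> borel_measurable borel"
  shows "(\<lambda>z. fourier \<theta> (slice k (fst z)) (snd z)) \<in> borel_measurable borel"
  unfolding fourier_def by measurable

lemma power_spectrum_slice_measurable [measurable]:
  assumes [measurable]: "k \<in> borel_measurable borel"
  shows "(\<lambda>z. power_spectrum (slice k (fst z)) (snd z)) \<in> borel_measurable borel"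
  unfolding power_spectrum_def by measurable

lemma v_sq_integrable:
  assumes [measurable]: "k \<in> borel_measurable borel" and L: "\<And>z. \<bar>k z\<bar> \<le> L"
  shows "integrable lborel (\<lambda>z. (v z)\<^sup>2 * k z)"
proof -
  have "\<bar>v z * k z\<bar> \<le> C * L" for z
    unfolding abs_mult using v_bd[of z] L[of z] by (intro mult_mono) auto
  then have "integrable lborel (\<lambda>z. v z * (v z * k z))"
    by (intro integrable_v_mult) auto
  then show ?thesis by (simp add: power2_eq_square mult.assoc)
qed

lemma slice_bound: "(\<And>z. \<bar>k z\<bar> \<le> L) \<Longrightarrow> \<bar>slice k t x\<bar> \<le> C * L"
  unfolding abs_mult using v_bd[of "(t, x)"] by (intro mult_mono) (auto intro: order_trans[OF abs_ge_zero])

text \<open>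
  At almost every time the Plancherel identity evaluates the integral over the frequencies. The result
  is integrable in time because \<open>v\<close> is square integrable.\<close>
lemma power_spectrum_slice_integrable:
  assumes [measurable]: "k \<in> borel_measurable borel" and L: "\<And>z. \<bar>k z\<bar> \<le> L"
  shows "integrable lborel (\<lambda>z. power_spectrum (slice k (fst z)) (snd z))"
proof -
  have nn: "0 \<le> power_spectrum f \<xi>" for f :: "'a \<Rightarrow> real" and \<xi> by (simp add: power_spectrum_def)
  have ae: "AE t in lborel. has_bochner_integral lborel (power_spectrum (slice k t)) ((gauss_mass TYPE('a))\<^sup>2 * (LBINT x. (slice k t x)\<^sup>2))"
    using AE_slice_integrable
  proof eventually_elim
    case (elim t)
    show ?case
      by (rule power_spectrum_integral[OF slice_mult_integrable[OF elim _ L] slice_bound[OF L]]) measurable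
  qed
  have m: "(\<lambda>t. LBINT \<xi>. power_spectrum (slice k t) \<xi>) \<in> borel_measurable borel"
    unfolding power_spectrum_def fourier_def by measurable
  have m2: "(\<lambda>t. LBINT x. (slice k t x)\<^sup>2) \<in> borel_measurable borel" by measurable
  have sq: "integrable lborel (\<lambda>t. LBINT x. (slice k t x)\<^sup>2)"
  proof -
    have "\<bar>k z * k z\<bar> \<le> L * L" for z unfolding abs_mult using L[of z] by (intro mult_mono) auto
    then have "integrable lborel (\<lambda>z. (v z)\<^sup>2 * (k z * k z))"
      by (intro v_sq_integrable) auto
    then have "integrable lborel (\<lambda>t. LBINT x. (v (t, x))\<^sup>2 * (k (t, x) * k (t, x)))"
      using lborel_pair.integrable_fst'[of "\<lambda>z. (v z)\<^sup>2 * (k z * k z)"] by (simp add: lborel_prod)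
    then show ?thesis by (simp add: power2_eq_square mult.assoc mult.left_commute)
  qed
  have "integrable (lborel \<Otimes>\<^sub>M lborel) (\<lambda>z. power_spectrum (slice k (fst z)) (snd z))"
  proof (rule lborel_pair.Fubini_integrable)
    show "AE t in lborel. integrable lborel (\<lambda>\<xi>. power_spectrum (slice k (fst (t, \<xi>))) (snd (t, \<xi>)))"
      using ae by eventually_elim (simp add: has_bochner_integral_iff)
    have "integrable lborel (\<lambda>t. LBINT \<xi>. power_spectrum (slice k t) \<xi>)"
    proof (subst integrable_cong_AE)
      show "AE t in lborel. (LBINT \<xi>. power_spectrum (slice k t) \<xi>) = (gauss_mass TYPE('a))\<^sup>2 * (LBINT x. (slice k t x)\<^sup>2)"
        using ae by eventually_elim (simp add: has_bochner_integral_iff)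
    qed (use m m2 sq in auto)
    then show "integrable lborel (\<lambda>t. LBINT \<xi>. norm (power_spectrum (slice k (fst (t, \<xi>))) (snd (t, \<xi>))))"
      using nn by simp
  qed (simp add: lborel_prod)
  then show ?thesis by (simp add: lborel_prod)
qed

lemma decay_mult_integrable:
  assumes "integrable lborel f" "\<mu> \<ge> 0"
  shows "integrable lborel (\<lambda>z. decay \<mu> (fst z) * f z)"
proof -
  have "\<bar>decay \<mu> t\<bar> \<le> 1" for t using decay_bounds[OF assms(2), of t] by auto
  then have "integrable lborel (\<lambda>z. f z * decay \<mu> (fst z))"
    by (intro integrable_mult_bounded[OF assms(1)]) auto
  then show ?thesis by (simp add: mult.commute)
qed

text \<open>
  The function \<open>R\<close> of time and frequency is the right-hand side of \<open>spectral_energy_bound\<close>, summed over both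
  phases and weighted in time. For fixed frequency, its integral over time is nonnegative by the
  energy inequality. For fixed time, its integral over the frequencies is at most a negative multiple
  of \<open>\<integral> v\<^sup>2\<close> by the Plancherel identity. Fubini's theorem compares the two.\<close>
theorem solution_is_zero: "AE z in lborel. v z = 0"
proof -
  define c where "c = (gauss_mass TYPE('a))\<^sup>2"
  have c: "c > 0" by (simp add: c_def gauss_mass_def)
  \<comment> \<open>With this choice, \<open>\<kappa> (a\<^sup>2 + |B|\<^sup>2) \<le> \<alpha> \<le> a\<close>.\<close>
  define \<kappa> where "\<kappa> = \<alpha> / (2 * M\<^sup>2)"
  have \<kappa>: "\<kappa> > 0" using \<alpha> M by (simp add: \<kappa>_def)
  \<comment> \<open>The rate for which \<open>spectral_energy_bound\<close> applies.\<close>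
  define \<mu> where "\<mu> = 2 / \<kappa>"
  have \<mu>: "\<mu> \<ge> 0" using \<kappa> by (simp add: \<mu>_def)
  have C0: "0 \<le> C" using v_bd[of undefined] by linarith
  have a_bd: "\<bar>a z\<bar> \<le> M" for z using a_ge[of z] a_le[of z] \<alpha> by linarith
  have B_bd': "\<bar>B z \<bullet> i\<bar> \<le> M" if "i \<in> Basis" for z i
    using Basis_le_norm[OF that] B_bd order_trans by blast
  define V where "V = (\<lambda>\<theta> (z :: real \<times> 'a). fourier \<theta> (slice (\<lambda>_. 1) (fst z)) (snd z))"
  define A where "A = (\<lambda>\<theta> (z :: real \<times> 'a). fourier \<theta> (slice a (fst z)) (snd z))"
  define h where "h = (\<lambda>\<theta> i (z :: real \<times> 'a). fourier (\<theta> + pi / 2) (slice (\<lambda>z. B z \<bullet> i) (fst z)) (snd z))"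
  define PA where "PA = (\<lambda>z :: real \<times> 'a. power_spectrum (slice a (fst z)) (snd z))"
  define PB where "PB = (\<lambda>i (z :: real \<times> 'a). power_spectrum (slice (\<lambda>z. B z \<bullet> i) (fst z)) (snd z))"
  define R where "R = (\<lambda>z. decay \<mu> (fst z) * (- 2 * (V 0 z * A 0 z + V (pi / 2) z * A (pi / 2) z)
      + \<kappa> * PA z + \<kappa> * (\<Sum>i\<in>Basis. PB i z)))"
  have [measurable]: "V \<theta> \<in> borel_measurable borel" "A \<theta> \<in> borel_measurable borel" for \<theta>
    unfolding V_def A_def by measurable
  have PV: "integrable lborel (\<lambda>z. power_spectrum (slice (\<lambda>_. 1) (fst z)) (snd z))"
    by (rule power_spectrum_slice_integrable[of _ 1]) auto
  have PAi: "integrable lborel PA"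
    unfolding PA_def by (rule power_spectrum_slice_integrable[OF _ a_bd]) measurable
  have PBi: "integrable lborel (PB i)" if "i \<in> Basis" for i
    unfolding PB_def by (rule power_spectrum_slice_integrable[OF _ B_bd'[OF that]]) measurable
  have VAi: "integrable lborel (\<lambda>z. V 0 z * A 0 z + V (pi / 2) z * A (pi / 2) z)"
  proof (rule Bochner_Integration.integrable_bound)
    show "integrable lborel (\<lambda>z. power_spectrum (slice (\<lambda>_. 1) (fst z)) (snd z) + PA z)" using PV PAi by auto
    have xy: "\<bar>x * y\<bar> \<le> x\<^sup>2 + y\<^sup>2" for x y :: real
    proof -
      have "2 * (\<bar>x\<bar> * \<bar>y\<bar>) \<le> x\<^sup>2 + y\<^sup>2" using sum_squares_bound[of "\<bar>x\<bar>" "\<bar>y\<bar>"] by simp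
      moreover have "0 \<le> \<bar>x\<bar> * \<bar>y\<bar>" by simp
      ultimately show ?thesis unfolding abs_mult by linarith
    qed
    show "AE z in lborel. norm (V 0 z * A 0 z + V (pi / 2) z * A (pi / 2) z) \<le> norm (power_spectrum (slice (\<lambda>_. 1) (fst z)) (snd z) + PA z)"
    proof (rule AE_I2)
      fix z
      have "power_spectrum (slice (\<lambda>_. 1) (fst z)) (snd z) + PA z = ((V 0 z)\<^sup>2 + (A 0 z)\<^sup>2) + ((V (pi / 2) z)\<^sup>2 + (A (pi / 2) z)\<^sup>2)"
        by (simp add: power_spectrum_def V_def A_def PA_def)
      then show "norm (V 0 z * A 0 z + V (pi / 2) z * A (pi / 2) z) \<le> norm (power_spectrum (slice (\<lambda>_. 1) (fst z)) (snd z) + PA z)"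
        using xy[of "V 0 z" "A 0 z"] xy[of "V (pi / 2) z" "A (pi / 2) z"] by simp
    qed
  qed measurable
  have Ri: "integrable lborel R"
    unfolding R_def
    by (intro decay_mult_integrable[OF _ \<mu>] Bochner_Integration.integrable_add integrable_mult_right
        Bochner_Integration.integrable_sum VAi PAi PBi)
  have Ri': "integrable (lborel \<Otimes>\<^sub>M lborel) (case_prod (\<lambda>t \<xi>. R (t, \<xi>)))"
    using Ri by (simp add: lborel_prod)
  have "0 \<le> (LBINT \<xi>. (LBINT t. R (t, \<xi>)))"
  proof (rule integral_nonneg_AE)
    show "AE \<xi> in lborel. 0 \<le> (LBINT t. R (t, \<xi>))"
      using lborel_pair.AE_integrable_snd[OF Ri']
    proof eventually_elim
      case (elim \<xi>)
      define I where "I = (\<lambda>\<theta> t. decay \<mu> t * (2 * (fourier \<theta> (\<lambda>x. v (t, x)) \<xi> * flux \<theta> \<xi> t) - \<mu> * (fourier \<theta> (\<lambda>x. v (t, x)) \<xi>)\<^sup>2))"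
      define \<omega> where "\<omega> = 1 / (1 + \<xi> \<bullet> \<xi>)"
      have "0 < 1 + \<xi> \<bullet> \<xi>" by (simp add: add_pos_nonneg)
      then have \<omega>: "\<omega> \<ge> 0" by (simp add: \<omega>_def)
      have I: "integrable lborel (I \<theta>)" "0 \<le> (LBINT t. I \<theta> t)" for \<theta>
        unfolding I_def using frequency_energy[OF \<mu>] by auto
      have "0 \<le> \<omega> * ((LBINT t. I 0 t) + (LBINT t. I (pi / 2) t))"
        using \<omega> I(2) by (intro mult_nonneg_nonneg add_nonneg_nonneg)
      also have "\<dots> = (LBINT t. \<omega> * (I 0 t + I (pi / 2) t))" using I(1) by simp
      also have "\<dots> \<le> (LBINT t. R (t, \<xi>))"
      proof (rule integral_mono_AE)
        show "AE t in lborel. \<omega> * (I 0 t + I (pi / 2) t) \<le> R (t, \<xi>)"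
          using AE_slice_integrable
        proof eventually_elim
          case (elim t)
          have X: "\<xi> \<bullet> \<xi> = (\<Sum>i\<in>Basis. (\<xi> \<bullet> i)\<^sup>2)"
            by (subst euclidean_inner) (simp add: power2_eq_square)
          have key: "\<omega> * I \<theta> t \<le> decay \<mu> t * (- 2 * (V \<theta> (t, \<xi>) * A \<theta> (t, \<xi>)) + \<kappa> * (A \<theta> (t, \<xi>))\<^sup>2
              + \<kappa> * (\<Sum>i\<in>Basis. (h \<theta> i (t, \<xi>))\<^sup>2))" for \<theta>
          proof -
            have "\<omega> * I \<theta> t = decay \<mu> t * ((2 * (V \<theta> (t, \<xi>) * (- (\<xi> \<bullet> \<xi>) * A \<theta> (t, \<xi>) + (\<Sum>i\<in>Basis. (\<xi> \<bullet> i) * h \<theta> i (t, \<xi>))))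
                - (2 / \<kappa>) * (V \<theta> (t, \<xi>))\<^sup>2) / (1 + \<xi> \<bullet> \<xi>))"
              unfolding I_def flux_spectral[OF elim] by (simp add: \<omega>_def V_def A_def h_def \<mu>_def)
            also have "\<dots> \<le> decay \<mu> t * (- 2 * (V \<theta> (t, \<xi>) * A \<theta> (t, \<xi>)) + \<kappa> * (A \<theta> (t, \<xi>))\<^sup>2
              + \<kappa> * (\<Sum>i\<in>Basis. (h \<theta> i (t, \<xi>))\<^sup>2))"
              using decay_bounds[OF \<mu>, of t] by (intro mult_left_mono spectral_energy_bound[OF \<kappa> finite_Basis X]) auto
            finally show ?thesis .
          qed
          \<comment> \<open>Shifting both phases by \<open>\<pi>/2\<close> changes the phase \<open>0\<close> into \<open>\<pi>/2\<close> and the phase \<open>\<pi>/2\<close> into \<open>\<pi>\<close>, which is \<open>0\<close> up to the sign.\<close>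
          have hh: "(h 0 i (t, \<xi>))\<^sup>2 + (h (pi / 2) i (t, \<xi>))\<^sup>2 = PB i (t, \<xi>)" for i
            using fourier_pi[of 0 "slice (\<lambda>z. B z \<bullet> i) t" \<xi>] by (simp add: h_def PB_def power_spectrum_def)
          have "R (t, \<xi>) = decay \<mu> t * (- 2 * (V 0 (t, \<xi>) * A 0 (t, \<xi>)) + \<kappa> * (A 0 (t, \<xi>))\<^sup>2 + \<kappa> * (\<Sum>i\<in>Basis. (h 0 i (t, \<xi>))\<^sup>2))
            + decay \<mu> t * (- 2 * (V (pi / 2) (t, \<xi>) * A (pi / 2) (t, \<xi>)) + \<kappa> * (A (pi / 2) (t, \<xi>))\<^sup>2 + \<kappa> * (\<Sum>i\<in>Basis. (h (pi / 2) i (t, \<xi>))\<^sup>2))"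
          proof -
            have alg: "d * (- 2 * (p + q) + k * (x + y) + k * (s + r)) = d * (- 2 * p + k * x + k * s) + d * (- 2 * q + k * y + k * r)"
              for d p q k x y s r :: real by (simp add: algebra_simps)
            have "PA (t, \<xi>) = (A 0 (t, \<xi>))\<^sup>2 + (A (pi / 2) (t, \<xi>))\<^sup>2"
              by (simp add: PA_def A_def power_spectrum_def)
            then show ?thesis
              unfolding R_def hh[symmetric] sum.distrib fst_conv by (simp only: alg)
          qed
          then show ?case using key[of 0] key[of "pi / 2"] by (simp add: distrib_left)
        qed
        show "integrable lborel (\<lambda>t. \<omega> * (I 0 t + I (pi / 2) t))" using I(1) by simp
      qed (use elim in simp)
      finally show ?case .
    qed
  qed
  also have "\<dots> = (LBINT t. (LBINT \<xi>. R (t, \<xi>)))"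
    by (rule lborel_pair.Fubini_integral[OF Ri'])
  also have "\<dots> \<le> (LBINT t. (LBINT x. - (c * \<alpha>) * (decay \<mu> t * (v (t, x))\<^sup>2)))"
  proof (rule integral_mono_AE)
    have v2: "integrable lborel (\<lambda>z. (v z)\<^sup>2)" using v_sq_integrable[of "\<lambda>_. 1" 1] by simp
    have "integrable lborel (\<lambda>z. - (c * \<alpha>) * (decay \<mu> (fst z) * (v z)\<^sup>2))"
      by (intro integrable_mult_right decay_mult_integrable v2 \<mu>)
    then show "integrable lborel (\<lambda>t. LBINT x. - (c * \<alpha>) * (decay \<mu> t * (v (t, x))\<^sup>2))"
      using lborel_pair.integrable_fst'[of "\<lambda>z. - (c * \<alpha>) * (decay \<mu> (fst z) * (v z)\<^sup>2)"] by (simp add: lborel_prod)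
    show "integrable lborel (\<lambda>t. LBINT \<xi>. R (t, \<xi>))"
      by (rule lborel_pair.integrable_fst[OF Ri'])
    show "AE t in lborel. (LBINT \<xi>. R (t, \<xi>)) \<le> (LBINT x. - (c * \<alpha>) * (decay \<mu> t * (v (t, x))\<^sup>2))"
      using AE_slice_integrable
    proof eventually_elim
      case (elim t)
      have s1: "integrable lborel (slice (\<lambda>_. 1) t)" using elim by simp
      have sA: "integrable lborel (slice a t)" by (rule slice_mult_integrable[OF elim _ a_bd]) measurable
      have sB: "integrable lborel (slice (\<lambda>z. B z \<bullet> i) t)" if "i \<in> Basis" for i
        by (rule slice_mult_integrable[OF elim _ B_bd'[OF that]]) measurable
      have b1: "\<bar>slice (\<lambda>_. 1) t x\<bar> \<le> C * M" for x
        using slice_bound[of "\<lambda>_. 1" M t x] M by simp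
      have bA: "\<bar>slice a t x\<bar> \<le> C * M" for x by (rule slice_bound[OF a_bd])
      have bB: "\<bar>slice (\<lambda>z. B z \<bullet> i) t x\<bar> \<le> C * M" if "i \<in> Basis" for i x by (rule slice_bound[OF B_bd'[OF that]])
      have PAt: "has_bochner_integral lborel (\<lambda>\<xi>. PA (t, \<xi>)) (c * (LBINT x. (slice a t x)\<^sup>2))"
        using power_spectrum_integral[OF sA bA] by (simp add: PA_def c_def)
      have PBt: "has_bochner_integral lborel (\<lambda>\<xi>. PB i (t, \<xi>)) (c * (LBINT x. (slice (\<lambda>z. B z \<bullet> i) t x)\<^sup>2))" if "i \<in> Basis" for i
        using power_spectrum_integral[OF sB[OF that] bB[OF that]] by (simp add: PB_def c_def)
      have VAt: "has_bochner_integral lborel (\<lambda>\<xi>. V 0 (t, \<xi>) * A 0 (t, \<xi>) + V (pi / 2) (t, \<xi>) * A (pi / 2) (t, \<xi>))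
          (c * (LBINT x. slice (\<lambda>_. 1) t x * slice a t x))"
        unfolding V_def A_def c_def fst_conv snd_conv by (rule Plancherel[OF s1 b1 sA bA])
      have sq: "integrable lborel (\<lambda>x. slice k t x * slice k' t x)"
        if "integrable lborel (slice k t)" "\<And>x. \<bar>slice k' t x\<bar> \<le> C * M" "k' \<in> borel_measurable borel" for k k'
        by (rule integrable_mult_bounded[OF that(1) _ that(2)]) (use that(3) in auto)
      note i1 = sq[OF s1 bA a_meas] and i2 = sq[OF sA bA a_meas]
      have i3: "integrable lborel (\<lambda>x. slice (\<lambda>z. B z \<bullet> i) t x * slice (\<lambda>z. B z \<bullet> i) t x)" if "i \<in> Basis" for i
        by (rule sq[OF sB[OF that] bB[OF that]]) measurable
      have i4: "integrable lborel (\<lambda>x. (v (t, x))\<^sup>2)"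
        using sq[OF s1 b1] by (simp add: power2_eq_square)
      have hb: "has_bochner_integral lborel (\<lambda>x. f x) (LBINT x. f x)" if "integrable lborel f" for f :: "'a \<Rightarrow> real"
        using that by (simp add: has_bochner_integral_iff)
      define Q where "Q = (\<lambda>x. - 2 * (slice (\<lambda>_. 1) t x * slice a t x) + \<kappa> * (slice a t x * slice a t x)
          + \<kappa> * (\<Sum>i\<in>Basis. slice (\<lambda>z. B z \<bullet> i) t x * slice (\<lambda>z. B z \<bullet> i) t x))"
      have Qi: "has_bochner_integral lborel Q (- 2 * (LBINT x. slice (\<lambda>_. 1) t x * slice a t x)
          + \<kappa> * (LBINT x. slice a t x * slice a t x) + \<kappa> * (\<Sum>i\<in>Basis. (LBINT x. slice (\<lambda>z. B z \<bullet> i) t x * slice (\<lambda>z. B z \<bullet> i) t x)))"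
        unfolding Q_def by (rule has_bochner_integral_combination; (rule hb)?) (rule i1, rule i2, rule i3)
      have "(LBINT \<xi>. R (t, \<xi>)) = decay \<mu> t * (LBINT \<xi>. - 2 * (V 0 (t, \<xi>) * A 0 (t, \<xi>) + V (pi / 2) (t, \<xi>) * A (pi / 2) (t, \<xi>))
          + \<kappa> * PA (t, \<xi>) + \<kappa> * (\<Sum>i\<in>Basis. PB i (t, \<xi>)))"
        unfolding R_def fst_conv by (rule integral_mult_right_zero)
      also have "(LBINT \<xi>. - 2 * (V 0 (t, \<xi>) * A 0 (t, \<xi>) + V (pi / 2) (t, \<xi>) * A (pi / 2) (t, \<xi>))
          + \<kappa> * PA (t, \<xi>) + \<kappa> * (\<Sum>i\<in>Basis. PB i (t, \<xi>)))
        = - 2 * (c * (LBINT x. slice (\<lambda>_. 1) t x * slice a t x))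
          + \<kappa> * (c * (LBINT x. (slice a t x)\<^sup>2)) + \<kappa> * (\<Sum>i\<in>Basis. c * (LBINT x. (slice (\<lambda>z. B z \<bullet> i) t x)\<^sup>2))"
        by (rule has_bochner_integral_integral_eq[OF has_bochner_integral_combination[where I=Basis, OF VAt PAt PBt]])
      also have "\<dots> = c * (- 2 * (LBINT x. slice (\<lambda>_. 1) t x * slice a t x)
          + \<kappa> * (LBINT x. slice a t x * slice a t x) + \<kappa> * (\<Sum>i\<in>Basis. (LBINT x. slice (\<lambda>z. B z \<bullet> i) t x * slice (\<lambda>z. B z \<bullet> i) t x)))"
        unfolding sum_distrib_left[symmetric] power2_eq_square by (simp only: distrib_left mult.left_commute)
      also have "\<dots> = c * (LBINT x. Q x)"
        by (simp only: has_bochner_integral_integral_eq[OF Qi])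
      finally have RQ: "(LBINT \<xi>. R (t, \<xi>)) = c * decay \<mu> t * (LBINT x. Q x)" by simp
      also have "(LBINT x. Q x) \<le> (LBINT x. - \<alpha> * (v (t, x))\<^sup>2)"
      proof (rule integral_mono)
        fix x
        let ?v = "v (t, x)" and ?a = "a (t, x)" and ?B = "B (t, x)"
        have "(\<Sum>i\<in>Basis. slice (\<lambda>z. B z \<bullet> i) t x * slice (\<lambda>z. B z \<bullet> i) t x) = ?v\<^sup>2 * (?B \<bullet> ?B)"
          by (subst euclidean_inner) (simp add: sum_distrib_left power2_eq_square ac_simps)
        then have "Q x = - 2 * (slice (\<lambda>_. 1) t x * slice a t x) + \<kappa> * (slice a t x * slice a t x) + \<kappa> * (?v\<^sup>2 * (?B \<bullet> ?B))"
          by (simp only: Q_def)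
        also have "\<dots> = ?v\<^sup>2 * (- 2 * ?a + \<kappa> * (?a\<^sup>2 + ?B \<bullet> ?B))"
          by (simp add: power2_eq_square algebra_simps)
        also have "\<dots> \<le> ?v\<^sup>2 * (- \<alpha>)"
        proof (rule mult_left_mono)
          have "?a\<^sup>2 \<le> M\<^sup>2" using a_bd[of "(t, x)"] by (metis abs_ge_zero power2_abs power_mono)
          moreover have "?B \<bullet> ?B \<le> M\<^sup>2"
            using B_bd[of "(t, x)"] by (simp add: dot_square_norm power_mono)
          ultimately have "\<kappa> * (?a\<^sup>2 + ?B \<bullet> ?B) \<le> \<kappa> * (M\<^sup>2 + M\<^sup>2)" using \<kappa> by (intro mult_left_mono) auto
          also have "\<dots> = \<alpha>" using M by (simp add: \<kappa>_def field_simps)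
          finally show "- 2 * ?a + \<kappa> * (?a\<^sup>2 + ?B \<bullet> ?B) \<le> - \<alpha>" using a_ge[of "(t, x)"] by linarith
        qed simp
        finally show "Q x \<le> - \<alpha> * ?v\<^sup>2" by (simp add: mult.commute)
      next
        show "integrable lborel Q" using Qi by (simp add: has_bochner_integral_iff)
        show "integrable lborel (\<lambda>x. - \<alpha> * (v (t, x))\<^sup>2)" by (intro integrable_mult_right i4)
      qed
      finally have "(LBINT \<xi>. R (t, \<xi>)) \<le> c * decay \<mu> t * (LBINT x. - \<alpha> * (v (t, x))\<^sup>2)"
        using c decay_bounds[OF \<mu>, of t] by (simp add: mult_left_mono)
      also have "\<dots> = (LBINT x. - (c * \<alpha>) * (decay \<mu> t * (v (t, x))\<^sup>2))" by simp
      finally show ?case .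
    qed
  qed
  also have "\<dots> = (LBINT z. - (c * \<alpha>) * (decay \<mu> (fst z) * (v z)\<^sup>2))"
  proof -
    have v2: "integrable lborel (\<lambda>z. (v z)\<^sup>2)" using v_sq_integrable[of "\<lambda>_. 1" 1] by simp
    have "integrable lborel (\<lambda>z. - (c * \<alpha>) * (decay \<mu> (fst z) * (v z)\<^sup>2))"
      by (intro integrable_mult_right decay_mult_integrable v2 \<mu>)
    then show ?thesis
      using lborel_pair.integral_fst'[of "\<lambda>z. - (c * \<alpha>) * (decay \<mu> (fst z) * (v z)\<^sup>2)"] by (simp add: lborel_prod)
  qed
  finally have le: "(LBINT z. decay \<mu> (fst z) * (v z)\<^sup>2) \<le> 0"
    using c \<alpha> by (simp add: mult_le_0_iff zero_le_mult_iff)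
  have nn: "0 \<le> decay \<mu> (fst z) * (v z)\<^sup>2" for z using decay_bounds[OF \<mu>] by simp
  have "integrable lborel (\<lambda>z. decay \<mu> (fst z) * (v z)\<^sup>2)"
    using v_sq_integrable[of "\<lambda>_. 1" 1] \<mu> by (intro decay_mult_integrable) auto
  then have "AE z in lborel. decay \<mu> (fst z) * (v z)\<^sup>2 = 0"
    using le nn integral_nonneg_eq_0_iff_AE[of lborel "\<lambda>z. decay \<mu> (fst z) * (v z)\<^sup>2"]
      Bochner_Integration.integral_nonneg[of lborel "\<lambda>z. decay \<mu> (fst z) * (v z)\<^sup>2"]
    by (metis (no_types, lifting) AE_I2 antisym)
  then show ?thesis
  proof eventually_elim
    case (elim z)
    then show ?case using v_zero[of z] by (cases "fst z \<in> {0<..<T}") (auto simp: decay_def)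
  qed
qed

end

section \<open>Coefficients of the linear equation\<close>

text \<open>
  Measurability of slices and Fubini's theorem are available for Borel functions. The coefficients and
  solutions are Lebesgue measurable only and are replaced by Borel functions.\<close>
lemma lebesgue_borel_representative:
  fixes f :: "'a::euclidean_space \<Rightarrow> 'b::euclidean_space"
  assumes Q: "Q \<in> sets borel" and f: "f \<in> borel_measurable (lebesgue_on Q)"
  obtains f' where "f' \<in> borel_measurable borel" "AE x in lborel. x \<in> Q \<longrightarrow> f x = f' x"
proof -
  have f0: "(\<lambda>x. indicator Q x *\<^sub>R f x) \<in> borel_measurable lebesgue"
    using f Q by (subst (asm) borel_measurable_restrict_space_iff) auto
  have "\<exists>g\<in>borel_measurable lborel. AE x in lborel. (indicator Q x *\<^sub>R f x) \<bullet> i = g x" if "i \<in> Basis" for i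
    by (rule completion_ex_borel_measurable_real) (use f0 in measurable)
  then obtain g where g: "\<And>i. i \<in> Basis \<Longrightarrow> g i \<in> borel_measurable lborel"
    "\<And>i. i \<in> Basis \<Longrightarrow> AE x in lborel. (indicator Q x *\<^sub>R f x) \<bullet> i = g i x" by metis
  have "AE x in lborel. \<forall>i\<in>Basis. (indicator Q x *\<^sub>R f x) \<bullet> i = g i x"
    using g(2) by (intro AE_finite_allI) auto
  then have "AE x in lborel. x \<in> Q \<longrightarrow> f x = (\<Sum>i\<in>Basis. g i x *\<^sub>R i)"
  proof eventually_elim
    case (elim x)
    show ?case
    proof
      assume "x \<in> Q"
      then have "(\<Sum>i\<in>Basis. g i x *\<^sub>R i) = (\<Sum>i\<in>Basis. (f x \<bullet> i) *\<^sub>R i)"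
        using elim by (intro sum.cong) auto
      then show "f x = (\<Sum>i\<in>Basis. g i x *\<^sub>R i)" by (simp add: euclidean_representation)
    qed
  qed
  moreover have "(\<lambda>x. \<Sum>i\<in>Basis. g i x *\<^sub>R i) \<in> borel_measurable borel"
    using g(1) by (intro borel_measurable_sum borel_measurable_scaleR) auto
  ultimately show ?thesis using that by blast
qed

lemma AE_lebesgue_on_iff:
  "Q \<in> sets borel \<Longrightarrow> (AE x in lebesgue_on Q. P x) \<longleftrightarrow> (AE x in lborel. x \<in> Q \<longrightarrow> P x)"
  by (subst AE_restrict_space_iff) (auto simp: AE_completion_iff)

lemma measurable_lebesgue_on_if_AE_eq:
  fixes f f' :: "'a::euclidean_space \<Rightarrow> 'b::euclidean_space"
  assumes Q: "Q \<in> sets borel" and f': "f' \<in> borel_measurable borel" and eq: "AE x in lborel. x \<in> Q \<longrightarrow> f x = f' x"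
  shows "f \<in> borel_measurable (lebesgue_on Q)"
proof -
  have [measurable]: "Q \<in> sets borel" "f' \<in> borel_measurable borel" by fact+
  have "(\<lambda>x. indicator Q x *\<^sub>R f x) \<in> borel_measurable lebesgue"
  proof (rule borel_measurable_AE)
    show "(\<lambda>x. indicator Q x *\<^sub>R f' x) \<in> borel_measurable lebesgue"
      by (intro measurable_completion) measurable
    show "AE x in lebesgue. indicator Q x *\<^sub>R f' x = indicator Q x *\<^sub>R f x"
      using AE_completion[OF eq] by eventually_elim (auto simp: indicator_def)
  qed
  then show ?thesis using Q by (subst borel_measurable_restrict_space_iff) auto
qed

lemma integral_lebesgue_on_eq_lborel:
  fixes f f' :: "'a::euclidean_space \<Rightarrow> 'b::euclidean_space"
  assumes Q: "Q \<in> sets borel" and f': "f' \<in> borel_measurable borel" and eq: "AE x in lborel. x \<in> Q \<longrightarrow> f x = f' x"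
    and zero: "\<And>x. x \<notin> Q \<Longrightarrow> f' x = 0"
  shows "integral\<^sup>L (lebesgue_on Q) f = integral\<^sup>L lborel f'"
    and "integrable (lebesgue_on Q) f \<longleftrightarrow> integrable lborel f'"
proof -
  have m: "(\<lambda>x. indicator Q x *\<^sub>R f x) \<in> borel_measurable lebesgue"
    using measurable_lebesgue_on_if_AE_eq[OF Q f' eq] Q by (subst (asm) borel_measurable_restrict_space_iff) auto
  have ae: "AE x in lebesgue. indicator Q x *\<^sub>R f x = f' x"
    using AE_completion[OF eq]
  proof eventually_elim
    case (elim x)
    then show ?case using zero[of x] by (cases "x \<in> Q") auto
  qed
  have "integral\<^sup>L (lebesgue_on Q) f = integral\<^sup>L lebesgue (\<lambda>x. indicator Q x *\<^sub>R f x)"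
    using Q by (intro integral_restrict_space) auto
  also have "\<dots> = integral\<^sup>L lebesgue f'"
    using f' by (intro integral_cong_AE[OF m _ ae] measurable_completion) simp
  also have "\<dots> = integral\<^sup>L lborel f'" using f' by (intro integral_completion) auto
  finally show "integral\<^sup>L (lebesgue_on Q) f = integral\<^sup>L lborel f'" .
  have "integrable (lebesgue_on Q) f \<longleftrightarrow> integrable lebesgue (\<lambda>x. indicator Q x *\<^sub>R f x)"
    using Q by (intro integrable_restrict_space) auto
  also have "\<dots> \<longleftrightarrow> integrable lebesgue f'"
    using f' by (intro integrable_cong_AE[OF m _ ae] measurable_completion) simp
  also have "\<dots> \<longleftrightarrow> integrable lborel f'" using f' by (intro integrable_completion) auto
  finally show "integrable (lebesgue_on Q) f \<longleftrightarrow> integrable lborel f'" .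
qed

lemma AE_lborel_prod_fst:
  fixes P :: "'a::euclidean_space \<Rightarrow> bool"
  assumes "AE x in lborel. P x"
  shows "AE z in (lborel :: ('a \<times> 'b::euclidean_space) measure). P (fst z)"
proof -
  obtain N where N: "N \<in> null_sets lborel" "{x. \<not> P x} \<subseteq> N"
    using assms by (auto simp: eventually_ae_filter)
  have "emeasure (lborel \<Otimes>\<^sub>M lborel) (N \<times> (UNIV :: 'b set)) = 0"
    using N by (subst lborel.emeasure_pair_measure_Times) auto
  then have "N \<times> (UNIV :: 'b set) \<in> null_sets (lborel \<Otimes>\<^sub>M lborel)"
    using N by (intro null_setsI) auto
  then have "N \<times> (UNIV :: 'b set) \<in> null_sets lborel" by (simp add: lborel_prod)
  then show ?thesis using N(2) by (intro AE_I'[of "N \<times> UNIV"]) auto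
qed

lemma AE_lborel_prod_snd:
  fixes P :: "'b::euclidean_space \<Rightarrow> bool"
  assumes "AE x in lborel. P x"
  shows "AE z in (lborel :: ('a::euclidean_space \<times> 'b) measure). P (snd z)"
proof -
  obtain N where N: "N \<in> null_sets lborel" "{x. \<not> P x} \<subseteq> N"
    using assms by (auto simp: eventually_ae_filter)
  have "emeasure (lborel \<Otimes>\<^sub>M lborel) ((UNIV :: 'a set) \<times> N) = 0"
    using N by (subst lborel.emeasure_pair_measure_Times) auto
  then have "(UNIV :: 'a set) \<times> N \<in> null_sets (lborel \<Otimes>\<^sub>M lborel)"
    using N by (intro null_setsI) auto
  then have "(UNIV :: 'a set) \<times> N \<in> null_sets lborel" by (simp add: lborel_prod)
  then show ?thesis using N(2) by (intro AE_I'[of "UNIV \<times> N"]) auto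
qed

lemma lborel_distr_reflect: "distr lborel borel (\<lambda>y::'a::euclidean_space. x - y) = lborel"
  using lborel_affine[of "-1" x] by (simp add: density_1)

lemma
  fixes g :: "'a::euclidean_space \<Rightarrow> real"
  assumes g: "integrable lborel g"
  shows integrable_reflect: "integrable lborel (\<lambda>y. g (x - y))"
    and integral_reflect: "(LBINT y. g (x - y)) = (LBINT y. g y)"
proof -
  have [measurable]: "g \<in> borel_measurable borel" using g by auto
  have "integrable (distr lborel borel (\<lambda>y. x - y)) g" using g by (simp add: lborel_distr_reflect)
  then show "integrable lborel (\<lambda>y. g (x - y))"
    by (subst (asm) integrable_distr_eq) auto
  have "(LBINT y. g y) = (\<integral>y. g y \<partial>distr lborel borel (\<lambda>y. x - y))" by (simp add: lborel_distr_reflect)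
  also have "\<dots> = (LBINT y. g (x - y))" by (rule integral_distr) auto
  finally show "(LBINT y. g (x - y)) = (LBINT y. g y)" by simp
qed

lemma AE_reflect:
  fixes P :: "'a::euclidean_space \<Rightarrow> bool"
  assumes "AE y in lborel. P y"
  shows "AE y in lborel. P (x - y)"
proof -
  obtain N where N: "N \<in> null_sets lborel" "{x. \<not> P x} \<subseteq> N"
    using assms by (auto simp: eventually_ae_filter)
  have "AE y in distr lborel borel (\<lambda>y. x - y). y \<notin> N"
    using N by (simp add: lborel_distr_reflect AE_not_in)
  then have "AE y in lborel. x - y \<notin> N"
    using N by (subst (asm) AE_distr_iff) auto
  then show ?thesis using N(2) by (auto elim!: eventually_mono)
qed

text \<open>
  Since \<open>\<beta>(0) = 0\<close>, the mean value theorem expresses the quotient as a value of \<open>\<beta>'\<close> between \<open>0\<close> and \<open>r\<close>.\<close>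
lemma beta_quot_bounds:
  assumes \<beta>: "\<beta> C1_differentiable_on UNIV" "\<beta> 0 = 0" and \<alpha>: "\<And>r. deriv \<beta> r \<ge> \<alpha>"
  shows "beta_quot \<beta> \<in> borel_measurable borel"
    and "\<alpha> \<le> beta_quot \<beta> r"
    and "\<exists>L. \<forall>r. \<bar>r\<bar> \<le> c \<longrightarrow> beta_quot \<beta> r \<le> L"
proof -
  obtain D where D: "\<And>x. (\<beta> has_vector_derivative D x) (at x)" "continuous_on UNIV D"
    using \<beta>(1) by (auto simp: C1_differentiable_on_def)
  have d: "(\<beta> has_real_derivative D x) (at x)" for x
    using D(1) by (simp add: has_real_derivative_iff_has_vector_derivative)
  then have deriv: "deriv \<beta> = D" by (auto intro: DERIV_imp_deriv)
  have "continuous_on UNIV \<beta>"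
    using d by (meson DERIV_continuous continuous_at_imp_continuous_on)
  then have [measurable]: "\<beta> \<in> borel_measurable borel" by (rule borel_measurable_continuous_onI)
  show "beta_quot \<beta> \<in> borel_measurable borel"
    unfolding beta_quot_def[abs_def] by measurable
  have mvt: "\<exists>s. \<bar>s\<bar> \<le> \<bar>r\<bar> \<and> beta_quot \<beta> r = D s" for r
  proof -
    consider "r = 0" | "r > 0" | "r < 0" by linarith
    then show ?thesis
    proof cases
      case 1 then show ?thesis by (auto simp: beta_quot_def deriv)
    next
      case 2
      obtain s where "0 < s" "s < r" "\<beta> r - \<beta> 0 = (r - 0) * D s"
        using MVT2[OF 2, of \<beta> D] d by blast
      then show ?thesis using 2 \<beta>(2) by (intro exI[of _ s]) (auto simp: beta_quot_def)
    next
      case 3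
      obtain s where "r < s" "s < 0" "\<beta> 0 - \<beta> r = (0 - r) * D s"
        using MVT2[OF 3, of \<beta> D] d by blast
      then show ?thesis using 3 \<beta>(2) by (intro exI[of _ s]) (auto simp: beta_quot_def field_simps)
    qed
  qed
  show "\<alpha> \<le> beta_quot \<beta> r" using mvt[of r] \<alpha> by (auto simp: deriv)
  have "bounded (D ` {-c..c})"
    using D(2) by (intro compact_imp_bounded compact_continuous_image) (auto intro: continuous_on_subset)
  then obtain L where L: "\<forall>y\<in>D ` {-c..c}. norm y \<le> L" unfolding bounded_iff by blast
  show "\<exists>L. \<forall>r. \<bar>r\<bar> \<le> c \<longrightarrow> beta_quot \<beta> r \<le> L"
  proof (intro exI[of _ L] allI impI)
    fix r assume "\<bar>r\<bar> \<le> c"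
    obtain s where s: "\<bar>s\<bar> \<le> \<bar>r\<bar>" "beta_quot \<beta> r = D s" using mvt by blast
    then have "s \<in> {-c..c}" using \<open>\<bar>r\<bar> \<le> c\<close> by auto
    then have "norm (D s) \<le> L" using L by blast
    then show "beta_quot \<beta> r \<le> L" using s by simp
  qed
qed

text \<open>
  At almost every time, \<open>u(t)\<close> agrees almost everywhere with a slice of a Borel function, and then the
  two convolutions agree at every point. The kernel is split at the unit sphere. The inner part is
  integrable and meets the bound of \<open>u(t)\<close>; the outer part is bounded and meets the mass \<open>1\<close> of \<open>u(t)\<close>.\<close>
lemma conv_representative:
  fixes K :: "'a::euclidean_space \<Rightarrow> 'a" and u :: "real \<Rightarrow> 'a \<Rightarrow> real"
  assumes K: "continuous_on (- {0}) K" "K \<in> Lp 1 (lebesgue_on (cball 0 1))" "K \<in> Linf (lebesgue_on (- cball 0 1))"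
    and u: "(\<lambda>(t, x). u t x) \<in> Linf (lebesgue_on ({0<..<T} \<times> UNIV))"
    and ut: "\<And>t. t \<in> {0<..<T} \<Longrightarrow> u t \<in> prob_densities"
  obtains w L where "w \<in> borel_measurable borel"
    "AE z in lborel. z \<in> {0<..<T} \<times> UNIV \<longrightarrow> conv K (u (fst z)) (snd z) = w z"
    "AE z in lborel. z \<in> {0<..<T} \<times> UNIV \<longrightarrow> norm (w z) \<le> L"
proof -
  let ?Q = "{0<..<T} \<times> (UNIV :: 'a set)"
  have Q: "?Q \<in> sets borel" by (intro borel_open open_Times) auto
  obtain Cu where u': "(\<lambda>(t, x). u t x) \<in> borel_measurable (lebesgue_on ?Q)"
    and Cu: "AE z in lborel. z \<in> ?Q \<longrightarrow> \<bar>u (fst z) (snd z)\<bar> \<le> Cu"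
    using u Q by (auto simp: Linf_def AE_lebesgue_on_iff case_prod_unfold)
  obtain U where [measurable]: "U \<in> borel_measurable borel"
    and U: "AE z in lborel. z \<in> ?Q \<longrightarrow> (case z of (t, x) \<Rightarrow> u t x) = U z"
    by (rule lebesgue_borel_representative[OF Q u'])
  define K' where "K' = (\<lambda>x. if x = 0 then 0 else K x)"
  have K'_m [measurable]: "K' \<in> borel_measurable borel"
  proof -
    have "(\<lambda>x. if x \<in> - {0} then K x else 0) \<in> borel_measurable borel"
      using K(1) by (intro borel_measurable_continuous_on_if) auto
    also have "(\<lambda>x. if x \<in> - {0} then K x else 0) = K'" by (auto simp: K'_def)
    finally show ?thesis .
  qed
  define w where "w = (\<lambda>z. LBINT y. U (fst z, y) *\<^sub>R K' (snd z - y))"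
  have w_m: "w \<in> borel_measurable borel" unfolding w_def by measurable
  have "AE z in lborel. z \<in> ?Q \<longrightarrow> \<bar>U z\<bar> \<le> Cu \<and> u (fst z) (snd z) = U z"
    using U Cu by eventually_elim (auto simp: case_prod_unfold)
  from lborel_pair.AE_pair[unfolded lborel_prod, OF this]
  have slices: "AE t in lborel. AE y in lborel. t \<in> {0<..<T} \<longrightarrow> \<bar>U (t, y)\<bar> \<le> Cu \<and> u t y = U (t, y)"
    by simp
  define k1 where "k1 = (\<lambda>y. indicator (cball 0 1) y * norm (K' y))"
  have k1: "integrable lborel k1"
  proof -
    have c [measurable]: "cball (0::'a) 1 \<in> sets borel" by auto
    have k1_m: "k1 \<in> borel_measurable borel" unfolding k1_def by measurable
    have "integrable (lebesgue_on (cball 0 1)) (\<lambda>x. norm (K x))"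
      using K(2) by (simp add: Lp_def)
    moreover have "AE x in lborel. x \<in> cball 0 1 \<longrightarrow> norm (K x) = k1 x"
      using AE_lborel_singleton[of 0] by eventually_elim (auto simp: k1_def K'_def)
    ultimately show ?thesis
      by (subst (asm) integral_lebesgue_on_eq_lborel(2)[OF c k1_m]) (auto simp: k1_def)
  qed
  obtain CK where CK: "AE x in lborel. x \<in> - cball 0 1 \<longrightarrow> norm (K x) \<le> CK"
    using K(3) by (auto simp: Linf_def AE_lebesgue_on_iff)
  define L where "L = \<bar>Cu\<bar> * (LBINT y. k1 y) + \<bar>CK\<bar> * 1"
  have main: "AE t in lborel. t \<in> {0<..<T} \<longrightarrow> (\<forall>x. conv K (u t) x = w (t, x) \<and> norm (w (t, x)) \<le> L)"
    using slices
  proof eventually_elim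
    case (elim t)
    show ?case
    proof (intro impI allI)
      fix x assume t: "t \<in> {0<..<T}"
      have pd: "u t \<in> prob_densities" by (rule ut[OF t])
      have eq: "AE y in lborel. u t y *\<^sub>R K (x - y) = U (t, y) *\<^sub>R K' (x - y)"
        using elim AE_lborel_singleton[of x] by eventually_elim (use t in \<open>auto simp: K'_def\<close>)
      have "conv K (u t) x = integral\<^sup>L (lebesgue_on UNIV) (\<lambda>y. u t y *\<^sub>R K (x - y))"
        by (simp add: conv_def lebesgue_on_UNIV_eq)
      also have "\<dots> = w (t, x)"
        unfolding w_def by (subst integral_lebesgue_on_eq_lborel(1)) (use eq in auto)
      finally have 1: "conv K (u t) x = w (t, x)" .
      have Ut: "integrable lborel (\<lambda>y. \<bar>U (t, y)\<bar>)" "(LBINT y. \<bar>U (t, y)\<bar>) = 1"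
      proof -
        have ut1: "AE y in lborel. y \<in> UNIV \<longrightarrow> u t y = \<bar>U (t, y)\<bar>"
        proof -
          have "AE y in lborel. 0 \<le> u t y" using pd by (simp add: prob_densities_def AE_completion_iff)
          then show ?thesis using elim by eventually_elim (use t in auto)
        qed
        have "integrable lebesgue (\<lambda>y. norm (u t y))" and one: "integral\<^sup>L lebesgue (u t) = 1"
          using pd by (auto simp: prob_densities_def Lp_def)
        moreover have "u t \<in> borel_measurable lebesgue" using pd by (auto simp: prob_densities_def Lp_def)
        ultimately have "integrable lebesgue (u t)" using integrable_norm_iff by blast
        then show "integrable lborel (\<lambda>y. \<bar>U (t, y)\<bar>)"
          using integral_lebesgue_on_eq_lborel(2)[OF _ _ ut1] by (simp add: lebesgue_on_UNIV_eq)
        show "(LBINT y. \<bar>U (t, y)\<bar>) = 1"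
          using integral_lebesgue_on_eq_lborel(1)[OF _ _ ut1] one by (simp add: lebesgue_on_UNIV_eq)
      qed
      define G where "G = (\<lambda>y. \<bar>Cu\<bar> * k1 (x - y) + \<bar>CK\<bar> * \<bar>U (t, y)\<bar>)"
      have Gi: "integrable lborel G"
        unfolding G_def by (intro Bochner_Integration.integrable_add integrable_mult_right integrable_reflect k1 Ut)
      have bd: "AE y in lborel. norm (U (t, y) *\<^sub>R K' (x - y)) \<le> G y"
        using elim AE_reflect[OF CK, of x]
      proof eventually_elim
        case (elim y)
        show ?case
        proof (cases "x - y \<in> cball 0 1")
          case True
          have "\<bar>U (t, y)\<bar> * norm (K' (x - y)) \<le> \<bar>Cu\<bar> * norm (K' (x - y))"
            using elim(1) t by (intro mult_right_mono) auto
          also have "\<dots> = \<bar>Cu\<bar> * k1 (x - y)" using True by (simp add: k1_def)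
          also have "\<dots> \<le> G y" by (simp add: G_def)
          finally show ?thesis by simp
        next
          case False
          then have "norm (K' (x - y)) \<le> \<bar>CK\<bar>" using elim(2) by (auto simp: K'_def)
          then have "\<bar>U (t, y)\<bar> * norm (K' (x - y)) \<le> \<bar>U (t, y)\<bar> * \<bar>CK\<bar>" by (intro mult_left_mono) auto
          also have "\<dots> \<le> G y" by (simp add: G_def k1_def mult.commute)
          finally show ?thesis by simp
        qed
      qed
      have fi: "integrable lborel (\<lambda>y. U (t, y) *\<^sub>R K' (x - y))"
      proof (rule Bochner_Integration.integrable_bound[OF Gi])
        show "AE y in lborel. norm (U (t, y) *\<^sub>R K' (x - y)) \<le> norm (G y)"
          using bd by eventually_elim auto
      qed measurable
      have "norm (w (t, x)) \<le> (LBINT y. norm (U (t, y) *\<^sub>R K' (x - y)))"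
        unfolding w_def fst_conv snd_conv by (rule integral_norm_bound)
      also have "\<dots> \<le> (LBINT y. G y)"
        by (rule integral_mono_AE[OF integrable_norm[OF fi] Gi bd])
      also have "\<dots> = L"
        unfolding G_def L_def using k1 Ut integrable_reflect[OF k1, of x] integral_reflect[OF k1, of x] by simp
      finally show "conv K (u t) x = w (t, x) \<and> norm (w (t, x)) \<le> L" using 1 by simp
    qed
  qed
  have "AE z in (lborel :: (real \<times> 'a) measure). fst z \<in> {0<..<T} \<longrightarrow> (\<forall>x. conv K (u (fst z)) x = w (fst z, x) \<and> norm (w (fst z, x)) \<le> L)"
    by (rule AE_lborel_prod_fst[OF main])
  then have "AE z in lborel. z \<in> ?Q \<longrightarrow> conv K (u (fst z)) (snd z) = w z"
    "AE z in lborel. z \<in> ?Q \<longrightarrow> norm (w z) \<le> L"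
    by (auto elim!: eventually_mono)
  then show ?thesis using that[OF w_m] by blast
qed

lemma wave_deriv_grad_laplacian:
  fixes x :: "'a::euclidean_space"
  assumes \<eta>: "(\<eta> has_real_derivative \<eta>' t) (at t)"
  shows "deriv (\<lambda>s. \<eta> s * wave \<epsilon> \<theta> \<xi> x) t = \<eta>' t * wave \<epsilon> \<theta> \<xi> x"
    and "laplacian (\<lambda>y. \<eta> t * wave \<epsilon> \<theta> \<xi> y) x = \<eta> t * laplacian (wave \<epsilon> \<theta> \<xi>) x"
    and "grad (\<lambda>y. \<eta> t * wave \<epsilon> \<theta> \<xi> y) x = \<eta> t *\<^sub>R grad (wave \<epsilon> \<theta> \<xi>) x"
  using laplacian_cmult[OF smooth_expr_wave[OF bounded_linear_ident]] grad_cmult[OF smooth_expr_differentiable[OF smooth_expr_wave[OF bounded_linear_ident]]]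
  by (auto intro!: DERIV_imp_deriv derivative_eq_intros \<eta>)

section \<open>Uniqueness for the linear equation\<close>

theorem theorem4p3:
  fixes \<beta> b :: "real \<Rightarrow> real"
    and D K :: "real ^ 'd \<Rightarrow> real ^ 'd"
    and u0 v0 :: "real ^ 'd \<Rightarrow> real"
    and u :: "real \<Rightarrow> real ^ 'd \<Rightarrow> real"
    and v1 v2 :: "real \<times> (real ^ 'd) \<Rightarrow> real"
    and T :: real
  assumes dim: "CARD('d) \<ge> 2"
    and beta: "\<beta> C1_differentiable_on UNIV" "\<beta> 0 = 0" "\<exists>\<alpha>>0. \<forall>r. deriv \<beta> r \<ge> \<alpha>"
    and D: "D \<in> Linf lebesgue" "D \<in> Lp 2 lebesgue"
      "\<forall>\<phi>\<in>test_functions UNIV. (\<forall>x. \<phi> x \<ge> 0) \<longrightarrow> - (LINT x|lebesgue. D x \<bullet> grad \<phi> x) \<ge> 0"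
    and b: "b C1_differentiable_on UNIV" "\<forall>r. b r \<ge> 0"
    and K: "Ck_on 1 (- {0}) K" "K \<in> Lp 1 (lebesgue_on (cball 0 1))"
      "\<exists>p. 1 \<le> p \<and> p \<le> 2 \<and> K \<in> Lp p (lebesgue_on (- cball 0 1))"
      "(\<lambda>x. neg_part (divergence K x)) \<in> Linf (lebesgue_on (- {0}))"
      "(\<lambda>x. neg_part (K x \<bullet> x) / norm x) \<in> Linf (lebesgue_on (cball 0 1))"
      "K \<in> Linf (lebesgue_on (- cball 0 1))"
    and T: "T > 0"
    and u0: "u0 \<in> prob_densities" "u0 \<in> Linf lebesgue"
    and u: "density_solution \<beta> D b K u0 u"
      "(\<lambda>(t, x). u t x) \<in> Linf (lebesgue_on ({0<..<T} \<times> UNIV))"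
      "(\<lambda>(t, x). u t x) \<in> Lp 1 (lebesgue_on ({0<..<T} \<times> UNIV))"
    and v0: "v0 \<in> L1_loc"
    and v1: "linear_solution T \<beta> D b K u v0 v1"
    and v2: "linear_solution T \<beta> D b K u v0 v2"
    and initial: "\<forall>\<psi>\<in>test_functions UNIV.
      ((\<lambda>t. esssup (lebesgue_on {0<..<t})
              (\<lambda>s. ereal (LINT x|lebesgue. (v1 (s, x) - v2 (s, x)) * \<psi> x))) \<longlongrightarrow> 0) (at_right 0)"
  shows "AE z in lebesgue_on ({0<..<T} \<times> UNIV). v1 z = v2 z"
proof -
  define Q where "Q = {0<..<T} \<times> (UNIV :: (real ^ 'd) set)"
  have Q: "Q \<in> sets borel" unfolding Q_def by (intro borel_open open_Times) auto
  have Q_iff: "z \<in> Q \<longleftrightarrow> fst z \<in> {0<..<T}" for z by (cases z) (auto simp: Q_def)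
  define v where "v = (\<lambda>z. v1 z - v2 z)"
  define aq where "aq = (\<lambda>z. beta_quot \<beta> (u (fst z) (snd z)))"
  define Bq where "Bq = (\<lambda>z. b (u (fst z) (snd z)) *\<^sub>R D (snd z) + conv K (u (fst z)) (snd z))"
  obtain \<alpha> where \<alpha>: "\<alpha> > 0" "\<And>r. deriv \<beta> r \<ge> \<alpha>" using beta(3) by auto
  note bq = beta_quot_bounds[OF beta(1,2) \<alpha>(2)]
  have "integrable (lebesgue_on Q) f" if "linear_solution T \<beta> D b K u v0 f" for f
  proof -
    have "f \<in> borel_measurable (lebesgue_on Q)" "integrable (lebesgue_on Q) (\<lambda>z. norm (f z))"
      using that by (simp_all add: linear_solution_def Lp_def Q_def[symmetric])
    then show ?thesis using integrable_norm_iff by blast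
  qed
  then have vi: "integrable (lebesgue_on Q) v1" "integrable (lebesgue_on Q) v2"
    using v1 v2 by auto
  obtain C1 C2 where C12: "AE z in lborel. z \<in> Q \<longrightarrow> \<bar>v1 z\<bar> \<le> C1" "AE z in lborel. z \<in> Q \<longrightarrow> \<bar>v2 z\<bar> \<le> C2"
    using v1 v2 by (auto simp: linear_solution_def Linf_def Q_def[symmetric] AE_lebesgue_on_iff[OF Q])
  define C where "C = \<bar>C1\<bar> + \<bar>C2\<bar>"
  have v_bd: "AE z in lborel. z \<in> Q \<longrightarrow> \<bar>v z\<bar> \<le> C"
    using C12 by eventually_elim (auto simp: v_def C_def)
  have v_m: "v \<in> borel_measurable (lebesgue_on Q)" using vi unfolding v_def by auto
  have u_m: "(\<lambda>z. u (fst z) (snd z)) \<in> borel_measurable (lebesgue_on Q)"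
    using u(2) by (simp add: Linf_def Q_def case_prod_unfold)
  obtain Cu where Cu: "AE z in lborel. z \<in> Q \<longrightarrow> \<bar>u (fst z) (snd z)\<bar> \<le> Cu"
    using u(2) by (auto simp: Linf_def Q_def[symmetric] AE_lebesgue_on_iff[OF Q] case_prod_unfold)
  have aq_m: "aq \<in> borel_measurable (lebesgue_on Q)"
    unfolding aq_def by (rule measurable_compose[OF u_m bq(1)])
  obtain La where La: "\<And>r. \<bar>r\<bar> \<le> Cu \<Longrightarrow> beta_quot \<beta> r \<le> La" using bq(3) by blast
  have aq_le: "AE z in lborel. z \<in> Q \<longrightarrow> aq z \<le> La"
    using Cu by eventually_elim (auto simp: aq_def La)
  have b_cont: "continuous_on UNIV b"
  proof -
    obtain b' where "\<And>x. (b has_vector_derivative b' x) (at x)"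
      using b(1) by (auto simp: C1_differentiable_on_def)
    then show ?thesis
      by (meson continuous_at_imp_continuous_on has_vector_derivative_continuous)
  qed
  have "bounded (b ` {-Cu..Cu})"
    using b_cont by (intro compact_imp_bounded compact_continuous_image) (auto intro: continuous_on_subset)
  then obtain Lb where Lb': "\<forall>y\<in>b ` {-Cu..Cu}. norm y \<le> Lb" unfolding bounded_iff by blast
  have Lb: "\<bar>b r\<bar> \<le> Lb" if "\<bar>r\<bar> \<le> Cu" for r
  proof -
    have "r \<in> {-Cu..Cu}" using that by auto
    then have "norm (b r) \<le> Lb" using Lb' by blast
    then show ?thesis by simp
  qed
  have D_m: "D \<in> borel_measurable (lebesgue_on UNIV)" using D(1) by (simp add: Linf_def lebesgue_on_UNIV_eq)
  obtain CD where "AE x in lborel. norm (D x) \<le> CD"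
    using D(1) by (auto simp: Linf_def AE_completion_iff)
  then have CD: "AE z in (lborel :: (real \<times> (real ^ 'd)) measure). norm (D (snd z)) \<le> CD"
    by (rule AE_lborel_prod_snd)
  obtain D' where D': "D' \<in> borel_measurable borel" "AE x in lborel. x \<in> UNIV \<longrightarrow> D x = D' x"
    by (rule lebesgue_borel_representative[OF _ D_m]) auto
  have D_m2: "(\<lambda>z. D (snd z)) \<in> borel_measurable (lebesgue_on Q)"
  proof (rule measurable_lebesgue_on_if_AE_eq[OF Q])
    show "(\<lambda>z::real \<times> (real ^ 'd). D' (snd z)) \<in> borel_measurable borel" by (rule measurable_compose[OF borel_measurable_snd D'(1)])
    show "AE z in lborel. z \<in> Q \<longrightarrow> D (snd z) = D' (snd z)"
      using AE_lborel_prod_snd[OF D'(2)] by eventually_elim auto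
  qed
  have K_cont: "continuous_on (- {0}) K"
  proof (rule continuous_at_imp_continuous_on, rule ballI)
    fix x assume "x \<in> - {0 :: real ^ 'd}"
    then have "K differentiable (at x)" using K(1) by simp
    then show "isCont K x" by (rule differentiable_imp_continuous_within)
  qed
  have ut: "u t \<in> prob_densities" if "t \<in> {0<..<T}" for t
    using u(1) that by (auto simp: density_solution_def)
  obtain w Lw where w: "w \<in> borel_measurable borel"
    "AE z in lborel. z \<in> Q \<longrightarrow> conv K (u (fst z)) (snd z) = w z"
    "AE z in lborel. z \<in> Q \<longrightarrow> norm (w z) \<le> Lw"
    using conv_representative[OF K_cont K(2,6) u(2) ut] unfolding Q_def by blast
  have Bq_m: "Bq \<in> borel_measurable (lebesgue_on Q)"
    unfolding Bq_def
    by (intro borel_measurable_add borel_measurable_scaleR D_m2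
        measurable_compose[OF u_m borel_measurable_continuous_onI[OF b_cont]]
        measurable_lebesgue_on_if_AE_eq[OF Q w(1,2)])
  have Bq_bd: "AE z in lborel. z \<in> Q \<longrightarrow> norm (Bq z) \<le> Lb * CD + Lw"
    using Cu CD w(2,3)
  proof eventually_elim
    case (elim z)
    show ?case
    proof
      assume z: "z \<in> Q"
      have "norm (b (u (fst z) (snd z)) *\<^sub>R D (snd z)) \<le> Lb * CD"
        unfolding norm_scaleR using Lb elim z by (intro mult_mono) (auto intro: order_trans[OF abs_ge_zero])
      moreover have "norm (conv K (u (fst z)) (snd z)) \<le> Lw" using elim z by simp
      ultimately show "norm (Bq z) \<le> Lb * CD + Lw"
        unfolding Bq_def by (meson add_mono norm_triangle_le)
    qed
  qed
  define M where "M = max 1 (max \<alpha> (max La (Lb * CD + Lw)))"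
  have M: "1 \<le> M" "\<alpha> \<le> M" "La \<le> M" "Lb * CD + Lw \<le> M" by (auto simp: M_def)
  obtain v' where [measurable]: "v' \<in> borel_measurable borel" and v': "AE z in lborel. z \<in> Q \<longrightarrow> v z = v' z"
    by (rule lebesgue_borel_representative[OF Q v_m])
  obtain a' where [measurable]: "a' \<in> borel_measurable borel" and a': "AE z in lborel. z \<in> Q \<longrightarrow> aq z = a' z"
    by (rule lebesgue_borel_representative[OF Q aq_m])
  obtain B' where [measurable]: "B' \<in> borel_measurable borel" and B': "AE z in lborel. z \<in> Q \<longrightarrow> Bq z = B' z"
    by (rule lebesgue_borel_representative[OF Q Bq_m])
  have [measurable]: "Q \<in> sets borel" by (rule Q)
  \<comment> \<open>Cutting off the Borel representatives at the essential bounds changes them on a null set only.\<close>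
  define vb where "vb = (\<lambda>z. if z \<in> Q \<and> \<bar>v' z\<bar> \<le> C then v' z else 0)"
  define ab where "ab = (\<lambda>z. max \<alpha> (min M (a' z)))"
  define Bb where "Bb = (\<lambda>z. if norm (B' z) \<le> M then B' z else 0)"
  have rep: "AE z in lborel. z \<in> Q \<longrightarrow> v z = vb z \<and> aq z = ab z \<and> Bq z = Bb z"
    using v' a' B' v_bd aq_le Bq_bd
  proof eventually_elim
    case (elim z)
    show ?case
    proof
      assume z: "z \<in> Q"
      have "\<alpha> \<le> aq z" unfolding aq_def by (rule bq(2))
      then show "v z = vb z \<and> aq z = ab z \<and> Bq z = Bb z"
        using elim z M by (auto simp: vb_def ab_def Bb_def)
    qed
  qed
  have [measurable]: "vb \<in> borel_measurable borel" "ab \<in> borel_measurable borel" "Bb \<in> borel_measurable borel"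
    unfolding vb_def ab_def Bb_def by measurable
  have vb0: "vb z = 0" if "z \<notin> Q" for z using that by (simp add: vb_def)
  interpret uniformly_parabolic_equation T vb ab Bb \<alpha> M C
  proof
    show "integrable lborel vb"
    proof (subst integral_lebesgue_on_eq_lborel(2)[OF Q _ _ vb0, symmetric])
      show "AE z in lborel. z \<in> Q \<longrightarrow> v z = vb z" using rep by eventually_elim auto
      show "integrable (lebesgue_on Q) v" unfolding v_def using vi by auto
    qed auto
    show "\<bar>vb z\<bar> \<le> C" for z by (simp add: vb_def C_def)
    show "vb z = 0" if "fst z \<notin> {0<..<T}" for z using that vb0 Q_iff by auto
    show "\<alpha> \<le> ab z" "ab z \<le> M" for z using M by (auto simp: ab_def)
    show "norm (Bb z) \<le> M" for z using M by (simp add: Bb_def)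
    show "(LBINT z. vb z * (\<eta>' (fst z) * wave \<epsilon> \<theta> \<xi> (snd z) + ab z * (\<eta> (fst z) * laplacian (wave \<epsilon> \<theta> \<xi>) (snd z))
        + Bb z \<bullet> (\<eta> (fst z) *\<^sub>R grad (wave \<epsilon> \<theta> \<xi>) (snd z)))) = 0"
      if \<eta>: "\<And>t. (\<eta> has_real_derivative \<eta>' t) (at t)" "continuous_on UNIV \<eta>'"
        "smooth_expr (\<lambda>z::real \<times> (real ^ 'd). \<eta> (fst z))" "e < T" "\<And>t. t \<notin> {-3..e} \<Longrightarrow> \<eta> t = 0"
        and \<epsilon>: "0 < \<epsilon>" "\<epsilon> \<le> 1" for \<eta> \<eta>' e \<epsilon> \<theta> and \<xi> :: "real ^ 'd"
    proof -
      define k where "k = (\<lambda>A B z. \<eta>' (fst z) * wave \<epsilon> \<theta> \<xi> (snd z) + A z * (\<eta> (fst z) * laplacian (wave \<epsilon> \<theta> \<xi>) (snd z))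
        + B z \<bullet> (\<eta> (fst z) *\<^sub>R grad (wave \<epsilon> \<theta> \<xi>) (snd z)))"
      have c\<eta>: "continuous_on UNIV \<eta>"
        using \<eta>(1) by (meson DERIV_continuous continuous_at_imp_continuous_on)
      have [measurable]: "\<eta> \<in> borel_measurable borel" "\<eta>' \<in> borel_measurable borel"
        using c\<eta> \<eta>(2) by (auto intro: borel_measurable_continuous_onI)
      have kb_m [measurable]: "k ab Bb \<in> borel_measurable borel" unfolding k_def by measurable
      have "0 \<le> M" using M by linarith
      obtain L where L: "\<And>t x p q. t \<in> {0<..<T} \<Longrightarrow> \<bar>p\<bar> \<le> M \<Longrightarrow> norm q \<le> M \<Longrightarrow>
          \<bar>\<eta>' t * wave \<epsilon> \<theta> \<xi> x + p * (\<eta> t * laplacian (wave \<epsilon> \<theta> \<xi>) x) + q \<bullet> (\<eta> t *\<^sub>R grad (wave \<epsilon> \<theta> \<xi>) x)\<bar> \<le> L"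
        by (rule wave_test_bound[OF c\<eta> \<eta>(2) \<open>0 \<le> M\<close>, of T \<theta> \<xi>]) (use \<epsilon> in blast)
      have kL: "\<bar>k ab Bb z\<bar> \<le> L" if "z \<in> Q" for z
        unfolding k_def using that M \<alpha>(1) by (intro L) (auto simp: Q_iff ab_def Bb_def)
      have k_eq: "AE z in lborel. z \<in> Q \<longrightarrow> k aq Bq z = k ab Bb z"
        using rep by eventually_elim (auto simp: k_def)
      have ki: "integrable (lebesgue_on Q) (\<lambda>z. f z * k aq Bq z)" if f: "integrable (lebesgue_on Q) f" for f
      proof (rule Bochner_Integration.integrable_bound)
        show "integrable (lebesgue_on Q) (\<lambda>z. L * f z)" using f by simp
        show "(\<lambda>z. f z * k aq Bq z) \<in> borel_measurable (lebesgue_on Q)"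
          using f by (intro borel_measurable_times measurable_lebesgue_on_if_AE_eq[OF Q kb_m k_eq]) auto
        have "AE z in lborel. z \<in> Q \<longrightarrow> norm (f z * k aq Bq z) \<le> norm (L * f z)"
          using k_eq
        proof eventually_elim
          case (elim z)
          show ?case
          proof
            assume z: "z \<in> Q"
            have "\<bar>f z\<bar> * \<bar>k aq Bq z\<bar> \<le> \<bar>f z\<bar> * \<bar>L\<bar>"
              using elim kL[OF z] z by (intro mult_left_mono) auto
            then show "norm (f z * k aq Bq z) \<le> norm (L * f z)" by (simp add: abs_mult mult.commute)
          qed
        qed
        then show "AE z in lebesgue_on Q. norm (f z * k aq Bq z) \<le> norm (L * f z)"
          by (simp add: AE_lebesgue_on_iff[OF Q])
      qed
      define \<phi> where "\<phi> = (\<lambda>z::real \<times> (real ^ 'd). \<eta> (fst z) * wave \<epsilon> \<theta> \<xi> (snd z))"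
      have \<phi>: "\<phi> \<in> test_functions ({..<T} \<times> UNIV)"
        unfolding \<phi>_def by (rule wave_test_function[OF \<epsilon>(1) \<eta>(3,5,4)])
      have bracket: "deriv (\<lambda>s. \<phi> (s, x)) t + beta_quot \<beta> (u t x) * laplacian (\<lambda>y. \<phi> (t, y)) x
            + (b (u t x) *\<^sub>R D x + conv K (u t) x) \<bullet> grad (\<lambda>y. \<phi> (t, y)) x = k aq Bq (t, x)" for t x
        unfolding \<phi>_def fst_conv snd_conv wave_deriv_grad_laplacian[of \<eta> \<eta>', OF \<eta>(1)]
        by (simp add: k_def aq_def Bq_def)
      \<comment> \<open>The initial datum contributes the same term for both solutions, so it drops out of the difference.\<close>
      have tested: "integral\<^sup>L (lebesgue_on Q) (\<lambda>z. f z * k aq Bq z) + (LINT x|lebesgue. v0 x * \<phi> (0, x)) = 0"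
        if "linear_solution T \<beta> D b K u v0 f" for f
        using that \<phi> by (auto simp: linear_solution_def bracket Q_def[symmetric] case_prod_unfold)
      have "integral\<^sup>L (lebesgue_on Q) (\<lambda>z. v z * k aq Bq z) = 0"
      proof -
        have "integral\<^sup>L (lebesgue_on Q) (\<lambda>z. v z * k aq Bq z)
            = integral\<^sup>L (lebesgue_on Q) (\<lambda>z. v1 z * k aq Bq z) - integral\<^sup>L (lebesgue_on Q) (\<lambda>z. v2 z * k aq Bq z)"
          unfolding v_def left_diff_distrib by (intro Bochner_Integration.integral_diff ki vi)
        then show ?thesis using tested[OF v1] tested[OF v2] by simp
      qed
      moreover have "integral\<^sup>L (lebesgue_on Q) (\<lambda>z. v z * k aq Bq z) = (LBINT z. vb z * k ab Bb z)"
      proof (rule integral_lebesgue_on_eq_lborel(1)[OF Q])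
        show "AE z in lborel. z \<in> Q \<longrightarrow> v z * k aq Bq z = vb z * k ab Bb z"
          using rep k_eq by eventually_elim auto
      qed (auto simp: vb0)
      ultimately show ?thesis by (simp add: k_def)
    qed
  qed (use T \<alpha> M in auto)
  have "AE z in lborel. z \<in> Q \<longrightarrow> v1 z = v2 z"
    using solution_is_zero rep by eventually_elim (auto simp: v_def)
  then have "AE z in lebesgue_on Q. v1 z = v2 z" by (simp only: AE_lebesgue_on_iff[OF Q])
  then show ?thesis unfolding Q_def .
qed

end
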